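(* For each structured class of $n$-qudit quantum states (local dimension $d$) listed below, let $N_{\mathrm{type}}$ denote the covering number, under the Frobenius norm, of the parameter set associated with the class (the parameter sets and the resolutions used are specified in the context). Then the logarithms of the covering numbers satisfy: 1. Physical states (PHY): $\log N_{\mathrm{type}}=O(d^{2n})$. 2. $s$-sparse states (S): $\log N_{\mathrm{type}}=O\big(s\log\frac{d^{2n}}{s}\big)$. 3. Rank-$r^{\mathrm{LR}}$ states (LR), given either as density matrices or through factors $F\in\mathbb{C}^{d^n\times r^{\mathrm{LR}}}$: $\log N_{\mathrm{type}}=O(d^n r^{\mathrm{LR}})$. 4. Low-rank and sparse states (LR-S), given through factors with $t$ nonzero entries: $\log N_{\mathrm{type}}=O\big(t^2\log\frac{d^{2n}}{t^2}\big)$. 5. Matrix product states (MPS) with bond dimensions $r_0=1,r_1,\dots,r_{n-1},r_n=1$: $\log N_{\mathrm{type}}=O\big(\sum_{\ell=1}^n d\,r_{\ell-1}r_\ell\log n\big)$. 6. Matrix product operators (MPO) with bond dimensions $r_0=1,r_1,\dots,r_{n-1},r_n=1$: $\log N_{\mathrm{type}}=O\big(\sum_{\ell=1}^n d^2\,r_{\ell-1}r_\ell\log n\big)$. 7. Low-rank matrix product operators (LR-MPO) with factor bond dimensions $r_0=1,r_1,\dots,r_{n-1},r_n=1$: $\log N_{\mathrm{type}}=O\big(\sum_{\ell=1}^n d^2\,r_{\ell-1}^2r_\ell^2\log n\big)$. 8. Projected entangled-pair states (PEPS) on a $q_0\times p_0$ lattice, $n=q_0p_0$: $\log N_{\mathrm{type}}=O\big(\sum_{a=1}^{q_0}\sum_{b=1}^{p_0}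 d\,R_{a,b}\log n\big)$, where $R_{a,b}$ is the product of the four bond dimensions of the edges at site $(a,b)$ (left, up, right, down). 9. Projected entangled-pair operators (PEPO) on a $q_0\times p_0$ lattice, $n=q_0p_0$: $\log N_{\mathrm{type}}=O\big(\sum_{a=1}^{q_0}\sum_{b=1}^{p_0} d^2\,R_{a,b}\log n\big)$. 10. Low-rank projected entangled-pair operators (LR-PEPO) on a $q_0\times p_0$ lattice, $n=q_0p_0$, with $R_{a,b}$ the product of the four factor bond dimensions at site $(a,b)$: $\log N_{\mathrm{type}}=O\big(\sum_{a=1}^{q_0}\sum_{b=1}^{p_0} d^2\,R_{a,b}^2\log n\big)$.
   Context: The covering number of a set at resolution $\epsilon$ under the Frobenius norm is the minimum number of Frobenius-norm balls of radius $\epsilon$ required to cover the set. $\|\cdot\|_F$ is the Frobenius norm, $\|\cdot\|_2$ the Euclidean norm, $\|\cdot\|_0$ the number of nonzero entries. $O(\cdot)$ hides a universal constant. Row and column indices of $d^n$-dimensional objects are multi-indices $i_1\cdots i_n$ with $i_\ell\in\{1,\dots,d\}$. Parameter sets and resolutions: - PHY: $\{\rho\in\mathbb{C}^{d^n\times d^n}:\operatorname{trace}\rho=0,\ \|\rho\|_F=1\}$; $\epsilon=\frac12$. - S: $\{\rho\in\mathbb{C}^{d^n\times d^n}:\operatorname{trace}\rho=0,\ \|\rho\|_F=1,\ \|\rho\|_0=s\}$; $\epsilon=\frac14$. - LR: $\{\rho\in\mathbb{C}^{d^n\times d^n}:\operatorname{trace}\rho=0,\ \|\rho\|_F=1,\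 \operatorname{rank}\rho=r^{\mathrm{LR}}\}$; $\epsilon=\frac14$. For the factor version (states $FF^\dagger$ with $F\in\mathbb{C}^{d^n\times r^{\mathrm{LR}}}$, $\|F\|_F=1$), the normalized differences $(F_1F_1^\dagger-F_2F_2^\dagger)/\|F_1F_1^\dagger-F_2F_2^\dagger\|_F$ are placed in the same set with $r^{\mathrm{LR}}$ replaced by $2r^{\mathrm{LR}}$. - LR-S (states $FF^\dagger$ with $F\in\mathbb{C}^{d^n\times r^{\mathrm{LR}}}$, $\|F\|_0=t$, $\|F\|_F=1$): $\{\rho\in\mathbb{C}^{d^n\times d^n}:\operatorname{trace}\rho=0,\ \|\rho\|_F=1,\ \operatorname{rank}\rho=2r^{\mathrm{LR}},\ \|\rho\|_0=2t^2\}$, in which the normalized differences of two such states are placed; $\epsilon=\frac14$. - MPS: $\{f\in\mathbb{C}^{d^n}:\|f\|_2=1,\ f(i_1\cdots i_n)=X_1^{i_1}\cdots X_n^{i_n},\ X_\ell^{i}\in\mathbb{C}^{r_{\ell-1}\times r_\ell},\ r_0=r_n=1\}$; $\epsilon=\frac1{4n}$. - MPO: $\{\rho\in\mathbb{C}^{d^n\times d^n}:\operatorname{trace}\rho=0,\ \|\rho\|_F=1,\ \rho(i_1\cdots i_n,j_1\cdots j_n)=X_1^{i_1,j_1}\cdots X_n^{i_n,j_n},\ X_\ell^{i,j}\in\mathbb{C}^{r_{\ell-1}\times r_\ell},\ r_0=r_n=1\}$; $\epsilon=\frac1{2n}$. - LR-MPO: the states are $FF^\dagger$, where $F\in\mathbb{C}^{d^n\times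 r^{\mathrm{LR}}}$, $\|F\|_F=1$, $F(i_1\cdots i_n,j)=X_1^{i_1}\cdots X_B^{i_B,j}\cdots X_n^{i_n}$ for a fixed site $B$ (only the matrices at site $B$ depend on $j\in\{1,\dots,r^{\mathrm{LR}}\}$), with local matrices of size $r_{\ell-1}\times r_\ell$. The parameter set, in which the normalized differences of two such states are placed, consists of all $\rho\in\mathbb{C}^{d^n\times d^n}$ with $\operatorname{trace}\rho=0$, $\|\rho\|_F=1$, $\operatorname{rank}\rho=2r^{\mathrm{LR}}$ that are of the MPO form above with bond dimensions $2r_\ell^2$, $1\le\ell\le n-1$ (boundary dimensions $1$); $\epsilon=\frac1{2n}$. - PEPS: sites $(a,b)\in\{1,\dots,q_0\}\times\{1,\dots,p_0\}$; a bond dimension is attached to each lattice edge, edges leaving the lattice having bond dimension $1$. The local tensor $X_{a,b}$ has one physical index in $\{1,\dots,d\}$ and one bond index for each of its four edges; $f=[X_{1,1},\dots,X_{q_0,p_0}]\in\mathbb{C}^{d^n}$ is the vector whose entries are obtained by summing the product of all local tensor entries over all bond indices. With given radii $L_{a,b}$ and $L$, the parameter set is $\{f=[X_{1,1},\dots,X_{q_0,p_0}]:\|X_{a,b}\|_F\le L_{a,b}\text{ for all }(a,b)\}\cap\{f:\|f\|_2\le L\}$. The resolution is specified per site: $X_{a,b}$ is covered by Frobenius balls of radius $L_{a,b}\epsilon_{a,b}$, with $\epsilon_{a,b}=\frac1{4n}$. - PEPO: the same with two physical indices (row and column) per site, $\rho=[X_{1,1},\dots,X_{q_0,p_0}]\in\mathbb{C}^{d^n\times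 d^n}$, and the global constraint $\|\rho\|_F\le L$; $\epsilon_{a,b}=\frac1{2n}$. - LR-PEPO: the states are $FF^\dagger$, where $F\in\mathbb{C}^{d^n\times r^{\mathrm{LR}}}$, $\|F\|_F=1$, is a PEPS-type contraction in which only the local tensor at one fixed site $(B_1,B_2)$ carries the additional column index $j\in\{1,\dots,r^{\mathrm{LR}}\}$. A difference $F_1F_1^\dagger-F_2F_2^\dagger$ is a PEPO whose bond dimensions are $2$ times the squares of the factor bond dimensions; the parameter set is the PEPO parameter set with these bond dimensions, with $\epsilon_{a,b}=\frac1{2n}$. For the tensor-network classes the covers are constructed as products of nets for the local factors at the stated resolution. For MPS (and likewise MPO, LR-MPO) one uses that a unit-norm element can be represented with $L(X_\ell)^\dagger L(X_\ell)=I$ for $\ell\le n-1$ and $\|L(X_n)\|_F=1$, where $L(X_\ell)$ is the vertical stacking of the local matrices at site $\ell$; the nets for $L(X_\ell)$, $\ell\le n-1$, are taken in spectral norm and that for $L(X_n)$ in Frobenius norm.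
   Formalization: Items 5–10 are proved for n ≥ 2 (at n = 1, log n = 0 and the bounds fail). Item 2 is proved as stated for 2s ≤ d^{2n}, and for every s with s(1+log(d^{2n}/s)) instead, since at s = d^{2n} the stated bound is 0 and false. *)

theory Defs
  imports
    Complex_Main
    "HOL-Library.Extended_Real"
    "HOL-Library.FuncSet"
    "Jordan_Normal_Form.Matrix"
    "Jordan_Normal_Form.DL_Rank"
begin

section \<open>Covering numbers\<close>

text \<open>The cells of a cover are \<open>cell c\<close> for \<open>c \<in> centers\<close>.  The value is infinite if there is no
  finite cover, and \<open>0\<close> exactly for the empty set.\<close>

definition covering_number :: "('c \<Rightarrow> 'a set) \<Rightarrow> 'c set \<Rightarrow> 'a set \<Rightarrow> enat" where
  "covering_number cell centers S =
     (INF C \<in> {C. finite C \<and> C \<subseteq> centers \<and> S \<subseteq> (\<Union>c\<in>C. cell c)}. enat (card C))"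

definition log_enat :: "enat \<Rightarrow> ereal" where
  "log_enat N = (case N of enat k \<Rightarrow> (if k = 0 then - \<infinity> else ereal (ln (real k))) | \<infinity> \<Rightarrow> \<infinity>)"

definition vec_l2_norm :: "complex vec \<Rightarrow> real" where
  "vec_l2_norm v = sqrt (\<Sum>i<dim_vec v. (cmod (v $ i))\<^sup>2)"

definition frob_norm :: "complex mat \<Rightarrow> real" where
  "frob_norm A = sqrt (\<Sum>i<dim_row A. \<Sum>j<dim_col A. (cmod (A $$ (i, j)))\<^sup>2)"

text \<open>Closed balls; the centers range over the whole ambient space, not only over the covered set.\<close>

definition vec_covering_number :: "nat \<Rightarrow> real \<Rightarrow> complex vec set \<Rightarrow> enat" where
  "vec_covering_number N \<epsilon> =
     covering_number (\<lambda>c. {v \<in> carrier_vec N. vec_l2_norm (v - c) \<le> \<epsilon>}) (carrier_vec N)"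

definition mat_covering_number :: "nat \<Rightarrow> real \<Rightarrow> complex mat set \<Rightarrow> enat" where
  "mat_covering_number N \<epsilon> =
     covering_number (\<lambda>c. {A \<in> carrier_mat N N. frob_norm (A - c) \<le> \<epsilon>}) (carrier_mat N N)"


section \<open>Matrices without tensor structure\<close>

definition mat_trace :: "complex mat \<Rightarrow> complex" where
  "mat_trace A = (\<Sum>i<dim_row A. A $$ (i, i))"

definition mat_rank :: "complex mat \<Rightarrow> nat" where
  "mat_rank A = vec_space.rank (dim_row A) A"

definition num_nonzero :: "complex mat \<Rightarrow> nat" where
  "num_nonzero A = card {(i, j). i < dim_row A \<and> j < dim_col A \<and> A $$ (i, j) \<noteq> 0}"

definition phy_set :: "nat \<Rightarrow> nat \<Rightarrow> complex mat set" where
  "phy_set d n = {\<rho> \<in> carrier_mat (d ^ n) (d ^ n). mat_trace \<rho> = 0 \<and> frob_norm \<rho> = 1}"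

definition sparse_set :: "nat \<Rightarrow> nat \<Rightarrow> nat \<Rightarrow> complex mat set" where
  "sparse_set d n s = {\<rho> \<in> phy_set d n. num_nonzero \<rho> = s}"

definition lr_set :: "nat \<Rightarrow> nat \<Rightarrow> nat \<Rightarrow> complex mat set" where
  "lr_set d n r = {\<rho> \<in> phy_set d n. mat_rank \<rho> = r}"

definition lr_sparse_set :: "nat \<Rightarrow> nat \<Rightarrow> nat \<Rightarrow> nat \<Rightarrow> complex mat set" where
  "lr_sparse_set d n r t =
     {\<rho> \<in> phy_set d n. mat_rank \<rho> = 2 * r \<and> num_nonzero \<rho> = 2 * t\<^sup>2}"


section \<open>Matrix product states and operators\<close>

text \<open>The multi-index \<open>i\<^sub>1 \<dots> i\<^sub>n\<close> is encoded as the number \<open>i < d ^ n\<close> with these base-\<open>d\<close> digits,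
  \<open>i\<^sub>1\<close> being the most significant one; physical indices run from \<open>0\<close> to \<open>d - 1\<close>.\<close>

definition site_index :: "nat \<Rightarrow> nat \<Rightarrow> nat \<Rightarrow> nat \<Rightarrow> nat" where
  "site_index d n i l = (i div d ^ (n - l)) mod d"

text \<open>\<open>X 1 \<cdots> X l\<close>, for a first factor with one row.\<close>

fun chain_prod :: "(nat \<Rightarrow> complex mat) \<Rightarrow> nat \<Rightarrow> complex mat" where
  "chain_prod X 0 = 1\<^sub>m 1"
| "chain_prod X (Suc l) = chain_prod X l * X (Suc l)"

definition bond_dims :: "nat \<Rightarrow> (nat \<Rightarrow> nat) \<Rightarrow> bool" where
  "bond_dims n r \<longleftrightarrow> r 0 = 1 \<and> r n = 1 \<and> (\<forall>l \<le> n. 1 \<le> r l)"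

definition is_mps :: "nat \<Rightarrow> nat \<Rightarrow> (nat \<Rightarrow> nat) \<Rightarrow> complex vec \<Rightarrow> bool" where
  "is_mps d n r f \<longleftrightarrow> f \<in> carrier_vec (d ^ n) \<and>
     (\<exists>X :: nat \<Rightarrow> nat \<Rightarrow> complex mat.
        (\<forall>l \<in> {1..n}. \<forall>i < d. X l i \<in> carrier_mat (r (l - 1)) (r l)) \<and>
        (\<forall>i < d ^ n. f $ i = chain_prod (\<lambda>l. X l (site_index d n i l)) n $$ (0, 0)))"

definition is_mpo :: "nat \<Rightarrow> nat \<Rightarrow> (nat \<Rightarrow> nat) \<Rightarrow> complex mat \<Rightarrow> bool" where
  "is_mpo d n r \<rho> \<longleftrightarrow> \<rho> \<in> carrier_mat (d ^ n) (d ^ n) \<and>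
     (\<exists>X :: nat \<Rightarrow> nat \<Rightarrow> nat \<Rightarrow> complex mat.
        (\<forall>l \<in> {1..n}. \<forall>i < d. \<forall>j < d. X l i j \<in> carrier_mat (r (l - 1)) (r l)) \<and>
        (\<forall>i < d ^ n. \<forall>j < d ^ n.
           \<rho> $$ (i, j) =
             chain_prod (\<lambda>l. X l (site_index d n i l) (site_index d n j l)) n $$ (0, 0)))"

definition mps_set :: "nat \<Rightarrow> nat \<Rightarrow> (nat \<Rightarrow> nat) \<Rightarrow> complex vec set" where
  "mps_set d n r = {f. is_mps d n r f \<and> vec_l2_norm f = 1}"

definition mpo_set :: "nat \<Rightarrow> nat \<Rightarrow> (nat \<Rightarrow> nat) \<Rightarrow> complex mat set" where
  "mpo_set d n r = {\<rho> \<in> phy_set d n. is_mpo d n r \<rho>}"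

text \<open>For a factor \<open>F\<close> with bond dimensions \<open>r l\<close>, the matrix \<open>F F\<^sup>\<dagger>\<close> has bond dimensions \<open>(r l)\<^sup>2\<close>;
  a difference of two such matrices doubles the inner ones.\<close>

definition lr_mpo_bonds :: "nat \<Rightarrow> (nat \<Rightarrow> nat) \<Rightarrow> nat \<Rightarrow> nat" where
  "lr_mpo_bonds n r l = (if 1 \<le> l \<and> l < n then 2 * (r l)\<^sup>2 else 1)"

definition lr_mpo_set :: "nat \<Rightarrow> nat \<Rightarrow> nat \<Rightarrow> (nat \<Rightarrow> nat) \<Rightarrow> complex mat set" where
  "lr_mpo_set d n k r = {\<rho> \<in> mpo_set d n (lr_mpo_bonds n r). mat_rank \<rho> = 2 * k}"


section \<open>Projected entangled-pair states and operators\<close>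

text \<open>Site \<open>(a, b)\<close> of a \<open>q \<times> p\<close> lattice is in row \<open>a \<in> {1..q}\<close> and column \<open>b \<in> {1..p}\<close>.
  \<open>Hor a b\<close> joins \<open>(a, b)\<close> to \<open>(a, b + 1)\<close> and \<open>Ver a b\<close> joins \<open>(a, b)\<close> to \<open>(a + 1, b)\<close>; edges one
  of whose ends is not a site leave the lattice.\<close>

datatype lattice_edge = Hor nat nat | Ver nat nat

definition inner_edges :: "nat \<Rightarrow> nat \<Rightarrow> lattice_edge set" where
  "inner_edges q p = {Hor a b | a b. a \<in> {1..q} \<and> 1 \<le> b \<and> b < p} \<union>
                     {Ver a b | a b. 1 \<le> a \<and> a < q \<and> b \<in> {1..p}}"

definition lattice_edges :: "nat \<Rightarrow> nat \<Rightarrow> lattice_edge set" where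
  "lattice_edges q p = {Hor a b | a b. a \<in> {1..q} \<and> b \<in> {0..p}} \<union>
                       {Ver a b | a b. a \<in> {0..q} \<and> b \<in> {1..p}}"

definition lattice_bond_dims :: "nat \<Rightarrow> nat \<Rightarrow> (lattice_edge \<Rightarrow> nat) \<Rightarrow> bool" where
  "lattice_bond_dims q p D \<longleftrightarrow> (\<forall>e \<in> lattice_edges q p. 1 \<le> D e) \<and>
     (\<forall>e \<in> lattice_edges q p - inner_edges q p. D e = 1)"

abbreviation left_edge :: "nat \<Rightarrow> nat \<Rightarrow> lattice_edge" where "left_edge a b \<equiv> Hor a (b - 1)"
abbreviation up_edge :: "nat \<Rightarrow> nat \<Rightarrow> lattice_edge" where "up_edge a b \<equiv> Ver (a - 1) b"
abbreviation right_edge :: "nat \<Rightarrow> nat \<Rightarrow> lattice_edge" where "right_edge a b \<equiv> Hor a b"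
abbreviation down_edge :: "nat \<Rightarrow> nat \<Rightarrow> lattice_edge" where "down_edge a b \<equiv> Ver a b"

definition bond_product :: "(lattice_edge \<Rightarrow> nat) \<Rightarrow> nat \<Rightarrow> nat \<Rightarrow> nat" where
  "bond_product D a b =
     D (left_edge a b) * D (up_edge a b) * D (right_edge a b) * D (down_edge a b)"

text \<open>A local tensor is indexed by a physical index (for operators, a pair of row and column index)
  and the left, up, right and down bond indices.  Its values outside the index ranges are
  irrelevant.\<close>

type_synonym 'i local_tensor = "'i \<Rightarrow> nat \<Rightarrow> nat \<Rightarrow> nat \<Rightarrow> nat \<Rightarrow> complex"

definition local_norm ::
    "'i set \<Rightarrow> (lattice_edge \<Rightarrow> nat) \<Rightarrow> nat \<Rightarrow> nat \<Rightarrow> 'i local_tensor \<Rightarrow> real" where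
  "local_norm I D a b T = sqrt (\<Sum>i \<in> I. \<Sum>x < D (left_edge a b). \<Sum>y < D (up_edge a b).
     \<Sum>z < D (right_edge a b). \<Sum>w < D (down_edge a b). (cmod (T i x y z w))\<^sup>2)"

definition contraction :: "nat \<Rightarrow> nat \<Rightarrow> (lattice_edge \<Rightarrow> nat) \<Rightarrow>
    (nat \<Rightarrow> nat \<Rightarrow> 'i local_tensor) \<Rightarrow> (nat \<Rightarrow> nat \<Rightarrow> 'i) \<Rightarrow> complex" where
  "contraction q p D X i =
     (\<Sum>\<beta> \<in> (\<Pi>\<^sub>E e \<in> lattice_edges q p. {..<D e}). \<Prod>a = 1..q. \<Prod>b = 1..p.
        X a b (i a b) (\<beta> (left_edge a b)) (\<beta> (up_edge a b)) (\<beta> (right_edge a b)) (\<beta> (down_edge a b)))"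

text \<open>The sites are numbered \<open>1, \<dots>, q p\<close> row by row.\<close>

definition lattice_index :: "nat \<Rightarrow> nat \<Rightarrow> nat \<Rightarrow> nat \<Rightarrow> nat \<Rightarrow> nat \<Rightarrow> nat" where
  "lattice_index d q p i a b = site_index d (q * p) i ((a - 1) * p + b)"

definition peps_vec :: "nat \<Rightarrow> nat \<Rightarrow> nat \<Rightarrow> (lattice_edge \<Rightarrow> nat) \<Rightarrow>
    (nat \<Rightarrow> nat \<Rightarrow> nat local_tensor) \<Rightarrow> complex vec" where
  "peps_vec d q p D X =
     vec (d ^ (q * p)) (\<lambda>i. contraction q p D X (\<lambda>a b. lattice_index d q p i a b))"

definition pepo_mat :: "nat \<Rightarrow> nat \<Rightarrow> nat \<Rightarrow> (lattice_edge \<Rightarrow> nat) \<Rightarrow>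
    (nat \<Rightarrow> nat \<Rightarrow> (nat \<times> nat) local_tensor) \<Rightarrow> complex mat" where
  "pepo_mat d q p D X = mat (d ^ (q * p)) (d ^ (q * p))
     (\<lambda>(i, j). contraction q p D X (\<lambda>a b. (lattice_index d q p i a b, lattice_index d q p j a b)))"

definition bounded_tensors :: "'i set \<Rightarrow> nat \<Rightarrow> nat \<Rightarrow> (lattice_edge \<Rightarrow> nat) \<Rightarrow>
    (nat \<Rightarrow> nat \<Rightarrow> real) \<Rightarrow> (nat \<Rightarrow> nat \<Rightarrow> 'i local_tensor) set" where
  "bounded_tensors I q p D \<Lambda> =
     {X. \<forall>a \<in> {1..q}. \<forall>b \<in> {1..p}. local_norm I D a b (X a b) \<le> \<Lambda> a b}"

definition peps_set :: "nat \<Rightarrow> nat \<Rightarrow> nat \<Rightarrow> (lattice_edge \<Rightarrow> nat) \<Rightarrow>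
    (nat \<Rightarrow> nat \<Rightarrow> real) \<Rightarrow> real \<Rightarrow> complex vec set" where
  "peps_set d q p D \<Lambda> L =
     peps_vec d q p D ` bounded_tensors {..<d} q p D \<Lambda> \<inter> {f. vec_l2_norm f \<le> L}"

definition pepo_set :: "nat \<Rightarrow> nat \<Rightarrow> nat \<Rightarrow> (lattice_edge \<Rightarrow> nat) \<Rightarrow>
    (nat \<Rightarrow> nat \<Rightarrow> real) \<Rightarrow> real \<Rightarrow> complex mat set" where
  "pepo_set d q p D \<Lambda> L =
     pepo_mat d q p D ` bounded_tensors ({..<d} \<times> {..<d}) q p D \<Lambda> \<inter> {\<rho>. frob_norm \<rho> \<le> L}"

definition lr_pepo_bonds :: "nat \<Rightarrow> nat \<Rightarrow> (lattice_edge \<Rightarrow> nat) \<Rightarrow> lattice_edge \<Rightarrow> nat" where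
  "lr_pepo_bonds q p D e = (if e \<in> inner_edges q p then 2 * (D e)\<^sup>2 else 1)"

text \<open>Products of Frobenius balls, one ball of radius \<open>\<Lambda> a b * \<epsilon>\<close> at each site.\<close>

definition sitewise_ball :: "'i set \<Rightarrow> nat \<Rightarrow> nat \<Rightarrow> (lattice_edge \<Rightarrow> nat) \<Rightarrow>
    (nat \<Rightarrow> nat \<Rightarrow> real) \<Rightarrow> real \<Rightarrow> (nat \<Rightarrow> nat \<Rightarrow> 'i local_tensor) \<Rightarrow>
    (nat \<Rightarrow> nat \<Rightarrow> 'i local_tensor) set" where
  "sitewise_ball I q p D \<Lambda> \<epsilon> Y =
     {X. \<forall>a \<in> {1..q}. \<forall>b \<in> {1..p}.
           local_norm I D a b (\<lambda>i x y z w. X a b i x y z w - Y a b i x y z w) \<le> \<Lambda> a b * \<epsilon>}"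

text \<open>Sitewise resolution: the parameter set is covered by the images, under the contraction, of
  products of local balls, restricted to the admissible local tensors.\<close>

definition peps_sitewise_covering_number :: "nat \<Rightarrow> nat \<Rightarrow> nat \<Rightarrow> (lattice_edge \<Rightarrow> nat) \<Rightarrow>
    (nat \<Rightarrow> nat \<Rightarrow> real) \<Rightarrow> real \<Rightarrow> real \<Rightarrow> enat" where
  "peps_sitewise_covering_number d q p D \<Lambda> L \<epsilon> =
     covering_number
       (\<lambda>Y. peps_vec d q p D `
              (bounded_tensors {..<d} q p D \<Lambda> \<inter> sitewise_ball {..<d} q p D \<Lambda> \<epsilon> Y))
       UNIV (peps_set d q p D \<Lambda> L)"

definition pepo_sitewise_covering_number :: "nat \<Rightarrow> nat \<Rightarrow> nat \<Rightarrow> (lattice_edge \<Rightarrow> nat) \<Rightarrow>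
    (nat \<Rightarrow> nat \<Rightarrow> real) \<Rightarrow> real \<Rightarrow> real \<Rightarrow> enat" where
  "pepo_sitewise_covering_number d q p D \<Lambda> L \<epsilon> =
     covering_number
       (\<lambda>Y. pepo_mat d q p D `
              (bounded_tensors ({..<d} \<times> {..<d}) q p D \<Lambda> \<inter>
               sitewise_ball ({..<d} \<times> {..<d}) q p D \<Lambda> \<epsilon> Y))
       UNIV (pepo_set d q p D \<Lambda> L)"

text \<open>Changing each local tensor by at most \<open>\<Lambda> a b * \<epsilon>\<close> within the bound \<open>\<Lambda> a b\<close> changes the
  contraction by at most this amount in Frobenius norm.\<close>

definition lattice_resolution :: "nat \<Rightarrow> nat \<Rightarrow> (nat \<Rightarrow> nat \<Rightarrow> real) \<Rightarrow> real \<Rightarrow> real" where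
  "lattice_resolution q p \<Lambda> \<epsilon> = (\<Sum>a = 1..q. \<Sum>b = 1..p. \<epsilon>) * (\<Prod>a = 1..q. \<Prod>b = 1..p. \<Lambda> a b)"

end

theory Submission
  imports Defs "HOL-Analysis.L2_Norm"
begin

text \<open>The unit ball of any norm on \<open>\<complex>\<^sup>m\<close> has an \<open>\<epsilon>\<close>-net with at most \<open>(4 / \<epsilon>) ^ (2 m)\<close> points; for
  \<open>s\<close>-sparse matrices there are in addition at most \<open>(e d\<^sup>2\<^sup>n / s) ^ s\<close> supports to choose from.
  A tensor train of norm at most one can be rewritten with local matrices that are contractions, so
  replacing them one by one by net elements at operator-norm distance \<open>\<epsilon>\<close> moves it by at most
  \<open>n \<epsilon>\<close>; nets of accuracy of order \<open>1 / n\<^sup>2\<close> suffice.  This covers MPS and MPO, and with two sites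
  also matrices of rank \<open>r\<close>.  For lattices the norm of a contraction is at most the product of the
  norms of the local tensors, by Cauchy--Schwarz on each bond, and one telescopes over the sites.\<close>

text \<open>Rounding to a coordinate grid costs a factor \<open>K\<close> per real coordinate, and
  for operator norms \<open>K\<close> grows with the matrix size; the logarithm of a dimension would
  enter every estimate. Hence the effort to count net points without \<open>K\<close>. Tensor trains
  call for the operator norm: a matrix with orthonormal columns has Frobenius norm the square root
  of its number of columns, so a product of Frobenius bounds would grow exponentially in
  \<open>n\<close>, whereas stacked contractions compose to contractions. For lattices the local
  radii \<Lambda> are given instead, and their product enters the resolution. Powers of
  \<open>n\<close> and constants in the accuracy change the logarithm of a net size only by a
  multiple of \<open>ln n\<close>, provided that \<open>n \<ge> 2\<close>; this is what allows the
  accuracy 1/(4n^2) per site. The final constant is 192 = 12 * 16: the 12 is twice the exponent in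
  16 n^2 \<le> n^6, and 16 = 2^4 comes from the doubling of the four bonds at a site in the low-rank
  lattice class.\<close>

section \<open>Nets in unit balls\<close>

text \<open>\<open>B t\<close> is the ball of radius \<open>t\<close> of a norm that dominates the maximum norm on the
  coordinates in \<open>I\<close> and is at most \<open>K\<close> times it.\<close>

locale norm_balls =
  fixes I :: "'i set" and B :: "real \<Rightarrow> ('i \<Rightarrow> complex) \<Rightarrow> bool" and K :: real
  assumes finite_index: "finite I"
    and ball_add: "B s x \<Longrightarrow> B t y \<Longrightarrow> B (s + t) (\<lambda>i. x i + y i)"
    and ball_scale: "B t x \<Longrightarrow> B (\<bar>c\<bar> * t) (\<lambda>i. of_real c * x i)"
    and ball_mono: "B s x \<Longrightarrow> s \<le> t \<Longrightarrow> B t x"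
    and ball_coord: "B t x \<Longrightarrow> i \<in> I \<Longrightarrow> cmod (x i) \<le> t"
    and ball_of_coord: "0 \<le> t \<Longrightarrow> (\<And>i. i \<in> I \<Longrightarrow> cmod (x i) \<le> t) \<Longrightarrow> B (K * t) x"
    and K_ge_1: "1 \<le> K"
begin

lemma ball_diff: "B s x \<Longrightarrow> B t y \<Longrightarrow> B (s + t) (\<lambda>i. x i - y i)"
  using ball_add[of s x t "\<lambda>i. of_real (-1) * y i"] ball_scale[of t y "-1"] by simp

text \<open>An expansion in base \<eta> whose digits are points of the ball, most significant digit
  first. Distinct digit strings over a separated set will give points that are still
  separated.\<close>

fun digit_sum :: "real \<Rightarrow> ('i \<Rightarrow> complex) list \<Rightarrow> 'i \<Rightarrow> complex" where
  "digit_sum \<eta> [] = (\<lambda>i. 0)"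
| "digit_sum \<eta> (x # xs) = (\<lambda>i. x i + of_real \<eta> * digit_sum \<eta> xs i)"

text \<open>\<open>4 / 3\<close> is the fixed point of t = 1 + t/4, so the bound does not grow with
  the number of digits.\<close>

lemma ball_digit_sum:
  assumes "0 < \<eta>" "\<eta> \<le> 1 / 4" "set xs \<subseteq> {x. B 1 x}"
  shows "B (4 / 3) (digit_sum \<eta> xs)"
  using assms(3)
proof (induction xs)
  case Nil
  \<comment> \<open>The zero vector enters the balls through \<open>ball_of_coord\<close> at radius
    0.\<close>
  have "B (K * 0) (\<lambda>i. 0)" by (rule ball_of_coord) auto
  then show ?case using ball_mono[of 0 "\<lambda>i. 0" "4/3"] by simp
next
  case (Cons x xs)
  have "B (\<bar>\<eta>\<bar> * (4 / 3)) (\<lambda>i. of_real \<eta> * digit_sum \<eta> xs i)"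
    using Cons by (intro ball_scale) auto
  moreover have "B 1 x" using Cons by auto
  ultimately have "B (1 + \<bar>\<eta>\<bar> * (4 / 3)) (digit_sum \<eta> (x # xs))"
    using ball_add by simp
  then show ?case by (rule ball_mono) (use assms in auto)
qed

text \<open>Equal leading digits cancel, and dividing by \<eta> leaves the shorter strings. At the
  first difference the leading digits are not within \<epsilon> = 4\<eta> of each other, while the
  two tails together move the sum by at most (8/3)\<eta> and cannot make up for it.\<close>

lemma digit_sum_separated:
  assumes e: "0 < \<epsilon>" "\<epsilon> \<le> 1"
    and sep: "\<And>x y. x \<in> P \<Longrightarrow> y \<in> P \<Longrightarrow> x \<noteq> y \<Longrightarrow> \<not> B \<epsilon> (\<lambda>i. x i - y i)"
    and P: "P \<subseteq> {x. B 1 x}"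
    and eq: "length xs = length ys" and ne: "xs \<noteq> ys" and sub: "set xs \<subseteq> P" "set ys \<subseteq> P"
  shows "\<not> B ((\<epsilon> / 4) ^ length xs) (\<lambda>i. digit_sum (\<epsilon> / 4) xs i - digit_sum (\<epsilon> / 4) ys i)"
  using eq ne sub
proof (induction xs ys rule: list_induct2)
  case Nil
  then show ?case by simp
next
  case (Cons x xs y ys)
  define \<eta> where "\<eta> = \<epsilon> / 4"
  have eps4: "\<epsilon> = 4 * \<eta>" by (simp add: \<eta>_def)
  have \<eta>: "0 < \<eta>" "\<eta> \<le> 1 / 4" using e by (auto simp: \<eta>_def)
  let ?d = "\<lambda>xs ys i. digit_sum \<eta> xs i - digit_sum \<eta> ys i"
  show ?case
  proof
    assume asm: "B ((\<epsilon> / 4) ^ length (x # xs)) (\<lambda>i. digit_sum (\<epsilon> / 4) (x # xs) i - digit_sum (\<epsilon> / 4) (y # ys) i)"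
    then have a: "B (\<eta> * \<eta> ^ length xs) (?d (x # xs) (y # ys))" by (simp add: \<eta>_def)
    show False
    proof (cases "x = y")
      case True
      have "B (\<bar>1 / \<eta>\<bar> * (\<eta> * \<eta> ^ length xs)) (\<lambda>i. of_real (1 / \<eta>) * ?d (x # xs) (y # ys) i)"
        by (rule ball_scale[OF a])
      moreover have "(\<lambda>i. of_real (1 / \<eta>) * ?d (x # xs) (y # ys) i) = ?d xs ys"
        using True \<eta> by (auto simp: field_simps)
      moreover have "\<bar>1 / \<eta>\<bar> * (\<eta> * \<eta> ^ length xs) = \<eta> ^ length xs" using \<eta> by auto
      ultimately have "B (\<eta> ^ length xs) (?d xs ys)" by simp
      then show False using Cons True by (simp add: \<eta>_def)
    next
      case False
      have "B (4 / 3) (digit_sum \<eta> xs)" "B (4 / 3) (digit_sum \<eta> ys)"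
        using ball_digit_sum \<eta> Cons.prems P by (metis list.set_intros(2) subset_eq)+
      then have "B (4 / 3 + 4 / 3) (?d xs ys)" by (rule ball_diff)
      then have "B (\<bar>\<eta>\<bar> * (4 / 3 + 4 / 3)) (\<lambda>i. of_real \<eta> * ?d xs ys i)" by (rule ball_scale)
      from ball_diff[OF a this]
      have "B (\<eta> * \<eta> ^ length xs + \<bar>\<eta>\<bar> * (4 / 3 + 4 / 3)) (\<lambda>i. x i - y i)"
        by (simp add: algebra_simps)
      \<comment> \<open>The assumed closeness contributes at most \<eta> and the tails (8/3)\<eta>,
        together (11/3)\<eta> < 4\<eta>.\<close>
      moreover have "\<eta> * \<eta> ^ length xs + \<bar>\<eta>\<bar> * (4 / 3 + 4 / 3) \<le> \<epsilon>"
      proof -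
        have "\<eta> * \<eta> ^ length xs \<le> \<eta> * 1"
          using \<eta> by (intro mult_left_mono power_le_one) auto
        moreover have "z + a * (4 / 3 + 4 / 3) \<le> 4 * a" if "z \<le> a * 1" "0 < a" for z a :: real
          using that by (simp add: field_simps)
        ultimately show ?thesis using \<eta>(1) unfolding abs_of_pos[OF \<eta>(1)] eps4 by blast
      qed
      ultimately have "B \<epsilon> (\<lambda>i. x i - y i)" by (rule ball_mono)
      then show False using sep[of x y] False Cons.prems by auto
    qed
  qed
qed

text \<open>Real and imaginary parts are rounded to a grid of mesh \<delta>. Points of one cell
  differ by at most 2\<delta> in every coordinate, hence by at most 2K\<delta> in the norm, so no
  cell holds two of them.\<close>

lemma separated_card_crude:
  assumes d: "0 < \<delta>" "\<delta> \<le> 1"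
    and F: "finite S" "\<And>x i. x \<in> S \<Longrightarrow> i \<in> I \<Longrightarrow> cmod (f x i) \<le> 4 / 3"
    and sep: "\<And>x y. x \<in> S \<Longrightarrow> y \<in> S \<Longrightarrow> x \<noteq> y \<Longrightarrow> \<not> B (2 * K * \<delta>) (\<lambda>i. f x i - f y i)"
  shows "real (card S) \<le> (6 / \<delta>) ^ (2 * card I)"
proof -
  define m where "m = \<lceil>(4 / 3) / \<delta>\<rceil>"
  define G where "G x = (\<lambda>i\<in>I. (\<lfloor>Re (f x i) / \<delta>\<rfloor>, \<lfloor>Im (f x i) / \<delta>\<rfloor>))" for x
  have fl: "\<lfloor>t / \<delta>\<rfloor> \<in> {-m..m}" if "\<bar>t\<bar> \<le> 4 / 3" for t
  proof -
    have "t / \<delta> \<le> (4 / 3) / \<delta>" "- ((4 / 3) / \<delta>) \<le> t / \<delta>"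
      using that d by (auto simp: divide_simps)
    then show ?thesis unfolding m_def by simp linarith
  qed
  have G: "G x \<in> PiE I (\<lambda>_. {-m..m} \<times> {-m..m})" if "x \<in> S" for x
  proof -
    have "\<bar>Re (f x i)\<bar> \<le> 4 / 3" "\<bar>Im (f x i)\<bar> \<le> 4 / 3" if "i \<in> I" for i
      using F(2)[OF \<open>x \<in> S\<close> that] abs_Re_le_cmod[of "f x i"] abs_Im_le_cmod[of "f x i"] by linarith+
    then show ?thesis unfolding G_def using fl by auto
  qed
  have inj: "inj_on G S"
  proof (rule inj_onI, rule ccontr)
    fix x y assume xy: "x \<in> S" "y \<in> S" "G x = G y" "x \<noteq> y"
    have close: "\<bar>s - t\<bar> \<le> \<delta>" if "\<lfloor>s / \<delta>\<rfloor> = \<lfloor>t / \<delta>\<rfloor>" for s t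
    proof -
      have "\<bar>s / \<delta> - t / \<delta>\<bar> \<le> 1" using that by linarith
      then show ?thesis using d by (simp add: diff_divide_distrib[symmetric] abs_divide)
    qed
    have "cmod (f x i - f y i) \<le> 2 * \<delta>" if "i \<in> I" for i
    proof -
      have "G x i = G y i" using xy by simp
      then have "\<bar>Re (f x i) - Re (f y i)\<bar> \<le> \<delta>" "\<bar>Im (f x i) - Im (f y i)\<bar> \<le> \<delta>"
        using that close by (auto simp: G_def)
      then show ?thesis using cmod_le[of "f x i - f y i"] by simp
    qed
    then have "B (K * (2 * \<delta>)) (\<lambda>i. f x i - f y i)" using d by (intro ball_of_coord) auto
    then show False using sep xy by (simp add: mult_ac)
  qed
  have "card S \<le> card (PiE I (\<lambda>_. {-m..m} \<times> {-m..m}))"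
    using G by (intro card_inj_on_le[OF inj]) (auto intro!: finite_PiE finite_index)
  also have "\<dots> = (nat (2 * m + 1)) ^ (2 * card I)"
    using finite_index by (simp add: card_PiE card_cartesian_product power_mult power2_eq_square)
  finally have 1: "real (card S) \<le> real (nat (2 * m + 1)) ^ (2 * card I)"
    by (metis of_nat_le_iff of_nat_power)
  have "0 \<le> m" using d unfolding m_def by (simp add: ceiling_mono[of 0, simplified])
  then have "real (nat (2 * m + 1)) = 2 * of_int m + 1" by simp
  also have "\<dots> \<le> 2 * ((4 / 3) / \<delta> + 1) + 1" using of_int_ceiling_le_add_one[of "(4 / 3) / \<delta>"]
    unfolding m_def by (simp only: add_le_cancel_right mult_le_cancel_left_pos zero_less_numeral)
  \<comment> \<open>As \<delta> \<le> 1, the additive 3 is at most 3/\<delta>, and 8/3 + 3 <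
    6.\<close>
  also have "\<dots> \<le> 6 / \<delta>" using d by (simp add: field_simps)
  finally have "real (nat (2 * m + 1)) ^ (2 * card I) \<le> (6 / \<delta>) ^ (2 * card I)"
    by (intro power_mono) auto
  with 1 show ?thesis by linarith
qed

text \<open>A tensor power argument: from a separated set \<open>P\<close> one builds \<open>card P ^ L\<close> points in a fixed
  ball that are \<open>(\<epsilon> / 4) ^ L\<close>-separated, so that as \<open>L\<close> grows the constants of the crude
  count disappear.\<close>

lemma separated_card:
  assumes e: "0 < \<epsilon>" "\<epsilon> \<le> 1"
    and sep: "\<And>x y. x \<in> P \<Longrightarrow> y \<in> P \<Longrightarrow> x \<noteq> y \<Longrightarrow> \<not> B \<epsilon> (\<lambda>i. x i - y i)"
    and P: "P \<subseteq> {x. B 1 x}" "finite P"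
  shows "real (card P) \<le> (4 / \<epsilon>) ^ (2 * card I)"
proof (rule ccontr)
  define \<eta> where "\<eta> = \<epsilon> / 4"
  have \<eta>: "0 < \<eta>" "\<eta> \<le> 1 / 4" using e by (auto simp: \<eta>_def)
  define m where "m = 2 * card I"
  have main: "real (card P) ^ L \<le> (12 * K) ^ m * ((4 / \<epsilon>) ^ m) ^ L" for L
  proof -
    let ?S = "{xs. set xs \<subseteq> P \<and> length xs = L}"
    \<comment> \<open>Mesh chosen so that 2K\<delta> is \<eta>^L, the separation of digit strings of
      length \<open>L\<close>.\<close>
    define \<delta> where "\<delta> = \<eta> ^ L / (2 * K)"
    have K: "0 < K" using K_ge_1 by simp
    have "\<eta> ^ L \<le> 1" using \<eta> by (intro power_le_one) auto
    then have d: "0 < \<delta>" "\<delta> \<le> 1"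
      using \<eta> K K_ge_1 by (auto simp: \<delta>_def pos_divide_le_eq)
    have "real (card ?S) \<le> (6 / \<delta>) ^ (2 * card I)"
    proof (rule separated_card_crude[OF d, where f = "digit_sum \<eta>"])
      show "finite ?S" using finite_lists_length_eq[OF P(2)] .
      show "cmod (digit_sum \<eta> xs i) \<le> 4 / 3" if "xs \<in> ?S" "i \<in> I" for xs i
        using that P by (intro ball_coord[OF ball_digit_sum[OF \<eta>]]) auto
      show "\<not> B (2 * K * \<delta>) (\<lambda>i. digit_sum \<eta> xs i - digit_sum \<eta> ys i)"
        if "xs \<in> ?S" "ys \<in> ?S" "xs \<noteq> ys" for xs ys
      proof -
        have "2 * K * \<delta> = (\<epsilon> / 4) ^ length xs" using K that by (simp add: \<delta>_def \<eta>_def)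
        moreover have "length xs = length ys" "set xs \<subseteq> P" "set ys \<subseteq> P" using that by auto
        ultimately show ?thesis
          using digit_sum_separated[OF e sep P(1) _ that(3)] unfolding \<eta>_def by metis
      qed
    qed
    also have "6 / \<delta> = 12 * K * (4 / \<epsilon>) ^ L" using e by (simp add: \<delta>_def \<eta>_def power_divide)
    also have "(12 * K * (4 / \<epsilon>) ^ L) ^ (2 * card I) = (12 * K) ^ m * ((4 / \<epsilon>) ^ m) ^ L"
      unfolding m_def power_mult_distrib power_mult[symmetric] by (simp only: mult.commute)
    finally show ?thesis using card_lists_length_eq[OF P(2)] by simp
  qed
  \<comment> \<open>If this ratio exceeded 1, its powers would outgrow (12K)^m, which does not
    depend on \<open>L\<close>.\<close>
  define q where "q = real (card P) / (4 / \<epsilon>) ^ m"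
  have pos: "0 < (4 / \<epsilon>) ^ m" using e by simp
  assume "\<not> real (card P) \<le> (4 / \<epsilon>) ^ (2 * card I)"
  then have "1 < q" using pos unfolding q_def m_def by (simp only: less_divide_eq_1_pos not_le)
  then obtain L where "(12 * K) ^ m < q ^ L" using real_arch_pow by blast
  moreover have "q ^ L \<le> (12 * K) ^ m"
    using main[of L] pos unfolding q_def power_divide[of "real (card P)"]
    by (simp only: pos_divide_le_eq zero_less_power)
  ultimately show False by simp
qed

text \<open>A separated subset of largest cardinality is a net, since a point outside all its
  \<epsilon>-balls could be added; \<open>separated_card\<close> bounds the cardinalities, so a
  largest one exists. The net lies in the unit ball: telescoping later needs net elements that
  satisfy the same bound as the points they replace.\<close>

lemma net_exists:
  assumes e: "0 < \<epsilon>" "\<epsilon> \<le> 1"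
  shows "\<exists>C. finite C \<and> C \<subseteq> {x. B 1 x} \<and> real (card C) \<le> (4 / \<epsilon>) ^ (2 * card I) \<and>
    (\<forall>x. B 1 x \<longrightarrow> (\<exists>c\<in>C. B \<epsilon> (\<lambda>i. x i - c i)))"
proof -
  define Q where "Q P \<longleftrightarrow> finite P \<and> P \<subseteq> {x. B 1 x} \<and>
    (\<forall>x\<in>P. \<forall>y\<in>P. x \<noteq> y \<longrightarrow> \<not> B \<epsilon> (\<lambda>i. x i - y i))" for P
  define M where "M = nat \<lceil>(4 / \<epsilon>) ^ (2 * card I)\<rceil>"
  have bd: "real (card P) \<le> (4 / \<epsilon>) ^ (2 * card I)" if "Q P" for P
    using that separated_card[OF e, of P] unfolding Q_def by blast
  then have bd': "card P \<le> M" if "Q P" for P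
    using that unfolding M_def by (meson le_nat_iff of_nat_ceiling of_nat_le_iff order_trans real_nat_ceiling_ge)
  have "Q {}" by (simp add: Q_def)
  then have "\<exists>C. Q C \<and> (\<forall>P. Q P \<longrightarrow> card P \<le> card C)"
    by (rule ex_has_greatest_nat[where b = "Suc M"]) (use bd' in \<open>auto simp: less_Suc_eq_le\<close>)
  then obtain C where C: "Q C" "\<And>P. Q P \<Longrightarrow> card P \<le> card C" by blast
  show ?thesis
  proof (intro exI[of _ C] conjI allI impI)
    show "finite C" "C \<subseteq> {x. B 1 x}" using C(1) by (auto simp: Q_def)
    show "real (card C) \<le> (4 / \<epsilon>) ^ (2 * card I)" using bd C(1) .
    show "\<exists>c\<in>C. B \<epsilon> (\<lambda>i. x i - c i)" if x: "B 1 x" for x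
    proof (rule ccontr)
      assume no: "\<not> (\<exists>c\<in>C. B \<epsilon> (\<lambda>i. x i - c i))"
      have "B (K * 0) (\<lambda>i. x i - x i)" by (rule ball_of_coord) auto
      then have "B \<epsilon> (\<lambda>i. x i - x i)" using e by (auto intro: ball_mono)
      then have "x \<notin> C" using no by blast
      \<comment> \<open>Separation is demanded for both orders of a pair, hence the reflection by
        -1.\<close>
      have "\<not> B \<epsilon> (\<lambda>i. c i - x i)" if "c \<in> C" for c
        using ball_scale[of \<epsilon> "\<lambda>i. c i - x i" "-1"] no that by auto
      then have "Q (insert x C)" using C(1) x no unfolding Q_def by auto
      from C(2)[OF this] show False using \<open>x \<notin> C\<close> C(1) by (simp add: Q_def)
    qed
  qed
qed

end

section \<open>Euclidean and operator norms\<close>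

definition l2n :: "'j set \<Rightarrow> ('j \<Rightarrow> complex) \<Rightarrow> real" where
  "l2n J f = L2_set (\<lambda>j. cmod (f j)) J"

lemma l2n_nonneg [simp]: "0 \<le> l2n J f"
  by (simp add: l2n_def)

lemma l2n_cong: "(\<And>j. j \<in> J \<Longrightarrow> f j = g j) \<Longrightarrow> l2n J f = l2n J g"
  unfolding l2n_def by (rule L2_set_cong) auto

lemma l2n_zero [simp]: "l2n J (\<lambda>j. 0) = 0"
  by (simp add: l2n_def L2_set_def)

lemma l2n_sq: "(l2n J f)\<^sup>2 = (\<Sum>j\<in>J. (cmod (f j))\<^sup>2)"
  by (simp add: l2n_def L2_set_def sum_nonneg)

lemma l2n_triangle: "l2n J (\<lambda>j. f j + g j) \<le> l2n J f + l2n J g"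
proof -
  have "l2n J (\<lambda>j. f j + g j) \<le> L2_set (\<lambda>j. cmod (f j) + cmod (g j)) J"
    unfolding l2n_def by (rule L2_set_mono) (auto simp: norm_triangle_ineq)
  also have "\<dots> \<le> l2n J f + l2n J g"
    unfolding l2n_def by (rule L2_set_triangle_ineq)
  finally show ?thesis .
qed

lemma l2n_scale: "l2n J (\<lambda>j. c * f j) = cmod c * l2n J f"
  by (simp add: l2n_def norm_mult L2_set_right_distrib)

lemma l2n_member: "finite J \<Longrightarrow> j \<in> J \<Longrightarrow> cmod (f j) \<le> l2n J f"
  unfolding l2n_def by (rule member_le_L2_set)

lemma l2n_le_sum: "l2n J f \<le> (\<Sum>j\<in>J. cmod (f j))"
  unfolding l2n_def by (rule L2_set_le_sum) auto

lemma l2n_reindex: "bij_betw h A J \<Longrightarrow> l2n A (\<lambda>a. f (h a)) = l2n J f"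
  unfolding l2n_def L2_set_def by (simp add: sum.reindex_bij_betw[of h A J "\<lambda>j. (cmod (f j))\<^sup>2"])

lemma l2n_le_iff: "0 \<le> t \<Longrightarrow> l2n J f \<le> t \<longleftrightarrow> (\<Sum>j\<in>J. (cmod (f j))\<^sup>2) \<le> t\<^sup>2"
  by (metis l2n_nonneg l2n_sq power2_le_imp_le power_mono)

text \<open>The operator norm as a predicate of its upper bounds, which avoids a supremum. The
  conjunct \<open>0 \<le> t\<close> matters for empty \<open>K\<close>, where the inequality holds
  for every \<open>t\<close>.\<close>

definition op_bound :: "'j set \<Rightarrow> 'k set \<Rightarrow> real \<Rightarrow> ('j \<Rightarrow> 'k \<Rightarrow> complex) \<Rightarrow> bool" where
  "op_bound J K t A \<longleftrightarrow> 0 \<le> t \<and> (\<forall>v. l2n J (\<lambda>j. \<Sum>k\<in>K. A j k * v k) \<le> t * l2n K v)"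

lemma op_bound_nonneg: "op_bound J K t A \<Longrightarrow> 0 \<le> t"
  by (simp add: op_bound_def)

lemma op_boundD: "op_bound J K t A \<Longrightarrow> l2n J (\<lambda>j. \<Sum>k\<in>K. A j k * v k) \<le> t * l2n K v"
  by (simp add: op_bound_def)

lemma op_bound_cong:
  "(\<And>j k. j \<in> J \<Longrightarrow> k \<in> K \<Longrightarrow> A j k = A' j k) \<Longrightarrow> op_bound J K t A = op_bound J K t A'"
  unfolding op_bound_def by (intro conj_cong refl all_cong) (simp cong: l2n_cong)

lemma op_bound_add:
  assumes "op_bound J K s A" "op_bound J K t A'"
  shows "op_bound J K (s + t) (\<lambda>j k. A j k + A' j k)"
  unfolding op_bound_def
proof (intro conjI allI)
  show "0 \<le> s + t" using assms by (simp add: op_bound_def)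
  fix v
  have "l2n J (\<lambda>j. \<Sum>k\<in>K. (A j k + A' j k) * v k) \<le>
      l2n J (\<lambda>j. \<Sum>k\<in>K. A j k * v k) + l2n J (\<lambda>j. \<Sum>k\<in>K. A' j k * v k)"
    by (simp add: distrib_right sum.distrib l2n_triangle)
  also have "\<dots> \<le> s * l2n K v + t * l2n K v" using assms by (intro add_mono op_boundD)
  finally show "l2n J (\<lambda>j. \<Sum>k\<in>K. (A j k + A' j k) * v k) \<le> (s + t) * l2n K v"
    by (simp add: distrib_right)
qed

lemma op_bound_mono: "op_bound J K s A \<Longrightarrow> s \<le> t \<Longrightarrow> op_bound J K t A"
  unfolding op_bound_def by (meson l2n_nonneg mult_right_mono order_trans)

text \<open>The factor counts the matrix entries, with 1 added so that it is at least 1 for empty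
  index sets too. Its size is harmless, as it does not appear in the bound of
  \<open>net_exists\<close>.\<close>

lemma op_bound_norm_balls:
  assumes "finite J" "finite K"
  shows "norm_balls (J \<times> K) (\<lambda>t x. op_bound J K t (\<lambda>j k. x (j, k))) (1 + real (card J * card K))"
proof
  show "finite (J \<times> K)" using assms by simp
  fix s t x y
  show "op_bound J K (s + t) (\<lambda>j k. x (j, k) + y (j, k))"
    if "op_bound J K s (\<lambda>j k. x (j, k))" "op_bound J K t (\<lambda>j k. y (j, k))"
    using op_bound_add[OF that] .
  show "op_bound J K t (\<lambda>j k. x (j, k))" if "op_bound J K s (\<lambda>j k. x (j, k))" "s \<le> t"
    using op_bound_mono[OF that] .
next
  fix t x and c :: real
  assume x: "op_bound J K t (\<lambda>j k. x (j, k))"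
  have "l2n J (\<lambda>j. \<Sum>k\<in>K. complex_of_real c * x (j, k) * v k) \<le> \<bar>c\<bar> * t * l2n K v" for v
  proof -
    have "l2n J (\<lambda>j. \<Sum>k\<in>K. complex_of_real c * x (j, k) * v k) =
        \<bar>c\<bar> * l2n J (\<lambda>j. \<Sum>k\<in>K. x (j, k) * v k)"
      by (simp add: mult.assoc sum_distrib_left[symmetric] l2n_scale)
    also have "\<dots> \<le> \<bar>c\<bar> * (t * l2n K v)" by (intro mult_left_mono op_boundD[OF x]) auto
    finally show ?thesis by (simp add: mult.assoc)
  qed
  then show "op_bound J K (\<bar>c\<bar> * t) (\<lambda>j k. complex_of_real c * x (j, k))"
    using x by (simp add: op_bound_def)
next
  fix t x i
  assume x: "op_bound J K t (\<lambda>j k. x (j, k))" and i: "i \<in> J \<times> K"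
  obtain j k where jk: "i = (j, k)" "j \<in> J" "k \<in> K" using i by auto
  \<comment> \<open>An entry is recovered by applying the matrix to a standard basis vector.\<close>
  have *: "(\<Sum>k'\<in>K. x (j, k') * (if k' = k then 1 else 0)) = x (j, k)"
    using assms jk by (simp add: if_distrib cong: if_cong)
  have "cmod (x i) \<le> l2n J (\<lambda>j. \<Sum>k'\<in>K. x (j, k') * (if k' = k then 1 else 0))"
    using l2n_member[OF assms(1) jk(2), of "\<lambda>j. \<Sum>k'\<in>K. x (j, k') * (if k' = k then 1 else 0)"]
    by (simp add: * jk(1))
  also have "\<dots> \<le> t * l2n K (\<lambda>k'. if k' = k then 1 else 0)" by (rule op_boundD[OF x])
  also have "l2n K (\<lambda>k'. if k' = k then 1 else 0) = 1"
  proof -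
    have "(\<Sum>k'\<in>K. (cmod (if k' = k then 1 else 0))\<^sup>2) = (\<Sum>k'\<in>K. if k' = k then 1 else 0)"
      by (rule sum.cong) auto
    then show ?thesis using assms jk by (simp add: l2n_def L2_set_def)
  qed
  finally show "cmod (x i) \<le> t" by simp
next
  fix t :: real and x
  assume t: "0 \<le> t" and x: "\<And>i. i \<in> J \<times> K \<Longrightarrow> cmod (x i) \<le> t"
  have "l2n J (\<lambda>j. \<Sum>k\<in>K. x (j, k) * v k) \<le> (1 + real (card J * card K)) * t * l2n K v" for v
  proof -
    have "l2n J (\<lambda>j. \<Sum>k\<in>K. x (j, k) * v k) \<le> (\<Sum>j\<in>J. cmod (\<Sum>k\<in>K. x (j, k) * v k))"
      by (rule l2n_le_sum)
    also have "\<dots> \<le> (\<Sum>j\<in>J. \<Sum>k\<in>K. t * l2n K v)"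
    proof (intro sum_mono order.trans[OF norm_sum])
      fix j k assume "j \<in> J" "k \<in> K"
      then show "cmod (x (j, k) * v k) \<le> t * l2n K v"
        unfolding norm_mult using x[of "(j, k)"] l2n_member[OF assms(2), of k v] t
        by (intro mult_mono) auto
    qed
    also have "\<dots> = real (card J * card K) * t * l2n K v" by simp
    also have "\<dots> \<le> (1 + real (card J * card K)) * t * l2n K v"
      using t by (intro mult_right_mono) auto
    finally show ?thesis .
  qed
  then show "op_bound J K ((1 + real (card J * card K)) * t) (\<lambda>j k. x (j, k))"
    using t by (simp add: op_bound_def)
qed simp

section \<open>Orthonormalisation\<close>

definition cinner :: "'j set \<Rightarrow> ('j \<Rightarrow> complex) \<Rightarrow> ('j \<Rightarrow> complex) \<Rightarrow> complex" where
  "cinner J f g = (\<Sum>j\<in>J. cnj (f j) * g j)"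

lemma cnj_mult_self: "cnj z * z = (complex_of_real (cmod z))\<^sup>2"
  by (metis complex_norm_square mult.commute of_real_power)

lemma cinner_self: "cinner J f f = of_real ((l2n J f)\<^sup>2)"
  by (simp add: cinner_def l2n_sq cnj_mult_self)

lemma cinner_cnj: "cnj (cinner J f g) = cinner J g f"
  by (simp add: cinner_def mult.commute)

lemma cinner_diff_right: "cinner J f (\<lambda>j. g j - h j) = cinner J f g - cinner J f h"
  by (simp add: cinner_def algebra_simps sum_subtractf)

lemma cinner_sum_right: "cinner J f (\<lambda>j. \<Sum>k\<in>K. g j k) = (\<Sum>k\<in>K. cinner J f (\<lambda>j. g j k))"
  unfolding cinner_def sum_distrib_left by (rule sum.swap)

lemma cinner_scale_right: "cinner J f (\<lambda>j. g j * c) = cinner J f g * c"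
  by (simp add: cinner_def sum_distrib_right mult.assoc)

lemma cinner_zero_left: "(\<And>j. j \<in> J \<Longrightarrow> f j = 0) \<Longrightarrow> cinner J f g = 0"
  by (simp add: cinner_def)

lemma cinner_cong_right: "(\<And>j. j \<in> J \<Longrightarrow> g j = h j) \<Longrightarrow> cinner J f g = cinner J f h"
  by (simp add: cinner_def)

lemma cmod_cinner_le: "cmod (cinner J f g) \<le> l2n J f * l2n J g"
proof -
  have "cmod (cinner J f g) \<le> (\<Sum>j\<in>J. \<bar>cmod (f j)\<bar> * \<bar>cmod (g j)\<bar>)"
    unfolding cinner_def by (rule order.trans[OF norm_sum]) (simp add: norm_mult)
  also have "\<dots> \<le> l2n J f * l2n J g" unfolding l2n_def by (rule L2_set_mult_ineq)
  finally show ?thesis .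
qed

lemma l2n_eq_0: "finite J \<Longrightarrow> l2n J f = 0 \<longleftrightarrow> (\<forall>j\<in>J. f j = 0)"
  by (simp add: l2n_def L2_set_eq_0_iff)

definition partial_orthonormal :: "'j set \<Rightarrow> nat \<Rightarrow> ('j \<Rightarrow> nat \<Rightarrow> complex) \<Rightarrow> bool" where
  "partial_orthonormal J r U \<longleftrightarrow>
     (\<forall>k<r. \<forall>k'<r. k \<noteq> k' \<longrightarrow> cinner J (\<lambda>j. U j k) (\<lambda>j. U j k') = 0) \<and>
     (\<forall>k<r. l2n J (\<lambda>j. U j k) \<in> {0, 1})"

text \<open>The coefficient at a zero column cannot be read off from the sum, hence the proviso that
  it be 0.\<close>

lemma partial_orthonormal_cinner_sum:
  assumes "finite J" "partial_orthonormal J r U" "k < r"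
    and zero: "l2n J (\<lambda>j. U j k) = 0 \<Longrightarrow> c k = 0"
  shows "cinner J (\<lambda>j. U j k) (\<lambda>j. \<Sum>k'<r. U j k' * c k') = c k"
proof -
  have "cinner J (\<lambda>j. U j k) (\<lambda>j. \<Sum>k'<r. U j k' * c k') =
      (\<Sum>k'<r. cinner J (\<lambda>j. U j k) (\<lambda>j. U j k') * c k')"
    by (simp add: cinner_sum_right cinner_scale_right)
  also have "\<dots> = (\<Sum>k'<r. if k' = k then c k else 0)"
  proof (rule sum.cong[OF refl])
    fix k' assume "k' \<in> {..<r}"
    then show "cinner J (\<lambda>j. U j k) (\<lambda>j. U j k') * c k' = (if k' = k then c k else 0)"
      using assms(2,3) zero unfolding partial_orthonormal_def
      by (cases "k' = k") (auto simp: cinner_self)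
  qed
  also have "\<dots> = c k" using assms(3) by simp
  finally show ?thesis .
qed

lemma partial_orthonormal_cinner_residual:
  assumes "finite J" "partial_orthonormal J r U" "k < r"
  shows "cinner J (\<lambda>j. U j k) (\<lambda>j. g j - (\<Sum>k'<r. U j k' * cinner J (\<lambda>j. U j k') g)) = 0"
proof -
  have "cinner J (\<lambda>j. U j k) (\<lambda>j. \<Sum>k'<r. U j k' * cinner J (\<lambda>j. U j k') g) = cinner J (\<lambda>j. U j k) g"
    using assms by (intro partial_orthonormal_cinner_sum)
      (auto simp: l2n_eq_0 intro!: cinner_zero_left)
  then show ?thesis by (simp add: cinner_diff_right)
qed

text \<open>Gram-Schmidt. \<open>W\<close> writes the new columns through the old ones for every
  \<open>j\<close>, even outside \<open>J\<close>; with it \<open>train_canonical\<close> sees that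
  fixing the last physical index of a new column leaves a combination of the preceding partial
  contractions.\<close>

lemma orthonormalise:
  fixes T :: "'j \<Rightarrow> nat \<Rightarrow> complex"
  assumes J: "finite J"
  obtains U W where "partial_orthonormal J r U"
    "\<And>j k. k < r \<Longrightarrow> U j k = (\<Sum>\<beta><r. T j \<beta> * W \<beta> k)"
    "\<And>j \<beta>. j \<in> J \<Longrightarrow> \<beta> < r \<Longrightarrow> T j \<beta> = (\<Sum>k<r. U j k * cinner J (\<lambda>j. U j k) (\<lambda>j. T j \<beta>))"
proof -
  have "\<exists>U W. partial_orthonormal J r U \<and>
    (\<forall>j. \<forall>k<r. U j k = (\<Sum>\<beta><r. T j \<beta> * W \<beta> k)) \<and>
    (\<forall>j\<in>J. \<forall>\<beta><r. T j \<beta> = (\<Sum>k<r. U j k * cinner J (\<lambda>j. U j k) (\<lambda>j. T j \<beta>)))"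
  proof (induction r)
    case 0
    show ?case by (simp add: partial_orthonormal_def)
  next
    case (Suc r)
    then obtain U W where U: "partial_orthonormal J r U"
      and W: "\<And>j k. k < r \<Longrightarrow> U j k = (\<Sum>\<beta><r. T j \<beta> * W \<beta> k)"
      and T: "\<And>j \<beta>. j \<in> J \<Longrightarrow> \<beta> < r \<Longrightarrow> T j \<beta> = (\<Sum>k<r. U j k * cinner J (\<lambda>j. U j k) (\<lambda>j. T j \<beta>))"
      by blast
    define c where "c k = cinner J (\<lambda>j. U j k) (\<lambda>j. T j r)" for k
    define w where "w j = T j r - (\<Sum>k<r. U j k * c k)" for j
    define a where "a = l2n J w"
    \<comment> \<open>Since \<open>inverse 0 = 0\<close>, a residual that vanishes on
      \<open>J\<close> yields a zero column.\<close>
    define u where "u j = w j * of_real (inverse a)" for j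
    define U' where "U' j k = (if k = r then u j else U j k)" for j k
    define W' where "W' \<beta> k = (if k = r then of_real (inverse a) * (if \<beta> = r then 1 else - (\<Sum>k<r. W \<beta> k * c k))
        else if \<beta> = r then 0 else W \<beta> k)" for \<beta> k
    have orth: "cinner J (\<lambda>j. U j k) w = 0" if "k < r" for k
      unfolding w_def c_def using partial_orthonormal_cinner_residual[OF J U that] .
    have orthu: "cinner J (\<lambda>j. U j k) u = 0" "cinner J u (\<lambda>j. U j k) = 0" if "k < r" for k
    proof -
      show 1: "cinner J (\<lambda>j. U j k) u = 0"
        unfolding u_def cinner_scale_right by (simp add: orth[OF that])
      show "cinner J u (\<lambda>j. U j k) = 0"
        using cinner_cnj[of J "\<lambda>j. U j k" u] 1 by simp
    qed
    have nu: "l2n J u \<in> {0, 1}"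
    proof -
      have "l2n J u = cmod (of_real (inverse a)) * l2n J w"
        unfolding u_def l2n_scale[symmetric] by (simp only: mult.commute)
      then have "l2n J u = \<bar>inverse a\<bar> * a"
        by (simp only: norm_of_real a_def)
      moreover have "0 \<le> a" by (simp add: a_def)
      ultimately show ?thesis by (cases "a = 0") auto
    qed
    have P: "partial_orthonormal J (Suc r) U'"
      using U orthu nu unfolding partial_orthonormal_def U'_def
      by (auto simp: less_Suc_eq)
    have W': "U' j k = (\<Sum>\<beta><Suc r. T j \<beta> * W' \<beta> k)" if "k < Suc r" for j k
    proof (cases "k = r")
      case False
      then show ?thesis using that W[of k j] by (simp add: U'_def W'_def)
    next
      case True
      have "(\<Sum>k<r. U j k * c k) = (\<Sum>k<r. \<Sum>\<beta><r. T j \<beta> * (W \<beta> k * c k))"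
        by (intro sum.cong refl) (simp add: W sum_distrib_right mult.assoc)
      also have "\<dots> = (\<Sum>\<beta><r. T j \<beta> * (\<Sum>k<r. W \<beta> k * c k))"
        by (subst sum.swap) (simp add: sum_distrib_left)
      finally have "w j = T j r + (\<Sum>\<beta><r. T j \<beta> * - (\<Sum>k<r. W \<beta> k * c k))"
        by (simp add: w_def sum_negf)
      then have "u j = T j r * of_real (inverse a) + (\<Sum>\<beta><r. T j \<beta> * (of_real (inverse a) * - (\<Sum>k<r. W \<beta> k * c k)))"
      proof -
        assume w: "w j = T j r + (\<Sum>\<beta><r. T j \<beta> * - (\<Sum>k<r. W \<beta> k * c k))"
        have "u j = T j r * of_real (inverse a) + (\<Sum>\<beta><r. T j \<beta> * - (\<Sum>k<r. W \<beta> k * c k) * of_real (inverse a))"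
          by (simp only: u_def w distrib_right sum_distrib_right)
        also have "(\<Sum>\<beta><r. T j \<beta> * - (\<Sum>k<r. W \<beta> k * c k) * of_real (inverse a)) =
            (\<Sum>\<beta><r. T j \<beta> * (of_real (inverse a) * - (\<Sum>k<r. W \<beta> k * c k)))"
          by (intro sum.cong refl) (simp only: mult_ac)
        finally show ?thesis .
      qed
      then show ?thesis using True by (simp add: U'_def W'_def)
    qed
    have T': "T j \<beta> = (\<Sum>k<Suc r. U' j k * cinner J (\<lambda>j. U' j k) (\<lambda>j. T j \<beta>))" if "j \<in> J" "\<beta> < Suc r" for j \<beta>
    proof -
      \<comment> \<open>The new direction is orthogonal to the earlier columns of \<open>T\<close>
        and restores exactly the residual of column \<open>r\<close>.\<close>
      have "u j * cinner J u (\<lambda>j. T j \<beta>) = (if \<beta> = r then w j else 0)"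
      proof (cases "\<beta> = r")
        case False
        then have "cinner J u (\<lambda>j. T j \<beta>) = cinner J u (\<lambda>j. \<Sum>k<r. U j k * cinner J (\<lambda>j. U j k) (\<lambda>j. T j \<beta>))"
          using T that by (intro cinner_cong_right) auto
        also have "\<dots> = 0" by (simp add: cinner_sum_right cinner_scale_right orthu)
        finally show ?thesis using False by simp
      next
        case True
        have "cinner J u (\<lambda>j. T j r) = cinner J u (\<lambda>j. T j r - (\<Sum>k<r. U j k * c k))"
          by (simp add: cinner_diff_right cinner_sum_right cinner_scale_right orthu)
        also have "\<dots> = cinner J u w" by (simp add: w_def[abs_def])
        also have "\<dots> = of_real (inverse a) * of_real (a\<^sup>2)"
        proof -
          have "cinner J u w = cnj (cinner J w u)" by (simp add: cinner_cnj)
          also have "cinner J w u = of_real (a\<^sup>2) * of_real (inverse a)"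
            using cinner_scale_right[of J w w "of_real (inverse a)"] cinner_self[of J w]
            by (simp add: u_def[abs_def] a_def)
          finally show ?thesis by (simp add: mult.commute)
        qed
        finally have *: "u j * cinner J u (\<lambda>j. T j r) = w j * of_real (inverse a * inverse a * a\<^sup>2)"
          unfolding u_def by simp
        show ?thesis
        proof (cases "a = 0")
          case True
          then have "w j = 0" using that(1) J by (simp add: a_def l2n_eq_0)
          then show ?thesis using * \<open>\<beta> = r\<close> by simp
        next
          case False
          then have "inverse a * inverse a * a\<^sup>2 = 1" by (simp add: power2_eq_square field_simps)
          then show ?thesis using * \<open>\<beta> = r\<close> by simp
        qed
      qed
      moreover have "(\<Sum>k<Suc r. U' j k * cinner J (\<lambda>j. U' j k) (\<lambda>j. T j \<beta>)) =
          (\<Sum>k<r. U j k * cinner J (\<lambda>j. U j k) (\<lambda>j. T j \<beta>)) + u j * cinner J u (\<lambda>j. T j \<beta>)"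
        by (simp add: U'_def)
      ultimately show ?thesis using T[OF that(1), of \<beta>] that(2)
        by (cases "\<beta> = r") (auto simp: w_def c_def less_Suc_eq)
    qed
    show ?case using P W' T' by blast
  qed
  then show ?thesis using that by blast
qed

text \<open>Pythagoras, once the coefficients at zero columns are set to 0; this changes nothing on
  \<open>J\<close> and can only shrink the coefficient vector.\<close>

lemma partial_orthonormal_op_bound:
  assumes J: "finite J" and U: "partial_orthonormal J r U"
  shows "op_bound J {..<r} 1 U"
  unfolding op_bound_def
proof (intro conjI allI)
  fix v
  let ?f = "\<lambda>j. \<Sum>k<r. U j k * v k"
  have n: "l2n J (\<lambda>j. U j k) \<le> 1" if "k < r" for k
    using U that unfolding partial_orthonormal_def by (metis insertE order_refl singletonD zero_le_one)
  define c where "c k = (if l2n J (\<lambda>j. U j k) = 0 then 0 else v k)" for k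
  have fc: "?f j = (\<Sum>k<r. U j k * c k)" if "j \<in> J" for j
    using that J by (intro sum.cong) (auto simp: c_def l2n_eq_0)
  have "of_real ((l2n J ?f)\<^sup>2) = cinner J ?f (\<lambda>j. \<Sum>k<r. U j k * c k)"
    unfolding cinner_self[symmetric] by (rule cinner_cong_right) (rule fc)
  also have "\<dots> = (\<Sum>k<r. cinner J ?f (\<lambda>j. U j k) * c k)"
    by (simp add: cinner_sum_right cinner_scale_right)
  also have "\<dots> = (\<Sum>k<r. cnj (c k) * c k)"
  proof (rule sum.cong[OF refl])
    fix k assume k: "k \<in> {..<r}"
    have "cinner J (\<lambda>j. U j k) ?f = cinner J (\<lambda>j. U j k) (\<lambda>j. \<Sum>k<r. U j k * c k)"
      by (rule cinner_cong_right) (rule fc)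
    also have "\<dots> = c k"
      using k by (intro partial_orthonormal_cinner_sum[OF J U]) (auto simp: c_def)
    finally show "cinner J ?f (\<lambda>j. U j k) * c k = cnj (c k) * c k"
      using cinner_cnj[of J "\<lambda>j. U j k" ?f] by simp
  qed
  also have "\<dots> = of_real (\<Sum>k<r. (cmod (c k))\<^sup>2)"
    by (simp add: cnj_mult_self)
  finally have "(l2n J ?f)\<^sup>2 = (\<Sum>k<r. (cmod (c k))\<^sup>2)" by (simp only: of_real_eq_iff)
  also have "\<dots> \<le> (l2n {..<r} v)\<^sup>2" unfolding l2n_sq by (intro sum_mono) (auto simp: c_def)
  finally have "l2n J ?f \<le> l2n {..<r} v" by (rule power2_le_imp_le) simp
  then show "l2n J ?f \<le> 1 * l2n {..<r} v" by simp
qed simp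

text \<open>The adjoint of a contraction is a contraction: if \<open>c\<close> is the adjoint
  applied to \<open>g\<close>, the squared norm of \<open>c\<close> is the inner product of
  \<open>g\<close> with the image of \<open>c\<close>, hence at most the product of the norms of
  \<open>g\<close> and \<open>c\<close>.\<close>

lemma bessel:
  assumes J: "finite J" and U: "op_bound J {..<r} 1 U"
  shows "l2n {..<r} (\<lambda>k. cinner J (\<lambda>j. U j k) g) \<le> l2n J g"
proof -
  let ?c = "\<lambda>k. cinner J (\<lambda>j. U j k) g"
  have "of_real ((l2n {..<r} ?c)\<^sup>2) = cinner J g (\<lambda>j. \<Sum>k<r. U j k * ?c k)"
  proof -
    have "cinner J g (\<lambda>j. \<Sum>k<r. U j k * ?c k) = (\<Sum>k<r. cinner J g (\<lambda>j. U j k) * ?c k)"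
      by (simp add: cinner_sum_right cinner_scale_right)
    also have "\<dots> = (\<Sum>k<r. cnj (?c k) * ?c k)" by (simp add: cinner_cnj)
    also have "\<dots> = of_real ((l2n {..<r} ?c)\<^sup>2)"
      by (simp add: l2n_sq cnj_mult_self)
    finally show ?thesis by simp
  qed
  then have "cmod (of_real ((l2n {..<r} ?c)\<^sup>2)) = cmod (cinner J g (\<lambda>j. \<Sum>k<r. U j k * ?c k))"
    by (rule arg_cong)
  then have "(l2n {..<r} ?c)\<^sup>2 = cmod (cinner J g (\<lambda>j. \<Sum>k<r. U j k * ?c k))"
    by (simp only: norm_of_real abs_power2)
  also have "\<dots> \<le> l2n J g * l2n J (\<lambda>j. \<Sum>k<r. U j k * ?c k)"
    by (rule cmod_cinner_le)
  also have "\<dots> \<le> l2n J g * l2n {..<r} ?c"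
    using op_boundD[OF U, of ?c] by (intro mult_left_mono) auto
  finally have "l2n {..<r} ?c * l2n {..<r} ?c \<le> l2n J g * l2n {..<r} ?c" by (simp add: power2_eq_square)
  moreover have "0 < l2n {..<r} ?c" if "l2n {..<r} ?c \<noteq> 0"
    using that l2n_nonneg[of "{..<r}" ?c] by linarith
  ultimately show ?thesis
    by (metis l2n_nonneg mult_right_le_imp_le)
qed

section \<open>Tensor trains\<close>

text \<open>The list runs from the last site back to the first, so that list recursion splits off
  the rightmost factor and the length of the list is the number of the site. The empty list stands
  for the first unit row vector.\<close>

fun train :: "(nat \<Rightarrow> nat \<Rightarrow> 'i \<Rightarrow> nat \<Rightarrow> complex) \<Rightarrow> (nat \<Rightarrow> nat) \<Rightarrow> 'i list \<Rightarrow> nat \<Rightarrow> complex" where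
  "train X r [] \<beta> = (if \<beta> = 0 then 1 else 0)"
| "train X r (i # xs) \<beta> = (\<Sum>\<alpha><r (length xs). train X r xs \<alpha> * X (Suc (length xs)) \<alpha> i \<beta>)"

definition configs :: "'i set \<Rightarrow> nat \<Rightarrow> 'i list set" where
  "configs P l = {xs. set xs \<subseteq> P \<and> length xs = l}"

lemma finite_configs: "finite P \<Longrightarrow> finite (configs P l)"
  unfolding configs_def by (rule finite_lists_length_eq)

lemma configs_0 [simp]: "configs P 0 = {[]}"
  by (auto simp: configs_def)

lemma Cons_in_configs [simp]: "i # xs \<in> configs P (Suc l) \<longleftrightarrow> i \<in> P \<and> xs \<in> configs P l"
  by (auto simp: configs_def)

lemma length_configs: "xs \<in> configs P l \<Longrightarrow> length xs = l"
  by (simp add: configs_def)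

lemma configs_SucE:
  assumes "ys \<in> configs P (Suc l)"
  obtains i xs where "ys = i # xs" "i \<in> P" "xs \<in> configs P l"
  using assms by (cases ys) (auto simp: configs_def)

lemma sum_configs_Suc:
  assumes "finite P"
  shows "(\<Sum>xs\<in>configs P (Suc l). f xs) = (\<Sum>i\<in>P. \<Sum>xs\<in>configs P l. f (i # xs))"
proof -
  have "bij_betw (\<lambda>(i, xs). i # xs) (P \<times> configs P l) (configs P (Suc l))"
    by (auto simp: bij_betw_def inj_on_def image_iff elim: configs_SucE)
  from sum.reindex_bij_betw[OF this, of f] show ?thesis
    by (simp add: sum.cartesian_product case_prod_unfold)
qed

text \<open>For the ends of the chain: bond dimension 1 leaves a single column there, and Euclidean
  norms turn into operator bounds.\<close>

lemma op_bound_single_column: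
  assumes "0 \<le> t" "l2n J (\<lambda>j. A j 0) \<le> t"
  shows "op_bound J {..<Suc 0} t A"
  unfolding op_bound_def
proof (intro conjI allI)
  fix v :: "nat \<Rightarrow> complex"
  have "l2n J (\<lambda>j. \<Sum>k<Suc 0. A j k * v k) = cmod (v 0) * l2n J (\<lambda>j. A j 0)"
    using l2n_scale[of J "v 0" "\<lambda>j. A j 0"] by (simp add: mult.commute)
  also have "\<dots> \<le> cmod (v 0) * t" using assms by (intro mult_left_mono) auto
  also have "cmod (v 0) = l2n {..<Suc 0} v" by (simp add: l2n_def L2_set_def)
  finally show "l2n J (\<lambda>j. \<Sum>k<Suc 0. A j k * v k) \<le> t * l2n {..<Suc 0} v" by (simp add: mult.commute)
qed (use assms in simp)

lemma op_bound_single_columnD: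
  assumes "op_bound J {..<Suc 0} t A"
  shows "l2n J (\<lambda>j. A j 0) \<le> t"
  using op_boundD[OF assms, of "\<lambda>_. 1"] by (simp add: l2n_def L2_set_def)

text \<open>For each value of the new physical index \<open>U\<close> acts on a separate vector, so
  squared norms add over that index and the only losses are \<open>s\<close> and \<open>t\<close>.
  This is why \<open>Y\<close> is measured through the vertical stack of its local matrices.\<close>

lemma op_bound_step:
  assumes P: "finite P" and U: "op_bound (configs P l) {..<m} s U"
    and Y: "op_bound ({..<m} \<times> P) K t (\<lambda>p \<beta>. Y (fst p) (snd p) \<beta>)"
  shows "op_bound (configs P (Suc l)) K (s * t) (\<lambda>xs \<beta>. \<Sum>\<alpha><m. U (tl xs) \<alpha> * Y \<alpha> (hd xs) \<beta>)"
  unfolding op_bound_def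
proof (intro conjI allI)
  show "0 \<le> s * t" using U Y op_bound_nonneg by (metis mult_nonneg_nonneg)
  have s: "0 \<le> s" "0 \<le> t" using U Y op_bound_nonneg by blast+
  fix v
  define w where "w \<alpha> i = (\<Sum>\<beta>\<in>K. Y \<alpha> i \<beta> * v \<beta>)" for \<alpha> i
  have eq: "(\<Sum>\<beta>\<in>K. (\<Sum>\<alpha><m. U (tl xs) \<alpha> * Y \<alpha> (hd xs) \<beta>) * v \<beta>) = (\<Sum>\<alpha><m. U (tl xs) \<alpha> * w \<alpha> (hd xs))" for xs
    unfolding w_def sum_distrib_left sum_distrib_right by (subst sum.swap) (simp add: mult.assoc)
  have "(l2n (configs P (Suc l)) (\<lambda>xs. \<Sum>\<alpha><m. U (tl xs) \<alpha> * w \<alpha> (hd xs)))\<^sup>2 =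
      (\<Sum>i\<in>P. (l2n (configs P l) (\<lambda>xs. \<Sum>\<alpha><m. U xs \<alpha> * w \<alpha> i))\<^sup>2)"
    by (simp add: l2n_sq sum_configs_Suc[OF P])
  also have "\<dots> \<le> (\<Sum>i\<in>P. (s * l2n {..<m} (\<lambda>\<alpha>. w \<alpha> i))\<^sup>2)"
    by (intro sum_mono power_mono op_boundD[OF U]) auto
  also have "\<dots> = s\<^sup>2 * (\<Sum>i\<in>P. \<Sum>\<alpha><m. (cmod (w \<alpha> i))\<^sup>2)"
    by (simp add: power_mult_distrib l2n_sq sum_distrib_left)
  also have "(\<Sum>i\<in>P. \<Sum>\<alpha><m. (cmod (w \<alpha> i))\<^sup>2) = (l2n ({..<m} \<times> P) (\<lambda>p. w (fst p) (snd p)))\<^sup>2"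
    by (subst sum.swap) (simp add: l2n_sq sum.cartesian_product case_prod_unfold)
  also have "s\<^sup>2 * \<dots> \<le> s\<^sup>2 * (t * l2n K v)\<^sup>2"
    using op_boundD[OF Y, of v] unfolding w_def by (intro mult_left_mono power_mono) auto
  finally have "(l2n (configs P (Suc l)) (\<lambda>xs. \<Sum>\<alpha><m. U (tl xs) \<alpha> * w \<alpha> (hd xs)))\<^sup>2 \<le> (s * t * l2n K v)\<^sup>2"
    by (simp add: power_mult_distrib mult_ac)
  then show "l2n (configs P (Suc l)) (\<lambda>xs. \<Sum>\<beta>\<in>K. (\<Sum>\<alpha><m. U (tl xs) \<alpha> * Y \<alpha> (hd xs) \<beta>) * v \<beta>) \<le> s * t * l2n K v"
    unfolding eq by (rule power2_le_imp_le) (use s in auto)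
qed

definition site_bound :: "'i set \<Rightarrow> (nat \<Rightarrow> nat) \<Rightarrow> nat \<Rightarrow> real \<Rightarrow> (nat \<Rightarrow> 'i \<Rightarrow> nat \<Rightarrow> complex) \<Rightarrow> bool" where
  "site_bound P r l t Y \<longleftrightarrow> op_bound ({..<r (l - 1)} \<times> P) {..<r l} t (\<lambda>p \<beta>. Y (fst p) (snd p) \<beta>)"

lemma train_op_bound:
  assumes P: "finite P" and r: "r 0 = 1"
    and Y: "\<And>l. l \<in> {1..n} \<Longrightarrow> site_bound P r l 1 (Y l)"
  shows "l \<le> n \<Longrightarrow> op_bound (configs P l) {..<r l} 1 (train Y r)"
proof (induction l)
  case 0
  show ?case unfolding r configs_0
    using op_bound_single_column[of 1 "{[]}" "train Y r"] by (simp add: l2n_def L2_set_def)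
next
  case (Suc l)
  have "op_bound (configs P (Suc l)) {..<r (Suc l)} (1 * 1)
      (\<lambda>xs \<beta>. \<Sum>\<alpha><r l. train Y r (tl xs) \<alpha> * Y (Suc l) \<alpha> (hd xs) \<beta>)"
    using Suc Y[of "Suc l"] by (intro op_bound_step[OF P]) (auto simp: site_bound_def)
  also have "op_bound (configs P (Suc l)) {..<r (Suc l)} (1 * 1)
      (\<lambda>xs \<beta>. \<Sum>\<alpha><r l. train Y r (tl xs) \<alpha> * Y (Suc l) \<alpha> (hd xs) \<beta>) =
      op_bound (configs P (Suc l)) {..<r (Suc l)} (1 * 1) (train Y r)"
    by (rule op_bound_cong) (auto elim!: configs_SucE simp: length_configs)
  finally show ?case by simp
qed

text \<open>One site further, the difference is the \<open>X\<close>-prefix times the new error plus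
  the old error times the \<open>Y\<close>-site. Both accompanying factors are contractions, so
  errors add up instead of multiplying.\<close>

lemma train_diff_op_bound:
  assumes P: "finite P" and r: "r 0 = 1"
    and X: "\<And>l. l \<in> {1..n} \<Longrightarrow> site_bound P r l 1 (X l)"
    and Y: "\<And>l. l \<in> {1..n} \<Longrightarrow> site_bound P r l 1 (Y l)"
    and d: "\<And>l. l \<in> {1..n} \<Longrightarrow> site_bound P r l \<epsilon> (\<lambda>\<alpha> i \<beta>. X l \<alpha> i \<beta> - Y l \<alpha> i \<beta>)"
  shows "l \<le> n \<Longrightarrow> op_bound (configs P l) {..<r l} (real l * \<epsilon>) (\<lambda>xs \<beta>. train X r xs \<beta> - train Y r xs \<beta>)"
proof (induction l)
  case 0
  show ?case unfolding r configs_0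
    using op_bound_single_column[of 0 "{[]}" "\<lambda>xs \<beta>. train X r xs \<beta> - train Y r xs \<beta>"] by (simp add: l2n_def L2_set_def)
next
  case (Suc l)
  let ?A = "\<lambda>xs \<beta>. \<Sum>\<alpha><r l. train X r (tl xs) \<alpha> * (X (Suc l) \<alpha> (hd xs) \<beta> - Y (Suc l) \<alpha> (hd xs) \<beta>)"
  let ?B = "\<lambda>xs \<beta>. \<Sum>\<alpha><r l. (train X r (tl xs) \<alpha> - train Y r (tl xs) \<alpha>) * Y (Suc l) \<alpha> (hd xs) \<beta>"
  have l: "l \<le> n" using Suc.prems by simp
  have "op_bound (configs P (Suc l)) {..<r (Suc l)} (1 * \<epsilon>) ?A"
    using Suc.prems d[of "Suc l"] train_op_bound[OF P r X l]
    by (intro op_bound_step[OF P, where Y = "\<lambda>\<alpha> i \<beta>. X (Suc l) \<alpha> i \<beta> - Y (Suc l) \<alpha> i \<beta>"]) (auto simp: site_bound_def)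
  moreover have "op_bound (configs P (Suc l)) {..<r (Suc l)} (real l * \<epsilon> * 1) ?B"
    using Suc Y[of "Suc l"] by (intro op_bound_step[OF P]) (auto simp: site_bound_def)
  ultimately have "op_bound (configs P (Suc l)) {..<r (Suc l)} (1 * \<epsilon> + real l * \<epsilon> * 1) (\<lambda>xs \<beta>. ?A xs \<beta> + ?B xs \<beta>)"
    by (rule op_bound_add)
  also have "op_bound (configs P (Suc l)) {..<r (Suc l)} (1 * \<epsilon> + real l * \<epsilon> * 1) (\<lambda>xs \<beta>. ?A xs \<beta> + ?B xs \<beta>) =
     op_bound (configs P (Suc l)) {..<r (Suc l)} (1 * \<epsilon> + real l * \<epsilon> * 1) (\<lambda>xs \<beta>. train X r xs \<beta> - train Y r xs \<beta>)"
    by (rule op_bound_cong)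
      (auto elim!: configs_SucE simp: length_configs algebra_simps sum.distrib[symmetric] sum_subtractf[symmetric])
  finally show ?case by (simp add: algebra_simps)
qed

text \<open>Every partial contraction is compressed to an orthonormal system \<open>U l\<close> for its column space
  (zero columns filling up a rank deficit); the new local matrices are the coordinates of
  \<open>U l\<close> with respect to \<open>U (l - 1)\<close>, hence contractions by Bessel's inequality.\<close>

lemma train_canonical:
  assumes P: "finite P" and r: "r 0 = 1" "r n = 1" and n: "1 \<le> n"
    and norm: "l2n (configs P n) (\<lambda>xs. train X r xs 0) \<le> 1"
  obtains Y where "\<And>l. l \<in> {1..n} \<Longrightarrow> site_bound P r l 1 (Y l)"
    "\<And>xs. xs \<in> configs P n \<Longrightarrow> train Y r xs 0 = train X r xs 0"
proof -
  let ?C = "configs P"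
  \<comment> \<open>At the two ends the partial contraction itself serves as \<open>U\<close>, so
    that the new train has the same start and the same final values. At site \<open>n\<close> it is
    a contraction by the norm hypothesis but need not be orthonormal; reconstruction from
    coordinates is therefore demanded for \<open>l < n\<close> only.\<close>
  define Q where "Q l U W \<longleftrightarrow> op_bound (?C l) {..<r l} 1 U \<and>
    (\<forall>xs. \<forall>k<r l. U xs k = (\<Sum>\<beta><r l. train X r xs \<beta> * W \<beta> k)) \<and>
    (l < n \<longrightarrow> (\<forall>xs\<in>?C l. \<forall>\<beta><r l. train X r xs \<beta> =
       (\<Sum>k<r l. U xs k * cinner (?C l) (\<lambda>xs. U xs k) (\<lambda>xs. train X r xs \<beta>)))) \<and>
    (l = 0 \<or> l = n \<longrightarrow> (\<forall>xs\<in>?C l. \<forall>\<beta><r l. U xs \<beta> = train X r xs \<beta>))" for l U and W :: "nat \<Rightarrow> nat \<Rightarrow> complex"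
  have "\<exists>U W. Q l U W" for l
  proof -
    consider "l = 0" | "l = n" | "l \<noteq> 0" "l \<noteq> n" by blast
    then show ?thesis
    proof cases
      case 1
      have "op_bound (?C 0) {..<Suc 0} 1 (train X r)"
        by (rule op_bound_single_column) (auto simp: l2n_def L2_set_def)
      then have "Q 0 (train X r) (\<lambda>_ _. 1)" using r n by (auto simp: Q_def cinner_def)
      then show ?thesis using 1 by blast
    next
      case 2
      have "op_bound (?C n) {..<Suc 0} 1 (train X r)"
        using norm by (intro op_bound_single_column) auto
      then have "Q n (train X r) (\<lambda>_ _. 1)" using r n by (auto simp: Q_def)
      then show ?thesis using 2 by blast
    next
      case 3
      obtain U W where "partial_orthonormal (?C l) (r l) U"
        "\<And>xs k. k < r l \<Longrightarrow> U xs k = (\<Sum>\<beta><r l. train X r xs \<beta> * W \<beta> k)"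
        "\<And>xs \<beta>. xs \<in> ?C l \<Longrightarrow> \<beta> < r l \<Longrightarrow> train X r xs \<beta> =
          (\<Sum>k<r l. U xs k * cinner (?C l) (\<lambda>xs. U xs k) (\<lambda>xs. train X r xs \<beta>))"
        using orthonormalise[OF finite_configs[OF P, of l], of "r l" "train X r"] by blast
      then have "Q l U W"
        using 3 partial_orthonormal_op_bound[OF finite_configs[OF P]] unfolding Q_def by blast
      then show ?thesis by blast
    qed
  qed
  then obtain U W where Q: "\<And>l. Q l (U l) (W l)" by metis
  have U: "op_bound (?C l) {..<r l} 1 (U l)" for l using Q[of l] by (simp add: Q_def)
  define Y where "Y l \<alpha> i \<beta> = cinner (?C (l - 1)) (\<lambda>xs. U (l - 1) xs \<alpha>) (\<lambda>xs. U l (i # xs) \<beta>)" for l \<alpha> i \<beta>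
  have site: "site_bound P r l 1 (Y l)" if "l \<in> {1..n}" for l
  proof -
    obtain m where l: "l = Suc m" using \<open>l \<in> {1..n}\<close> by (cases l) auto
    have "l2n ({..<r m} \<times> P) (\<lambda>p. \<Sum>\<beta><r (Suc m). Y (Suc m) (fst p) (snd p) \<beta> * v \<beta>) \<le> 1 * l2n {..<r (Suc m)} v" for v
    proof -
      \<comment> \<open>With \<open>v\<close> applied first, Bessel acts on one slice of
        \<open>g\<close> per physical index, and the slices together make up the norm of
        \<open>g\<close>.\<close>
      define g where "g xs = (\<Sum>\<beta><r (Suc m). U (Suc m) xs \<beta> * v \<beta>)" for xs
      have "(l2n ({..<r m} \<times> P) (\<lambda>p. \<Sum>\<beta><r (Suc m). Y (Suc m) (fst p) (snd p) \<beta> * v \<beta>))\<^sup>2 =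
          (l2n ({..<r m} \<times> P) (\<lambda>p. cinner (?C m) (\<lambda>xs. U m xs (fst p)) (\<lambda>xs. g (snd p # xs))))\<^sup>2"
        by (simp add: Y_def g_def cinner_sum_right cinner_scale_right)
      also have "\<dots> = (\<Sum>\<alpha><r m. \<Sum>i\<in>P. (cmod (cinner (?C m) (\<lambda>xs. U m xs \<alpha>) (\<lambda>xs. g (i # xs))))\<^sup>2)"
        by (simp add: l2n_sq sum.cartesian_product case_prod_unfold)
      also have "\<dots> = (\<Sum>i\<in>P. (l2n {..<r m} (\<lambda>\<alpha>. cinner (?C m) (\<lambda>xs. U m xs \<alpha>) (\<lambda>xs. g (i # xs))))\<^sup>2)"
        by (subst sum.swap) (simp add: l2n_sq)
      also have "\<dots> \<le> (\<Sum>i\<in>P. (l2n (?C m) (\<lambda>xs. g (i # xs)))\<^sup>2)"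
        by (intro sum_mono power_mono bessel finite_configs P U) auto
      also have "\<dots> = (l2n (?C (Suc m)) g)\<^sup>2" by (simp add: l2n_sq sum_configs_Suc[OF P])
      also have "\<dots> \<le> (1 * l2n {..<r (Suc m)} v)\<^sup>2"
        unfolding g_def by (intro power_mono op_boundD[OF U]) auto
      finally show ?thesis by (rule power2_le_imp_le) auto
    qed
    then show ?thesis unfolding l site_bound_def op_bound_def by simp
  qed
  \<comment> \<open>Fixing the last index of a column of \<open>U (Suc l)\<close> gives a vector in
    the span of the partial trains of length \<open>l\<close>. \<open>U l\<close> reproduces these,
    so passing to coordinates loses nothing.\<close>
  have step: "U (Suc l) (i # xs) \<beta> = (\<Sum>\<alpha><r l. U l xs \<alpha> * Y (Suc l) \<alpha> i \<beta>)"
    if l: "l < n" and xs: "xs \<in> ?C l" and \<beta>: "\<beta> < r (Suc l)" for l i xs \<beta>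
  proof -
    define d where "d \<alpha> = (\<Sum>\<gamma><r (Suc l). X (Suc l) \<alpha> i \<gamma> * W (Suc l) \<gamma> \<beta>)" for \<alpha>
    have h: "U (Suc l) (i # ys) \<beta> = (\<Sum>\<alpha><r l. train X r ys \<alpha> * d \<alpha>)" if "ys \<in> ?C l" for ys
    proof -
      have "U (Suc l) (i # ys) \<beta> = (\<Sum>\<gamma><r (Suc l). train X r (i # ys) \<gamma> * W (Suc l) \<gamma> \<beta>)"
        using Q[of "Suc l"] \<beta> unfolding Q_def by blast
      also have "\<dots> = (\<Sum>\<gamma><r (Suc l). \<Sum>\<alpha><r l. train X r ys \<alpha> * (X (Suc l) \<alpha> i \<gamma> * W (Suc l) \<gamma> \<beta>))"
        by (simp add: length_configs[OF that] sum_distrib_right mult.assoc)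
      also have "\<dots> = (\<Sum>\<alpha><r l. train X r ys \<alpha> * d \<alpha>)"
        unfolding d_def sum_distrib_left by (rule sum.swap)
      finally show ?thesis .
    qed
    have "U (Suc l) (i # xs) \<beta> = (\<Sum>\<alpha><r l. train X r xs \<alpha> * d \<alpha>)" by (rule h[OF xs])
    also have "\<dots> = (\<Sum>\<alpha><r l. (\<Sum>k<r l. U l xs k * cinner (?C l) (\<lambda>xs. U l xs k) (\<lambda>xs. train X r xs \<alpha>)) * d \<alpha>)"
      using Q[of l] l xs unfolding Q_def by (intro sum.cong refl arg_cong2[where f = "(*)"]) blast
    also have "\<dots> = (\<Sum>k<r l. U l xs k * (\<Sum>\<alpha><r l. cinner (?C l) (\<lambda>xs. U l xs k) (\<lambda>xs. train X r xs \<alpha>) * d \<alpha>))"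
      unfolding sum_distrib_left sum_distrib_right by (subst sum.swap) (simp only: mult.assoc)
    also have "\<dots> = (\<Sum>k<r l. U l xs k * cinner (?C l) (\<lambda>xs. U l xs k) (\<lambda>xs. \<Sum>\<alpha><r l. train X r xs \<alpha> * d \<alpha>))"
      by (simp only: cinner_sum_right cinner_scale_right)
    also have "\<dots> = (\<Sum>k<r l. U l xs k * Y (Suc l) k i \<beta>)"
      by (simp add: Y_def cinner_def h)
    finally show ?thesis .
  qed
  have tr: "l \<le> n \<Longrightarrow> xs \<in> ?C l \<Longrightarrow> \<beta> < r l \<Longrightarrow> train Y r xs \<beta> = U l xs \<beta>" for l xs \<beta>
  proof (induction l arbitrary: xs \<beta>)
    case 0
    then show ?case using Q[of 0] r by (auto simp: Q_def)
  next
    case (Suc l)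
    then obtain i ys where xs: "xs = i # ys" "ys \<in> ?C l" by (auto elim: configs_SucE)
    show ?case using Suc step[of l ys \<beta> i] by (simp add: xs length_configs[OF xs(2)])
  qed
  show ?thesis
  proof (rule that[OF site])
    fix xs assume xs: "xs \<in> ?C n"
    have "0 < r n" using r by simp
    with Q[of n] xs have "U n xs 0 = train X r xs 0" unfolding Q_def by blast
    with xs show "train Y r xs 0 = train X r xs 0"
      using tr[of n xs 0] r by simp
  qed
qed

text \<open>The centers depend on \<open>P\<close>, \<open>r\<close>, \<open>n\<close> and
  \<epsilon> alone. The local matrices \<open>X\<close> may be arbitrarily large;
  \<open>train_canonical\<close> exchanges them for contractions with the same train before the nets
  are used.\<close>

lemma train_net:
  fixes P :: "'i set"
  assumes P: "finite P" and r: "r 0 = 1" "r n = 1" and n: "1 \<le> n" and e: "0 < \<epsilon>" "\<epsilon> \<le> 1"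
  shows "\<exists>C. finite C \<and>
    real (card C) \<le> (\<Prod>l = 1..n. (4 / \<epsilon>) ^ (2 * (r (l - 1) * card P * r l))) \<and>
    (\<forall>X. l2n (configs P n) (\<lambda>xs. train X r xs 0) \<le> 1 \<longrightarrow>
      (\<exists>c\<in>C. l2n (configs P n) (\<lambda>xs. train X r xs 0 - c xs) \<le> real n * \<epsilon>))"
proof -
  define B where "B l t x \<longleftrightarrow> site_bound P r l t (\<lambda>\<alpha> i \<beta>. x ((\<alpha>, i), \<beta>))" for l t x
  have "\<exists>N. finite N \<and> N \<subseteq> {x. B l 1 x} \<and> real (card N) \<le> (4 / \<epsilon>) ^ (2 * (r (l - 1) * card P * r l)) \<and>
      (\<forall>x. B l 1 x \<longrightarrow> (\<exists>c\<in>N. B l \<epsilon> (\<lambda>i. x i - c i)))" for l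
  proof -
    interpret norm_balls "({..<r (l - 1)} \<times> P) \<times> {..<r l}" "B l" "1 + real (card ({..<r (l - 1)} \<times> P) * card {..<r l})"
      using op_bound_norm_balls[of "{..<r (l - 1)} \<times> P" "{..<r l}"] P by (simp add: B_def[abs_def] site_bound_def)
    have "card (({..<r (l - 1)} \<times> P) \<times> {..<r l}) = r (l - 1) * card P * r l"
      by (simp add: card_cartesian_product)
    then show ?thesis using net_exists[OF e] by simp
  qed
  then have "\<forall>l. \<exists>N. finite N \<and> N \<subseteq> {x. B l 1 x} \<and> real (card N) \<le> (4 / \<epsilon>) ^ (2 * (r (l - 1) * card P * r l)) \<and>
      (\<forall>x. B l 1 x \<longrightarrow> (\<exists>c\<in>N. B l \<epsilon> (\<lambda>i. x i - c i)))" ..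
  from choice[OF this] obtain N where
    N0: "\<forall>l. finite (N l) \<and> N l \<subseteq> {x. B l 1 x} \<and> real (card (N l)) \<le> (4 / \<epsilon>) ^ (2 * (r (l - 1) * card P * r l)) \<and>
      (\<forall>x. B l 1 x \<longrightarrow> (\<exists>c\<in>N l. B l \<epsilon> (\<lambda>i. x i - c i)))" ..
  have N: "finite (N l)" "N l \<subseteq> {x. B l 1 x}"
      "real (card (N l)) \<le> (4 / \<epsilon>) ^ (2 * (r (l - 1) * card P * r l))"
      "B l 1 x \<Longrightarrow> \<exists>c\<in>N l. B l \<epsilon> (\<lambda>i. x i - c i)" for l x
    using N0[rule_format, of l] by simp_all
  define F where "F z xs = train (\<lambda>l \<alpha> i \<beta>. z l ((\<alpha>, i), \<beta>)) r xs 0" for z and xs :: "'i list"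
  let ?Z = "PiE {1..n} N"
  show ?thesis
  proof (intro exI[of _ "F ` ?Z"] conjI allI impI)
    show "finite (F ` ?Z)" using N by (intro finite_imageI finite_PiE) auto
    have "card (F ` ?Z) \<le> card ?Z" using N by (intro card_image_le finite_PiE) auto
    also have "card ?Z = (\<Prod>l = 1..n. card (N l))" by (simp add: card_PiE)
    finally have "real (card (F ` ?Z)) \<le> (\<Prod>l = 1..n. real (card (N l)))"
      by (metis of_nat_le_iff of_nat_prod)
    also have "\<dots> \<le> (\<Prod>l = 1..n. (4 / \<epsilon>) ^ (2 * (r (l - 1) * card P * r l)))"
      using N by (intro prod_mono) auto
    finally show "real (card (F ` ?Z)) \<le> (\<Prod>l = 1..n. (4 / \<epsilon>) ^ (2 * (r (l - 1) * card P * r l)))" .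
    fix X assume "l2n (configs P n) (\<lambda>xs. train X r xs 0) \<le> 1"
    then obtain Y where Y: "\<And>l. l \<in> {1..n} \<Longrightarrow> site_bound P r l 1 (Y l)"
      "\<And>xs. xs \<in> configs P n \<Longrightarrow> train Y r xs 0 = train X r xs 0"
      using train_canonical[OF P r n] by blast
    define y where "y l = (\<lambda>((\<alpha>, i), \<beta>). Y l \<alpha> i \<beta>)" for l
    have "B l 1 (y l)" if "l \<in> {1..n}" for l using Y(1)[OF that] by (simp add: B_def y_def)
    then have "\<forall>l\<in>{1..n}. \<exists>c. c \<in> N l \<and> B l \<epsilon> (\<lambda>i. y l i - c i)" using N(4) by blast
    from bchoice[OF this] obtain z where z: "\<forall>l\<in>{1..n}. z l \<in> N l \<and> B l \<epsilon> (\<lambda>i. y l i - z l i)" ..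
    let ?z = "restrict z {1..n}"
    have "op_bound (configs P n) {..<r n} (real n * \<epsilon>)
        (\<lambda>xs \<beta>. train Y r xs \<beta> - train (\<lambda>l \<alpha> i \<beta>. ?z l ((\<alpha>, i), \<beta>)) r xs \<beta>)"
    proof (rule train_diff_op_bound[where n = n and P = P and r = r and X = Y and
          Y = "\<lambda>l \<alpha> i \<beta>. ?z l ((\<alpha>, i), \<beta>)"])
      show "finite P" "r 0 = 1" using P r by auto
    next
      fix l assume l: "l \<in> {1..n}"
      show "site_bound P r l 1 (Y l)" by (rule Y(1)[OF l])
      show "site_bound P r l 1 (\<lambda>\<alpha> i \<beta>. ?z l ((\<alpha>, i), \<beta>))"
        using z l N(2)[of l] by (auto simp: B_def)
      show "site_bound P r l \<epsilon> (\<lambda>\<alpha> i \<beta>. Y l \<alpha> i \<beta> - ?z l ((\<alpha>, i), \<beta>))"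
        using z l by (simp add: B_def y_def)
    qed simp
    then have "l2n (configs P n) (\<lambda>xs. train Y r xs 0 - F ?z xs) \<le> real n * \<epsilon>"
      unfolding F_def r One_nat_def by (rule op_bound_single_columnD)
    moreover have "l2n (configs P n) (\<lambda>xs. train Y r xs 0 - F ?z xs) = l2n (configs P n) (\<lambda>xs. train X r xs 0 - F ?z xs)"
      by (rule l2n_cong) (simp add: Y(2))
    ultimately have "l2n (configs P n) (\<lambda>xs. train X r xs 0 - F ?z xs) \<le> real n * \<epsilon>" by simp
    moreover have "F ?z \<in> F ` ?Z" using z by (intro imageI) auto
    ultimately show "\<exists>c\<in>F ` ?Z. l2n (configs P n) (\<lambda>xs. train X r xs 0 - c xs) \<le> real n * \<epsilon>" ..
  qed
qed

section \<open>Covering numbers\<close>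

lemma log_covering_number_le:
  assumes "finite C" "C \<subseteq> centers" "S \<subseteq> (\<Union>c\<in>C. cell c)" "real (card C) \<le> exp b"
  shows "log_enat (covering_number cell centers S) \<le> ereal b"
proof -
  have "covering_number cell centers S \<le> enat (card C)"
    unfolding covering_number_def using assms by (intro INF_lower) auto
  then obtain k where k: "covering_number cell centers S = enat k" "k \<le> card C"
    by (cases "covering_number cell centers S") auto
  have "ln (real k) \<le> b" if "k \<noteq> 0"
  proof -
    have "real k \<le> exp b" using k assms(4) by linarith
    then have "ln (real k) \<le> ln (exp b)" using that by (intro ln_mono) auto
    then show ?thesis by simp
  qed
  then show ?thesis by (simp add: k log_enat_def)
qed

lemma frob_norm_l2n: "A \<in> carrier_mat N M \<Longrightarrow> frob_norm A = l2n ({..<N} \<times> {..<M}) (\<lambda>p. A $$ p)"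
  by (simp add: frob_norm_def l2n_def L2_set_def sum.cartesian_product)

lemma vec_l2_norm_l2n: "v \<in> carrier_vec N \<Longrightarrow> vec_l2_norm v = l2n {..<N} (\<lambda>i. v $ i)"
  by (simp add: vec_l2_norm_def l2n_def L2_set_def)

lemma log_mat_covering_number_le:
  assumes C: "finite C" "real (card C) \<le> exp b" and S: "S \<subseteq> carrier_mat N N"
    and cover: "\<And>A. A \<in> S \<Longrightarrow> \<exists>c\<in>C. l2n ({..<N} \<times> {..<N}) (\<lambda>p. A $$ p - c p) \<le> \<epsilon>"
  shows "log_enat (mat_covering_number N \<epsilon> S) \<le> ereal b"
  unfolding mat_covering_number_def
proof (rule log_covering_number_le)
  let ?C = "(\<lambda>c. mat N N c) ` C"
  show "finite ?C" using C by simp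
  show "?C \<subseteq> carrier_mat N N" by auto
  show "real (card ?C) \<le> exp b" using card_image_le[OF C(1), of "mat N N"] C(2) by linarith
  show "S \<subseteq> (\<Union>c\<in>?C. {A \<in> carrier_mat N N. frob_norm (A - c) \<le> \<epsilon>})"
  proof
    fix A assume A: "A \<in> S"
    then obtain c where c: "c \<in> C" "l2n ({..<N} \<times> {..<N}) (\<lambda>p. A $$ p - c p) \<le> \<epsilon>" using cover by blast
    have car: "A \<in> carrier_mat N N" using A S by auto
    have "frob_norm (A - mat N N c) = l2n ({..<N} \<times> {..<N}) (\<lambda>p. (A - mat N N c) $$ p)"
      using car by (intro frob_norm_l2n) auto
    also have "\<dots> = l2n ({..<N} \<times> {..<N}) (\<lambda>p. A $$ p - c p)"
      using car by (intro l2n_cong) auto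
    finally show "A \<in> (\<Union>c\<in>?C. {A \<in> carrier_mat N N. frob_norm (A - c) \<le> \<epsilon>})"
      using c car by (intro UN_I[of "mat N N c"]) auto
  qed
qed

lemma log_vec_covering_number_le:
  assumes C: "finite C" "real (card C) \<le> exp b" and S: "S \<subseteq> carrier_vec N"
    and cover: "\<And>v. v \<in> S \<Longrightarrow> \<exists>c\<in>C. l2n {..<N} (\<lambda>i. v $ i - c i) \<le> \<epsilon>"
  shows "log_enat (vec_covering_number N \<epsilon> S) \<le> ereal b"
  unfolding vec_covering_number_def
proof (rule log_covering_number_le)
  let ?C = "(\<lambda>c. vec N c) ` C"
  show "finite ?C" using C by simp
  show "?C \<subseteq> carrier_vec N" by auto
  show "real (card ?C) \<le> exp b" using card_image_le[OF C(1), of "vec N"] C(2) by linarith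
  show "S \<subseteq> (\<Union>c\<in>?C. {v \<in> carrier_vec N. vec_l2_norm (v - c) \<le> \<epsilon>})"
  proof
    fix v assume v: "v \<in> S"
    then obtain c where c: "c \<in> C" "l2n {..<N} (\<lambda>i. v $ i - c i) \<le> \<epsilon>" using cover by blast
    have car: "v \<in> carrier_vec N" using v S by auto
    have "vec_l2_norm (v - vec N c) = l2n {..<N} (\<lambda>i. (v - vec N c) $ i)"
      using car by (intro vec_l2_norm_l2n) auto
    also have "\<dots> = l2n {..<N} (\<lambda>i. v $ i - c i)"
      using car by (intro l2n_cong) auto
    finally show "v \<in> (\<Union>c\<in>?C. {v \<in> carrier_vec N. vec_l2_norm (v - c) \<le> \<epsilon>})"
      using c car by (intro UN_I[of "vec N c"]) auto
  qed
qed

section \<open>Matrices without structure and sparse matrices\<close>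

lemma l2n_norm_balls:
  assumes "finite I"
  shows "norm_balls I (\<lambda>t x. l2n I x \<le> t) (1 + real (card I))"
proof
  show "finite I" by fact
  fix s t :: real and x y :: "'a \<Rightarrow> complex" and c :: real
  show "l2n I (\<lambda>i. x i + y i) \<le> s + t" if "l2n I x \<le> s" "l2n I y \<le> t"
    using l2n_triangle[of I x y] that by linarith
  show "l2n I (\<lambda>i. complex_of_real c * x i) \<le> \<bar>c\<bar> * t" if "l2n I x \<le> t"
    unfolding l2n_scale norm_of_real using that by (rule mult_left_mono) simp
  show "l2n I x \<le> t" if "l2n I x \<le> s" "s \<le> t" using that by simp
  show "cmod (x i) \<le> t" if "l2n I x \<le> t" "i \<in> I" for i
    using l2n_member[OF assms that(2), of x] that(1) by linarith
  show "l2n I x \<le> (1 + real (card I)) * t" if "0 \<le> t" "\<And>i. i \<in> I \<Longrightarrow> cmod (x i) \<le> t"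
  proof -
    have "l2n I x \<le> (\<Sum>i\<in>I. cmod (x i))" by (rule l2n_le_sum)
    also have "\<dots> \<le> (\<Sum>i\<in>I. t)" by (rule sum_mono) (rule that)
    also have "\<dots> \<le> (1 + real (card I)) * t" using that(1) by (simp add: algebra_simps)
    finally show ?thesis .
  qed
qed simp

lemma l2n_net:
  assumes "finite I" "0 < \<epsilon>" "\<epsilon> \<le> 1"
  shows "\<exists>C. finite C \<and> C \<subseteq> {x. l2n I x \<le> 1} \<and> real (card C) \<le> (4 / \<epsilon>) ^ (2 * card I) \<and>
    (\<forall>x. l2n I x \<le> 1 \<longrightarrow> (\<exists>c\<in>C. l2n I (\<lambda>i. x i - c i) \<le> \<epsilon>))"
proof -
  interpret norm_balls I "\<lambda>t x. l2n I x \<le> t" "1 + real (card I)" by (rule l2n_norm_balls) fact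
  show ?thesis by (rule net_exists[OF assms(2,3)])
qed

lemma phy_setD:
  assumes "A \<in> phy_set d n"
  shows "A \<in> carrier_mat (d ^ n) (d ^ n)" "l2n ({..<d ^ n} \<times> {..<d ^ n}) (\<lambda>p. A $$ p) = 1"
  using assms by (auto simp: phy_set_def frob_norm_l2n)

lemma log_phy_covering_le:
  "log_enat (mat_covering_number (d ^ n) (1 / 2) (phy_set d n)) \<le> ereal (6 * real (d ^ (2 * n)))"
proof -
  let ?I = "{..<d ^ n} \<times> {..<d ^ n}"
  obtain C where C: "finite C" "real (card C) \<le> (4 / (1 / 2)) ^ (2 * card ?I)"
    "\<And>x. l2n ?I x \<le> 1 \<Longrightarrow> \<exists>c\<in>C. l2n ?I (\<lambda>i. x i - c i) \<le> 1 / 2"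
    using l2n_net[of ?I "1 / 2"] by auto
  \<comment> \<open>A net of accuracy 1/2 in \<open>m\<close> complex dimensions has at most 8^(2m)
    points; 8 \<le> e^3 follows from 2 \<le> e and gives the constant 6.\<close>
  have ln8: "(8::real) \<le> exp 3"
  proof -
    have "(2::real) ^ 3 \<le> exp 1 ^ 3" using exp_ge_add_one_self[of 1] by (intro power_mono) auto
    then show ?thesis by (simp add: exp_of_nat_mult[symmetric])
  qed
  have "card ?I = d ^ (2 * n)" by (simp add: card_cartesian_product power_add[symmetric] mult_2)
  then have "real (card C) \<le> 8 ^ (2 * d ^ (2 * n))" using C(2) by simp
  also have "\<dots> \<le> exp 3 ^ (2 * d ^ (2 * n))" using ln8 by (intro power_mono) auto
  also have "\<dots> = exp (6 * real (d ^ (2 * n)))" by (simp add: exp_of_nat_mult[symmetric])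
  finally have "real (card C) \<le> exp (6 * real (d ^ (2 * n)))" .
  then show ?thesis
  proof (rule log_mat_covering_number_le[OF C(1)])
    show "phy_set d n \<subseteq> carrier_mat (d ^ n) (d ^ n)" using phy_setD by blast
    show "\<exists>c\<in>C. l2n ?I (\<lambda>p. A $$ p - c p) \<le> 1 / 2" if "A \<in> phy_set d n" for A
      by (intro C(3)) (simp add: phy_setD[OF that])
  qed
qed

text \<open>The standard bound (e m / s)^s. It rests on s^s / s! being one term of the series of exp
  s.\<close>

lemma binomial_le_exp:
  assumes "1 \<le> s" "s \<le> m"
  shows "real (m choose s) \<le> exp (real s * (1 + ln (real m / real s)))"
proof -
  have "(\<Sum>k\<in>{s}. real s ^ k /\<^sub>R fact k) \<le> exp (real s)"
    unfolding exp_def using summable_exp_generic[of "real s"] by (intro sum_le_suminf) auto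
  then have f: "real s ^ s \<le> exp (real s) * fact s" by (simp add: field_simps)
  have "real (m choose s) * fact s \<le> real m ^ s"
    using binomial_fact_pow[of m s] by (metis of_nat_fact of_nat_le_iff of_nat_mult of_nat_power)
  then have "real (m choose s) * real s ^ s * fact s \<le> real m ^ s * (exp (real s) * fact s)"
    using mult_mono[OF _ f, of "real (m choose s) * fact s" "real m ^ s"] by (simp add: mult_ac)
  then have "real (m choose s) * real s ^ s \<le> real m ^ s * exp (real s)" by simp
  then have "real (m choose s) \<le> (real m / real s) ^ s * exp (real s)"
    using assms by (simp add: power_divide field_simps)
  also have "(real m / real s) ^ s = exp (real s * ln (real m / real s))"
    using assms by (simp add: exp_of_nat_mult)
  finally show ?thesis by (simp add: exp_add[symmetric] algebra_simps)
qed

text \<open>One net for each support, extended by zero. In the 9, the number of supports accounts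
  for 1 and the size of a net, 16^(2s) \<le> exp (8s), for 8.\<close>

lemma log_sparse_covering_le:
  assumes "1 \<le> s" "s \<le> d ^ (2 * n)"
  shows "log_enat (mat_covering_number (d ^ n) (1 / 4) (sparse_set d n s))
    \<le> ereal (real s * (9 + ln (real (d ^ (2 * n)) / real s)))"
proof -
  let ?I = "{..<d ^ n} \<times> {..<d ^ n}" and ?m = "d ^ (2 * n)"
  define \<T> where "\<T> = {T. T \<subseteq> ?I \<and> card T = s}"
  have cI: "card ?I = ?m" by (simp add: card_cartesian_product power_add[symmetric] mult_2)
  have T: "finite T" if "T \<in> \<T>" for T using that finite_subset[of T ?I] by (auto simp: \<T>_def)
  have fT: "finite \<T>" unfolding \<T>_def by simp
  have cT: "card \<T> = ?m choose s" unfolding \<T>_def using n_subsets[of ?I s] cI by simp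
  have "\<forall>T\<in>\<T>. \<exists>C. finite C \<and> real (card C) \<le> 16 ^ (2 * s) \<and>
      (\<forall>x. l2n T x \<le> 1 \<longrightarrow> (\<exists>c\<in>C. l2n T (\<lambda>i. x i - c i) \<le> 1 / 4))"
  proof
    fix T assume "T \<in> \<T>"
    then have "finite T" "card T = s" using T[of T] unfolding \<T>_def by blast+
    then show "\<exists>C. finite C \<and> real (card C) \<le> 16 ^ (2 * s) \<and>
      (\<forall>x. l2n T x \<le> 1 \<longrightarrow> (\<exists>c\<in>C. l2n T (\<lambda>i. x i - c i) \<le> 1 / 4))"
      using l2n_net[of T "1 / 4"] by auto
  qed
  from bchoice[OF this] obtain N where N: "\<forall>T\<in>\<T>. finite (N T) \<and> real (card (N T)) \<le> 16 ^ (2 * s) \<and>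
      (\<forall>x. l2n T x \<le> 1 \<longrightarrow> (\<exists>c\<in>N T. l2n T (\<lambda>i. x i - c i) \<le> 1 / 4))" ..
  define C where "C = (\<Union>T\<in>\<T>. (\<lambda>c p. if p \<in> T then c p else 0) ` N T)"
  have "card C \<le> (\<Sum>T\<in>\<T>. card ((\<lambda>c p. if p \<in> T then c p else (0::complex)) ` N T))"
    unfolding C_def by (rule card_UN_le[OF fT])
  then have "real (card C) \<le> real (\<Sum>T\<in>\<T>. card ((\<lambda>c p. if p \<in> T then c p else (0::complex)) ` N T))"
    by (rule of_nat_mono)
  also have "\<dots> = (\<Sum>T\<in>\<T>. real (card ((\<lambda>c p. if p \<in> T then c p else (0::complex)) ` N T)))"
    by (rule of_nat_sum)
  also have "\<dots> \<le> (\<Sum>T\<in>\<T>. 16 ^ (2 * s))"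
  proof (rule sum_mono)
    fix T assume "T \<in> \<T>"
    with N have "finite (N T)" "real (card (N T)) \<le> 16 ^ (2 * s)" by auto
    then show "real (card ((\<lambda>c p. if p \<in> T then c p else (0::complex)) ` N T)) \<le> 16 ^ (2 * s)"
      using card_image_le[of "N T" "\<lambda>c p. if p \<in> T then c p else 0"] by linarith
  qed
  also have "\<dots> = real (?m choose s) * 16 ^ (2 * s)" by (simp add: cT)
  also have "\<dots> \<le> exp (real s * (1 + ln (real ?m / real s))) * exp (real s * 8)"
  proof (intro mult_mono binomial_le_exp assms)
    have "(16::real) \<le> exp 4"
    proof -
      have "(2::real) ^ 4 \<le> exp 1 ^ 4" using exp_ge_add_one_self[of 1] by (intro power_mono) auto
      then show ?thesis by (simp add: exp_of_nat_mult[symmetric])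
    qed
    then have "(16::real) ^ (2 * s) \<le> exp 4 ^ (2 * s)" by (intro power_mono) auto
    then show "(16::real) ^ (2 * s) \<le> exp (real s * 8)"
      by (simp add: exp_of_nat_mult[symmetric] mult.commute)
  qed auto
  also have "\<dots> = exp (real s * (9 + ln (real ?m / real s)))"
    by (simp add: exp_add[symmetric] algebra_simps)
  finally have card: "real (card C) \<le> exp (real s * (9 + ln (real ?m / real s)))" .
  show ?thesis
  proof (rule log_mat_covering_number_le[OF _ card])
    show "finite C" unfolding C_def using fT N by (intro finite_UN_I finite_imageI) blast+
    show "sparse_set d n s \<subseteq> carrier_mat (d ^ n) (d ^ n)" using phy_setD by (auto simp: sparse_set_def)
    fix A assume A: "A \<in> sparse_set d n s"
    then have A': "A \<in> carrier_mat (d ^ n) (d ^ n)" "l2n ?I (\<lambda>p. A $$ p) = 1"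
      using phy_setD by (auto simp: sparse_set_def)
    define T where "T = {p \<in> ?I. A $$ p \<noteq> 0}"
    have sub: "T \<subseteq> ?I" by (auto simp: T_def)
    have "{(i, j). i < dim_row A \<and> j < dim_col A \<and> A $$ (i, j) \<noteq> 0} = T"
      using A' by (auto simp: T_def)
    then have "T \<in> \<T>" using A sub by (simp add: \<T>_def sparse_set_def num_nonzero_def)
    have "(l2n T (\<lambda>p. A $$ p))\<^sup>2 \<le> (l2n ?I (\<lambda>p. A $$ p))\<^sup>2"
      unfolding l2n_sq using sub by (intro sum_mono2) auto
    then have "l2n T (\<lambda>p. A $$ p) \<le> l2n ?I (\<lambda>p. A $$ p)" by (rule power2_le_imp_le) simp
    then have "l2n T (\<lambda>p. A $$ p) \<le> 1" using A'(2) by linarith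
    then obtain c where c: "c \<in> N T" "l2n T (\<lambda>p. A $$ p - c p) \<le> 1 / 4"
      using N \<open>T \<in> \<T>\<close> by blast
    let ?c = "\<lambda>p. if p \<in> T then c p else 0"
    have "(l2n ?I (\<lambda>p. A $$ p - ?c p))\<^sup>2 = (l2n T (\<lambda>p. A $$ p - c p))\<^sup>2"
      unfolding l2n_sq by (rule sum.mono_neutral_cong_right) (use sub in \<open>auto simp: T_def\<close>)
    then have "l2n ?I (\<lambda>p. A $$ p - ?c p) = l2n T (\<lambda>p. A $$ p - c p)" by simp
    moreover have "?c \<in> C" using c \<open>T \<in> \<T>\<close> by (auto simp: C_def)
    ultimately show "\<exists>c\<in>C. l2n ?I (\<lambda>p. A $$ p - c p) \<le> 1 / 4" using c(2) by (intro bexI[of _ ?c]) simp_all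
  qed
qed

section \<open>Tensor trains and their physical indices\<close>

lemma net_size_le_exp:
  assumes "2 \<le> n" "0 \<le> x" "x \<le> 16 * (real n)\<^sup>2"
  shows "x ^ (2 * k) \<le> exp (12 * (real k * ln (real n)))"
proof -
  \<comment> \<open>From \<open>n \<ge> 2\<close> the constant 16 is absorbed into n^4, whence 16
    n^2 \<le> n^6 and 12 = 2 * 6. For n = 1 the right-hand side would be 1.\<close>
  have "(2::real) ^ 4 \<le> real n ^ 4" using assms by (intro power_mono) auto
  then have "16 * (real n)\<^sup>2 \<le> real n ^ 4 * (real n)\<^sup>2" by (intro mult_right_mono) auto
  then have "x \<le> real n ^ 6" using assms(3) by (simp add: power_add[symmetric])
  then have "x ^ (2 * k) \<le> (real n ^ 6) ^ (2 * k)" using assms by (intro power_mono) auto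
  also have "\<dots> = exp (ln (real n)) ^ (12 * k)" using assms by (simp add: power_mult[symmetric])
  also have "\<dots> = exp (12 * (real k * ln (real n)))" by (simp add: exp_of_nat_mult[symmetric] mult.assoc)
  finally show ?thesis .
qed

lemma train_cover:
  assumes bij: "bij_betw \<phi> I (configs P n)" and P: "finite P" and r: "r 0 = 1" "r n = 1" and n: "2 \<le> n"
  shows "\<exists>C. finite C \<and>
    real (card C) \<le> exp (12 * (\<Sum>l = 1..n. real (card P * r (l - 1) * r l) * ln (real n))) \<and>
    (\<forall>f X. (\<forall>a\<in>I. f a = train X r (\<phi> a) 0) \<longrightarrow> l2n I f \<le> 1 \<longrightarrow>
       (\<exists>c\<in>C. l2n I (\<lambda>a. f a - c a) \<le> 1 / (4 * real n)))"
proof -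
  \<comment> \<open>Over \<open>n\<close> sites the errors add up to n\<epsilon> = 1/(4n), and
    4/\<epsilon> = 16 n^2 is the largest base that \<open>net_size_le_exp\<close> accepts.\<close>
  define \<epsilon> where "\<epsilon> = 1 / (4 * (real n)\<^sup>2)"
  have n1: "1 \<le> n" using n by simp
  then have "1 \<le> (real n)\<^sup>2" by (intro one_le_power) simp
  then have "0 < 4 * (real n)\<^sup>2" "1 \<le> 4 * (real n)\<^sup>2" by linarith+
  then have e: "0 < \<epsilon>" "\<epsilon> \<le> 1" unfolding \<epsilon>_def by simp_all
  obtain C where C: "finite C"
    "real (card C) \<le> (\<Prod>l = 1..n. (4 / \<epsilon>) ^ (2 * (r (l - 1) * card P * r l)))"
    "\<And>X. l2n (configs P n) (\<lambda>xs. train X r xs 0) \<le> 1 \<Longrightarrow>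
      \<exists>c\<in>C. l2n (configs P n) (\<lambda>xs. train X r xs 0 - c xs) \<le> real n * \<epsilon>"
    using train_net[OF P r n1 e] by blast
  show ?thesis
  proof (intro exI[of _ "(\<lambda>c a. c (\<phi> a)) ` C"] conjI allI impI)
    show "finite ((\<lambda>c a. c (\<phi> a)) ` C)" using C by simp
    have "real (card ((\<lambda>c a. c (\<phi> a)) ` C)) \<le> real (card C)"
      using card_image_le[OF C(1)] of_nat_mono by blast
    also note C(2)
    also have "(\<Prod>l = 1..n. (4 / \<epsilon>) ^ (2 * (r (l - 1) * card P * r l))) \<le>
      (\<Prod>l = 1..n. exp (12 * (real (r (l - 1) * card P * r l) * ln (real n))))"
      using e n by (intro prod_mono conjI net_size_le_exp) (auto simp: \<epsilon>_def)
    also have "\<dots> = exp (\<Sum>l = 1..n. 12 * (real (r (l - 1) * card P * r l) * ln (real n)))"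
      by (rule exp_sum[symmetric]) simp
    also have "\<dots> = exp (12 * (\<Sum>l = 1..n. real (card P * r (l - 1) * r l) * ln (real n)))"
      unfolding sum_distrib_left by (intro arg_cong[of _ _ exp] sum.cong refl) (simp add: mult_ac)
    finally show "real (card ((\<lambda>c a. c (\<phi> a)) ` C)) \<le>
      exp (12 * (\<Sum>l = 1..n. real (card P * r (l - 1) * r l) * ln (real n)))" .
    fix f X assume "\<forall>a\<in>I. f a = train X r (\<phi> a) 0" and norm: "l2n I f \<le> 1"
    then have f: "f a = train X r (\<phi> a) 0" if "a \<in> I" for a using that by blast
    have "l2n I f = l2n I (\<lambda>a. train X r (\<phi> a) 0)" using f by (rule l2n_cong)
    also have "\<dots> = l2n (configs P n) (\<lambda>xs. train X r xs 0)" by (rule l2n_reindex[OF bij])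
    finally obtain c where c: "c \<in> C" "l2n (configs P n) (\<lambda>xs. train X r xs 0 - c xs) \<le> real n * \<epsilon>"
      using C(3)[of X] norm by auto
    have "l2n I (\<lambda>a. f a - c (\<phi> a)) = l2n I (\<lambda>a. train X r (\<phi> a) 0 - c (\<phi> a))"
      using f by (intro l2n_cong) simp
    also have "\<dots> = l2n (configs P n) (\<lambda>xs. train X r xs 0 - c xs)"
      by (rule l2n_reindex[OF bij])
    also have "\<dots> \<le> 1 / (4 * real n)" using c(2) n by (simp add: \<epsilon>_def power2_eq_square)
    finally show "\<exists>c\<in>(\<lambda>c a. c (\<phi> a)) ` C. l2n I (\<lambda>a. f a - c a) \<le> 1 / (4 * real n)"
      by (intro bexI[of _ "\<lambda>a. c (\<phi> a)"] rev_image_eqI[OF c(1)] refl)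
  qed
qed

text \<open>Reversed to match \<open>train\<close>, which expects the last site first.\<close>

definition site_list :: "(nat \<Rightarrow> 'i) \<Rightarrow> nat \<Rightarrow> 'i list" where
  "site_list g n = map g (rev [1..<Suc n])"

lemma site_list_0 [simp]: "site_list g 0 = []"
  by (simp add: site_list_def)

lemma site_list_Suc [simp]: "site_list g (Suc n) = g (Suc n) # site_list g n"
  by (simp add: site_list_def)

lemma length_site_list [simp]: "length (site_list g n) = n"
  by (simp add: site_list_def)

lemma site_list_in_configs: "(\<And>l. l \<in> {1..n} \<Longrightarrow> g l \<in> P) \<Longrightarrow> site_list g n \<in> configs P n"
  by (auto simp: site_list_def configs_def)

lemma site_list_eq_iff: "site_list g n = site_list h n \<longleftrightarrow> (\<forall>l\<in>{1..n}. g l = h l)"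
  by (auto simp: site_list_def)

lemma site_index_div:
  "l \<le> n \<Longrightarrow> site_index d (Suc n) i l = site_index d n (i div d) l"
  by (simp add: site_index_def Suc_diff_le div_mult2_eq)

lemma site_index_less: "1 \<le> d \<Longrightarrow> site_index d n i l < d"
  by (simp add: site_index_def)

text \<open>Uniqueness of base-\<open>d\<close> digits; the induction removes the least significant
  one, which belongs to the last site.\<close>

lemma site_index_eqD:
  assumes "i < d ^ n" "j < d ^ n" "\<forall>l\<in>{1..n}. site_index d n i l = site_index d n j l"
  shows "i = j"
  using assms
proof (induction n arbitrary: i j)
  case 0
  then show ?case by simp
next
  case (Suc n)
  have "i div d < d ^ n" "j div d < d ^ n"
    using Suc.prems by (auto simp: less_mult_imp_div_less mult.commute)
  moreover have "\<forall>l\<in>{1..n}. site_index d n (i div d) l = site_index d n (j div d) l"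
  proof
    fix l assume "l \<in> {1..n}"
    then show "site_index d n (i div d) l = site_index d n (j div d) l"
      using Suc.prems(3)[rule_format, of l] by (simp add: site_index_div)
  qed
  ultimately have "i div d = j div d" by (rule Suc.IH)
  moreover have "i mod d = j mod d"
    using Suc.prems(3)[rule_format, of "Suc n"] by (simp add: site_index_def)
  ultimately show ?case by (metis div_mult_mod_eq)
qed

lemma bij_betw_vec_digits:
  assumes "1 \<le> d"
  shows "bij_betw (\<lambda>i. site_list (site_index d n i) n) {..<d ^ n} (configs {..<d} n)"
proof -
  let ?f = "\<lambda>i. site_list (site_index d n i) n"
  have inj: "inj_on ?f {..<d ^ n}"
    by (intro inj_onI site_index_eqD) (auto simp: site_list_eq_iff)
  have "?f ` {..<d ^ n} \<subseteq> configs {..<d} n"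
    using site_index_less[OF assms] by (intro image_subsetI site_list_in_configs) auto
  \<comment> \<open>Both sets have d^n elements, so injectivity already gives surjectivity.\<close>
  moreover have "card (?f ` {..<d ^ n}) = card (configs {..<d} n)"
    by (simp add: card_image[OF inj] configs_def card_lists_length_eq)
  ultimately have "?f ` {..<d ^ n} = configs {..<d} n"
    by (intro card_subset_eq finite_configs) auto
  with inj show ?thesis by (simp add: bij_betw_def)
qed

lemma bij_betw_mat_digits:
  assumes "1 \<le> d"
  shows "bij_betw (\<lambda>p. site_list (\<lambda>l. (site_index d n (fst p) l, site_index d n (snd p) l)) n)
    ({..<d ^ n} \<times> {..<d ^ n}) (configs ({..<d} \<times> {..<d}) n)"
proof -
  let ?f = "\<lambda>p. site_list (\<lambda>l. (site_index d n (fst p) l, site_index d n (snd p) l)) n"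
  let ?I = "{..<d ^ n} \<times> {..<d ^ n}"
  have inj: "inj_on ?f ?I"
  proof (rule inj_onI)
    fix p q assume *: "p \<in> ?I" "q \<in> ?I" "?f p = ?f q"
    then have "fst p = fst q" "snd p = snd q"
      by (intro site_index_eqD[of _ d n]; auto simp: site_list_eq_iff)+
    then show "p = q" by (rule prod_eqI)
  qed
  have "?f ` ?I \<subseteq> configs ({..<d} \<times> {..<d}) n"
    using site_index_less[OF assms] by (intro image_subsetI site_list_in_configs) auto
  moreover have "card (?f ` ?I) = card (configs ({..<d} \<times> {..<d}) n)"
    by (simp add: card_image[OF inj] configs_def card_lists_length_eq card_cartesian_product power_mult_distrib)
  ultimately have "?f ` ?I = configs ({..<d} \<times> {..<d}) n"
    by (intro card_subset_eq finite_configs) auto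
  with inj show ?thesis by (simp add: bij_betw_def)
qed

lemma chain_prod_train:
  assumes r: "r 0 = 1" and X: "\<And>l. l \<in> {1..n} \<Longrightarrow> M l (g l) \<in> carrier_mat (r (l - 1)) (r l)"
  shows "l \<le> n \<Longrightarrow> chain_prod (\<lambda>l. M l (g l)) l \<in> carrier_mat 1 (r l) \<and>
    (\<forall>\<beta><r l. chain_prod (\<lambda>l. M l (g l)) l $$ (0, \<beta>) =
      train (\<lambda>l \<alpha> i \<beta>. M l i $$ (\<alpha>, \<beta>)) r (site_list g l) \<beta>)"
proof (induction l)
  case 0
  then show ?case using r by simp
next
  case (Suc l)
  let ?A = "chain_prod (\<lambda>l. M l (g l)) l"
  have A: "?A \<in> carrier_mat 1 (r l)" and B: "M (Suc l) (g (Suc l)) \<in> carrier_mat (r l) (r (Suc l))"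
    using Suc X[of "Suc l"] by auto
  have "(?A * M (Suc l) (g (Suc l))) $$ (0, \<beta>) = (\<Sum>\<alpha><r l. ?A $$ (0, \<alpha>) * M (Suc l) (g (Suc l)) $$ (\<alpha>, \<beta>))"
    if "\<beta> < r (Suc l)" for \<beta>
    using A B that by (simp add: scalar_prod_def lessThan_atLeast0)
  then show ?case using Suc A B by auto
qed

lemma log_mps_covering_le:
  assumes d: "1 \<le> d" and n: "2 \<le> n" and r: "bond_dims n r"
  shows "log_enat (vec_covering_number (d ^ n) (1 / (4 * real n)) (mps_set d n r))
    \<le> ereal (12 * (\<Sum>l = 1..n. real (d * r (l - 1) * r l) * ln (real n)))"
proof -
  have r': "r 0 = 1" "r n = 1" using r by (auto simp: bond_dims_def)
  let ?\<phi> = "\<lambda>i. site_list (site_index d n i) n"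
  obtain C where C: "finite C"
    "real (card C) \<le> exp (12 * (\<Sum>l = 1..n. real (card {..<d} * r (l - 1) * r l) * ln (real n)))"
    "\<forall>f X. (\<forall>a\<in>{..<d ^ n}. f a = train X r (?\<phi> a) 0) \<longrightarrow> l2n {..<d ^ n} f \<le> 1 \<longrightarrow>
       (\<exists>c\<in>C. l2n {..<d ^ n} (\<lambda>a. f a - c a) \<le> 1 / (4 * real n))"
    using train_cover[OF bij_betw_vec_digits[OF d] finite_lessThan r' n] by blast
  show ?thesis
  proof (rule log_vec_covering_number_le[OF C(1)])
    show "real (card C) \<le> exp (12 * (\<Sum>l = 1..n. real (d * r (l - 1) * r l) * ln (real n)))"
      using C(2) by simp
    show "mps_set d n r \<subseteq> carrier_vec (d ^ n)" by (auto simp: mps_set_def is_mps_def)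
    fix f assume "f \<in> mps_set d n r"
    then obtain M where f: "f \<in> carrier_vec (d ^ n)" "vec_l2_norm f = 1"
      and M: "\<And>l i. l \<in> {1..n} \<Longrightarrow> i < d \<Longrightarrow> M l i \<in> carrier_mat (r (l - 1)) (r l)"
      and fi: "\<And>i. i < d ^ n \<Longrightarrow> f $ i = chain_prod (\<lambda>l. M l (site_index d n i l)) n $$ (0, 0)"
      unfolding mps_set_def is_mps_def by blast
    show "\<exists>c\<in>C. l2n {..<d ^ n} (\<lambda>i. f $ i - c i) \<le> 1 / (4 * real n)"
    proof (rule C(3)[rule_format])
      show "l2n {..<d ^ n} (($) f) \<le> 1" using f vec_l2_norm_l2n by simp
      show "f $ i = train (\<lambda>l \<alpha> i \<beta>. M l i $$ (\<alpha>, \<beta>)) r (?\<phi> i) 0" if "i \<in> {..<d ^ n}" for i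
        using fi[of i] that chain_prod_train[of r n M "site_index d n i" n] r' M site_index_less[OF d]
        by simp
    qed
  qed
qed

text \<open>Stated for subsets because the low-rank operators are cut out of an MPO set by a rank
  condition, and a cover with centers in the whole space covers every subset.\<close>

lemma log_mpo_covering_le:
  assumes d: "1 \<le> d" and n: "2 \<le> n" and r: "r 0 = 1" "r n = 1"
    and S: "S \<subseteq> mpo_set d n r"
  shows "log_enat (mat_covering_number (d ^ n) (1 / (2 * real n)) S)
    \<le> ereal (12 * (\<Sum>l = 1..n. real (d\<^sup>2 * r (l - 1) * r l) * ln (real n)))"
proof -
  let ?\<phi> = "\<lambda>p. site_list (\<lambda>l. (site_index d n (fst p) l, site_index d n (snd p) l)) n"
  let ?I = "{..<d ^ n} \<times> {..<d ^ n}"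
  obtain C where C: "finite C"
    "real (card C) \<le> exp (12 * (\<Sum>l = 1..n. real (card ({..<d} \<times> {..<d}) * r (l - 1) * r l) * ln (real n)))"
    "\<forall>f X. (\<forall>a\<in>?I. f a = train X r (?\<phi> a) 0) \<longrightarrow> l2n ?I f \<le> 1 \<longrightarrow>
       (\<exists>c\<in>C. l2n ?I (\<lambda>a. f a - c a) \<le> 1 / (4 * real n))"
    using train_cover[OF bij_betw_mat_digits[OF d] finite_cartesian_product[OF finite_lessThan finite_lessThan] r n] by blast
  show ?thesis
  proof (rule log_mat_covering_number_le[OF C(1)])
    show "real (card C) \<le> exp (12 * (\<Sum>l = 1..n. real (d\<^sup>2 * r (l - 1) * r l) * ln (real n)))"
      using C(2) by (simp add: card_cartesian_product power2_eq_square)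
    show "S \<subseteq> carrier_mat (d ^ n) (d ^ n)" using S phy_setD(1) by (auto simp: mpo_set_def)
    fix A assume "A \<in> S"
    then have A: "A \<in> phy_set d n" and "is_mpo d n r A" using S by (auto simp: mpo_set_def)
    then obtain M where
      M: "\<And>l i j. l \<in> {1..n} \<Longrightarrow> i < d \<Longrightarrow> j < d \<Longrightarrow> M l i j \<in> carrier_mat (r (l - 1)) (r l)"
      and Aij: "\<And>i j. i < d ^ n \<Longrightarrow> j < d ^ n \<Longrightarrow>
        A $$ (i, j) = chain_prod (\<lambda>l. M l (site_index d n i l) (site_index d n j l)) n $$ (0, 0)"
      unfolding is_mpo_def by blast
    have "\<exists>c\<in>C. l2n ?I (\<lambda>p. A $$ p - c p) \<le> 1 / (4 * real n)"
    proof (rule C(3)[rule_format])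
      show "l2n ?I (($$) A) \<le> 1" using phy_setD(2)[OF A] by simp
      show "A $$ p = train (\<lambda>l \<alpha> i \<beta>. M l (fst i) (snd i) $$ (\<alpha>, \<beta>)) r (?\<phi> p) 0" if "p \<in> ?I" for p
        using Aij[of "fst p" "snd p"] that r M site_index_less[OF d]
          chain_prod_train[of r n "\<lambda>l i. M l (fst i) (snd i)" "\<lambda>l. (site_index d n (fst p) l, site_index d n (snd p) l)" n]
        by auto
    qed
    moreover have "1 / (4 * real n) \<le> 1 / (2 * real n)" using n by (simp add: field_simps)
    ultimately show "\<exists>c\<in>C. l2n ?I (\<lambda>p. A $$ p - c p) \<le> 1 / (2 * real n)" by (meson order_trans)
  qed
qed

section \<open>Matrices of given rank\<close>

lemma rank_factorisation:
  fixes A :: "complex mat"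
  assumes A: "A \<in> carrier_mat N M"
  obtains B E where "\<And>i j. i < N \<Longrightarrow> j < M \<Longrightarrow> A $$ (i, j) = (\<Sum>\<alpha><mat_rank A. B i \<alpha> * E \<alpha> j)"
proof -
  interpret vec_space "TYPE(complex)" N .
  let ?S = "set (cols A)" and ?r = "mat_rank A"
  have S: "?S \<subseteq> carrier_vec N" using cols_dim[of A] A by auto
  \<comment> \<open>A maximal independent set of columns serves as the left factor; its size is the
    rank, and the coordinates of the columns form the right factor.\<close>
  have "\<exists>U. finite U \<and> maximal U (\<lambda>T. T \<subseteq> ?S \<and> lin_indpt T) \<and> {} \<subseteq> U"
    by (rule maximal_exists_superset[where S = ?S]) (auto simp: finite_lin_indpt2)
  then obtain U where U: "finite U" "maximal U (\<lambda>T. T \<subseteq> ?S \<and> lin_indpt T)" by blast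
  have Us: "U \<subseteq> ?S" "lin_indpt U" using U(2) unfolding maximal_def by blast+
  have Uc: "U \<subseteq> carrier_vec N" using Us S by blast
  have "card U = ?r" using rank_card_indpt[OF A U(2)] A by (simp add: mat_rank_def)
  then obtain h where h: "bij_betw h {..<?r} U"
    using ex_bij_betw_nat_finite[OF U(1)] by (metis lessThan_atLeast0)
  have "\<exists>a. \<forall>i<N. A $$ (i, j) = (\<Sum>\<alpha><?r. h \<alpha> $ i * a \<alpha>)" if j: "j < M" for j
  proof -
    have c: "col A j \<in> ?S" using j A by (simp add: cols_def)
    have "col A j \<in> span U"
    proof (rule ccontr)
      assume n: "col A j \<notin> span U"
      have nU: "col A j \<notin> U" using n Uc span_mem by blast
      have "lin_indpt (insert (col A j) U)"
        using lin_dep_iff_in_span[OF _ Us(2) _ nU] Uc S c n by auto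
      then have "insert (col A j) U = U"
        using U(2) Us(1) c unfolding maximal_def by blast
      then show False using nU by blast
    qed
    then obtain a where "lincomb a U = col A j" using finite_in_span[OF U(1) Uc] by blast
    then have a: "col A j = lincomb a U" by (rule sym)
    have "A $$ (i, j) = (\<Sum>\<alpha><?r. h \<alpha> $ i * a (h \<alpha>))" if i: "i < N" for i
    proof -
      have "A $$ (i, j) = col A j $ i" using i j A by simp
      also have "\<dots> = (\<Sum>u\<in>U. a u * u $ i)" unfolding a by (rule lincomb_index[OF i Uc])
      also have "\<dots> = (\<Sum>\<alpha><?r. a (h \<alpha>) * h \<alpha> $ i)" by (rule sum.reindex_bij_betw[OF h, symmetric])
      finally show ?thesis by (simp add: mult.commute)
    qed
    then show ?thesis by (intro exI[of _ "\<lambda>\<alpha>. a (h \<alpha>)"]) blast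
  qed
  then have "\<forall>j. \<exists>a. j < M \<longrightarrow> (\<forall>i<N. A $$ (i, j) = (\<Sum>\<alpha><?r. h \<alpha> $ i * a \<alpha>))" by blast
  from choice[OF this] obtain a where "\<forall>j. j < M \<longrightarrow> (\<forall>i<N. A $$ (i, j) = (\<Sum>\<alpha><?r. h \<alpha> $ i * a j \<alpha>))" ..
  then show ?thesis by (intro that[of "\<lambda>i \<alpha>. h \<alpha> $ i" "\<lambda>\<alpha> j. a j \<alpha>"]) blast
qed

text \<open>A matrix of rank \<open>r\<close> is a tensor train with two sites, the row and the column index.\<close>

lemma log_lr_covering_le:
  "log_enat (mat_covering_number (d ^ n) (1 / 4) (lr_set d n r)) \<le> ereal (24 * real (d ^ n * r))"
proof -
  let ?N = "d ^ n"
  let ?I = "{..<?N} \<times> {..<?N}"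
  \<comment> \<open>Bond dimensions 1, r, 1 on a chain of two sites of physical dimension d^n. The
    column index comes first in the list because it belongs to the last site.\<close>
  define b where "b l = (if l = Suc 0 then r else 1)" for l
  let ?\<phi> = "\<lambda>p. [snd p, fst p]"
  have "bij_betw ?\<phi> ?I (configs {..<?N} 2)"
    unfolding numeral_2_eq_2
    by (auto simp: bij_betw_def inj_on_def image_iff elim!: configs_SucE)
  moreover have "b 0 = 1" "b 2 = 1" by (simp_all add: b_def)
  ultimately obtain C where C: "finite C"
    "real (card C) \<le> exp (12 * (\<Sum>l = 1..2. real (card {..<?N} * b (l - 1) * b l) * ln (real 2)))"
    "\<forall>f X. (\<forall>a\<in>?I. f a = train X b (?\<phi> a) 0) \<longrightarrow> l2n ?I f \<le> 1 \<longrightarrow>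
       (\<exists>c\<in>C. l2n ?I (\<lambda>a. f a - c a) \<le> 1 / (4 * real 2))"
    using train_cover[OF _ finite_lessThan _ _ order_refl, of ?\<phi> ?I ?N b] by blast
  show ?thesis
  proof (rule log_mat_covering_number_le[OF C(1)])
    \<comment> \<open>Each of the two sites contributes d^n r, and ln 2 \<le> 1; this is how 12
      becomes 24.\<close>
    have "(\<Sum>l = 1..2. real (card {..<?N} * b (l - 1) * b l) * ln (real 2)) = 2 * real (?N * r) * ln 2"
      by (simp add: b_def numeral_2_eq_2)
    also have "\<dots> \<le> 2 * real (?N * r) * 1"
      using ln_le_minus_one[of "2::real"] by (intro mult_left_mono) auto
    finally have "(\<Sum>l = 1..2. real (card {..<?N} * b (l - 1) * b l) * ln (real 2)) \<le> 2 * real (?N * r) * 1" .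
    then have "exp (12 * (\<Sum>l = 1..2. real (card {..<?N} * b (l - 1) * b l) * ln (real 2))) \<le> exp (24 * real (?N * r))"
      by (subst exp_le_cancel_iff) linarith
    with C(2) show "real (card C) \<le> exp (24 * real (?N * r))" by linarith
    show "lr_set d n r \<subseteq> carrier_mat ?N ?N" using phy_setD(1) by (auto simp: lr_set_def)
    fix A assume "A \<in> lr_set d n r"
    then have A: "A \<in> phy_set d n" "mat_rank A = r" by (auto simp: lr_set_def)
    obtain B E where BE: "\<And>i j. i < ?N \<Longrightarrow> j < ?N \<Longrightarrow> A $$ (i, j) = (\<Sum>\<alpha><r. B i \<alpha> * E \<alpha> j)"
      using rank_factorisation[OF phy_setD(1)[OF A(1)]] A(2) by metis
    define X where "X l \<alpha> i \<beta> = (if l = Suc 0 then B i \<beta> else E \<alpha> i)" for l \<alpha> i \<beta> :: nat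
    have "\<exists>c\<in>C. l2n ?I (\<lambda>p. A $$ p - c p) \<le> 1 / (4 * real 2)"
    proof (rule C(3)[rule_format])
      show "l2n ?I (($$) A) \<le> 1" using phy_setD(2)[OF A(1)] by simp
      show "A $$ p = train X b (?\<phi> p) 0" if "p \<in> ?I" for p
        using BE[of "fst p" "snd p"] that by (auto simp: X_def b_def)
    qed
    moreover have "1 / (4 * real 2) \<le> 1 / 4" by simp
    ultimately show "\<exists>c\<in>C. l2n ?I (\<lambda>p. A $$ p - c p) \<le> 1 / 4" by (meson order_trans)
  qed
qed

section \<open>Lattice contractions\<close>

lemma sum_PiE_insert:
  assumes "e \<notin> E"
  shows "(\<Sum>\<beta>\<in>PiE (insert e E) B. f \<beta>) = (\<Sum>\<beta>\<in>PiE E B. \<Sum>x\<in>B e. f (\<beta>(e := x)))"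
proof -
  have "(\<Sum>\<beta>\<in>PiE (insert e E) B. f \<beta>) = (\<Sum>(x, \<beta>)\<in>B e \<times> PiE E B. f (\<beta>(e := x)))"
    unfolding PiE_insert_eq by (subst sum.reindex[OF inj_combinator[OF assms]]) (simp add: case_prod_unfold)
  also have "\<dots> = (\<Sum>x\<in>B e. \<Sum>\<beta>\<in>PiE E B. f (\<beta>(e := x)))"
    by (rule sum.cartesian_product[symmetric])
  also have "\<dots> = (\<Sum>\<beta>\<in>PiE E B. \<Sum>x\<in>B e. f (\<beta>(e := x)))" by (rule sum.swap)
  finally show ?thesis .
qed

text \<open>Iterated Cauchy--Schwarz, one edge at a time.  Edges of dimension \<open>1\<close> may be attached to any
  number of sites; every other edge joins exactly two.\<close>

lemma sum_prod_le_prod_l2: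
  fixes g :: "'s \<Rightarrow> ('e \<Rightarrow> nat) \<Rightarrow> real"
  assumes "finite E" and S: "finite S"
    and "\<And>s \<beta>. s \<in> S \<Longrightarrow> 0 \<le> g s \<beta>"
    and "\<And>s \<beta> \<beta>'. s \<in> S \<Longrightarrow> (\<And>e. e \<in> A s \<Longrightarrow> \<beta> e = \<beta>' e) \<Longrightarrow> g s \<beta> = g s \<beta>'"
    and "\<And>e. e \<in> E \<Longrightarrow> D e = Suc 0 \<or> card {s \<in> S. e \<in> A s} = 2"
  shows "(\<Sum>\<beta>\<in>PiE E (\<lambda>e. {..<D e}). \<Prod>s\<in>S. g s \<beta>) \<le>
    (\<Prod>s\<in>S. sqrt (\<Sum>\<beta>\<in>PiE (A s \<inter> E) (\<lambda>e. {..<D e}). (g s \<beta>)\<^sup>2))"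
  using assms(1,3-)
proof (induction E arbitrary: g rule: finite_induct)
  case empty
  have "sqrt (\<Sum>\<beta>\<in>PiE (A s \<inter> {}) (\<lambda>e. {..<D e}). (g s \<beta>)\<^sup>2) = g s (\<lambda>_. undefined)" if "s \<in> S" for s
    using empty(1)[OF that] by simp
  then show ?case by simp
next
  case (insert e E)
  let ?B = "\<lambda>e. {..<D e}"
  define T where "T = {s \<in> S. e \<in> A s}"
  have T: "finite T" "T \<subseteq> S" using S by (auto simp: T_def)
  \<comment> \<open>The edge \<open>e\<close> is summed out in the l2 sense at each site it touches,
    so that no \<open>g' s\<close> depends on it any more.\<close>
  define g' where "g' s \<beta> = (if e \<in> A s then sqrt (\<Sum>x<D e. (g s (\<beta>(e := x)))\<^sup>2) else g s \<beta>)" for s \<beta>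
  have dep: "g s \<beta> = g s \<beta>'" if "s \<in> S" "\<And>e. e \<in> A s \<Longrightarrow> \<beta> e = \<beta>' e" for s \<beta> \<beta>'
    using insert.prems(2) that by blast
  have inner: "(\<Sum>x<D e. \<Prod>s\<in>S. g s (\<beta>(e := x))) \<le> (\<Prod>s\<in>S. g' s \<beta>)" for \<beta>
  proof -
    have split: "(\<Prod>s\<in>S. h s) = (\<Prod>s\<in>T. h s) * (\<Prod>s\<in>S - T. h s)" for h :: "'s \<Rightarrow> real"
      using prod.subset_diff[OF T(2) S, of h] by (simp add: mult.commute)
    have rest: "(\<Prod>s\<in>S - T. g s (\<beta>(e := x))) = (\<Prod>s\<in>S - T. g s \<beta>)" for x
      by (intro prod.cong refl dep) (auto simp: T_def)
    have rest': "(\<Prod>s\<in>S - T. g' s \<beta>) = (\<Prod>s\<in>S - T. g s \<beta>)"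
      by (intro prod.cong) (auto simp: T_def g'_def)
    have T': "(\<Prod>s\<in>T. g' s \<beta>) = (\<Prod>s\<in>T. sqrt (\<Sum>x<D e. (g s (\<beta>(e := x)))\<^sup>2))"
      by (intro prod.cong) (auto simp: T_def g'_def)
    have "(\<Sum>x<D e. \<Prod>s\<in>T. g s (\<beta>(e := x))) \<le> (\<Prod>s\<in>T. sqrt (\<Sum>x<D e. (g s (\<beta>(e := x)))\<^sup>2))"
      using insert.prems(3)[OF insertI1]
    proof (elim disjE)
      \<comment> \<open>With the single value x = 0 both sides are the same product, however many
        sites are attached.\<close>
      assume "D e = Suc 0"
      then show ?thesis using T(2) insert.prems(1) by (simp add: subset_eq)
    next
      assume "card {s \<in> S. e \<in> A s} = 2"
      then obtain s t where st: "T = {s, t}" "s \<noteq> t" unfolding T_def[symmetric] card_2_iff by blast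
      then have nn: "0 \<le> g s \<beta>" "0 \<le> g t \<beta>" for \<beta> using T(2) insert.prems(1) by auto
      have "(\<Sum>x<D e. \<bar>g s (\<beta>(e := x))\<bar> * \<bar>g t (\<beta>(e := x))\<bar>) \<le>
          L2_set (\<lambda>x. g s (\<beta>(e := x))) {..<D e} * L2_set (\<lambda>x. g t (\<beta>(e := x))) {..<D e}"
        by (rule L2_set_mult_ineq)
      then show ?thesis using st nn by (simp add: L2_set_def)
    qed
    moreover have "0 \<le> (\<Prod>s\<in>S - T. g s \<beta>)" using insert.prems(1) by (intro prod_nonneg) auto
    ultimately have "(\<Sum>x<D e. \<Prod>s\<in>T. g s (\<beta>(e := x))) * (\<Prod>s\<in>S - T. g s \<beta>) \<le>
        (\<Prod>s\<in>T. g' s \<beta>) * (\<Prod>s\<in>S - T. g' s \<beta>)"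
      unfolding T' rest' by (rule mult_right_mono)
    then show ?thesis unfolding split rest by (simp add: sum_distrib_right)
  qed
  have "(\<Sum>\<beta>\<in>PiE (insert e E) ?B. \<Prod>s\<in>S. g s \<beta>) = (\<Sum>\<beta>\<in>PiE E ?B. \<Sum>x<D e. \<Prod>s\<in>S. g s (\<beta>(e := x)))"
    by (rule sum_PiE_insert) fact
  also have "\<dots> \<le> (\<Sum>\<beta>\<in>PiE E ?B. \<Prod>s\<in>S. g' s \<beta>)" by (rule sum_mono) (rule inner)
  also have "\<dots> \<le> (\<Prod>s\<in>S. sqrt (\<Sum>\<beta>\<in>PiE (A s \<inter> E) ?B. (g' s \<beta>)\<^sup>2))"
  proof (rule insert.IH)
    show "0 \<le> g' s \<beta>" if "s \<in> S" for s \<beta>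
      using insert.prems(1)[OF that] by (simp add: g'_def sum_nonneg)
    show "g' s \<beta> = g' s \<beta>'" if "s \<in> S" "\<And>e. e \<in> A s \<Longrightarrow> \<beta> e = \<beta>' e" for s \<beta> \<beta>'
    proof -
      have "g s (\<beta>(e := x)) = g s (\<beta>'(e := x))" for x
        by (rule dep[OF that(1)]) (simp add: that(2))
      moreover have "g s \<beta> = g s \<beta>'" by (rule dep[OF that])
      ultimately show ?thesis by (simp add: g'_def)
    qed
    show "D e = Suc 0 \<or> card {s \<in> S. e \<in> A s} = 2" if "e \<in> E" for e
      using insert.prems(3) that by blast
  qed
  also have "\<dots> = (\<Prod>s\<in>S. sqrt (\<Sum>\<beta>\<in>PiE (A s \<inter> insert e E) ?B. (g s \<beta>)\<^sup>2))"
  proof (intro prod.cong refl arg_cong[of _ _ sqrt])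
    fix s assume "s \<in> S"
    show "(\<Sum>\<beta>\<in>PiE (A s \<inter> E) ?B. (g' s \<beta>)\<^sup>2) = (\<Sum>\<beta>\<in>PiE (A s \<inter> insert e E) ?B. (g s \<beta>)\<^sup>2)"
    proof (cases "e \<in> A s")
      case True
      then have "A s \<inter> insert e E = insert e (A s \<inter> E)" by auto
      then show ?thesis using True insert.hyps
        by (simp add: sum_PiE_insert g'_def sum_nonneg)
    next
      case False
      then have "A s \<inter> insert e E = A s \<inter> E" by auto
      then show ?thesis using False by (simp add: g'_def)
    qed
  qed
  finally show ?case .
qed

section \<open>Norm of a contraction\<close>

definition site_edges :: "nat \<times> nat \<Rightarrow> lattice_edge set" where
  "site_edges s = (case s of (a, b) \<Rightarrow> {down_edge a b, right_edge a b, up_edge a b, left_edge a b})"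

lemma site_edges_subset:
  "s \<in> {1..q} \<times> {1..p} \<Longrightarrow> site_edges s \<subseteq> lattice_edges q p"
  by (auto simp: site_edges_def lattice_edges_def)

lemma card_sites_of_inner_edge:
  assumes "e \<in> inner_edges q p"
  shows "card {s \<in> {1..q} \<times> {1..p}. e \<in> site_edges s} = 2"
proof -
  consider a b where "e = Hor a b" "a \<in> {1..q}" "1 \<le> b" "b < p"
    | a b where "e = Ver a b" "b \<in> {1..p}" "1 \<le> a" "a < q"
    using assms by (auto simp: inner_edges_def)
  then show ?thesis
  proof cases
    case 1
    then have "{s \<in> {1..q} \<times> {1..p}. e \<in> site_edges s} = {(a, b), (a, Suc b)}"
      by (auto simp: site_edges_def)
    then show ?thesis by simp
  next
    case 2
    then have "{s \<in> {1..q} \<times> {1..p}. e \<in> site_edges s} = {(a, b), (Suc a, b)}"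
      by (auto simp: site_edges_def)
    then show ?thesis by simp
  qed
qed

lemma finite_lattice_edges: "finite (lattice_edges q p)"
proof -
  have "lattice_edges q p = (\<lambda>(a, b). Hor a b) ` ({1..q} \<times> {0..p}) \<union> (\<lambda>(a, b). Ver a b) ` ({0..q} \<times> {1..p})"
    by (auto simp: lattice_edges_def)
  then show ?thesis by simp
qed

text \<open>The order down, right, up, left in \<open>site_edges\<close> makes the iterated sums of
  \<open>sum_PiE_insert\<close> come out with the left edge outermost, as in
  \<open>local_norm\<close>. Positivity of \<open>a\<close> and \<open>b\<close> keeps the four
  edges distinct, since \<open>0 - 1 = 0\<close> for natural numbers.\<close>

lemma sum_site_edges:
  fixes f :: "nat \<Rightarrow> nat \<Rightarrow> nat \<Rightarrow> nat \<Rightarrow> real"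
  assumes "1 \<le> a" "1 \<le> b"
  shows "(\<Sum>\<beta>\<in>PiE (site_edges (a, b)) (\<lambda>e. {..<D e}).
      f (\<beta> (left_edge a b)) (\<beta> (up_edge a b)) (\<beta> (right_edge a b)) (\<beta> (down_edge a b))) =
    (\<Sum>x<D (left_edge a b). \<Sum>y<D (up_edge a b). \<Sum>z<D (right_edge a b). \<Sum>w<D (down_edge a b). f x y z w)"
proof -
  have "b - Suc 0 \<noteq> b" "a - Suc 0 \<noteq> a" using assms by auto
  then show ?thesis unfolding site_edges_def by (simp add: sum_PiE_insert)
qed

text \<open>Iterated Cauchy-Schwarz with the physical indices held fixed: an inner edge touches
  exactly two sites, and every edge leaving the lattice has dimension 1.\<close>

lemma cmod_contraction_le:
  assumes D: "lattice_bond_dims q p D"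
  shows "cmod (contraction q p D X i) \<le> (\<Prod>(a, b)\<in>{1..q} \<times> {1..p}.
    sqrt (\<Sum>x<D (left_edge a b). \<Sum>y<D (up_edge a b). \<Sum>z<D (right_edge a b). \<Sum>w<D (down_edge a b).
      (cmod (X a b (i a b) x y z w))\<^sup>2))"
proof -
  let ?E = "lattice_edges q p" and ?S = "{1..q} \<times> {1..p}"
  let ?g = "\<lambda>s \<beta>. case s of (a, b) \<Rightarrow> cmod (X a b (i a b)
    (\<beta> (left_edge a b)) (\<beta> (up_edge a b)) (\<beta> (right_edge a b)) (\<beta> (down_edge a b)))"
  have "cmod (contraction q p D X i) \<le> (\<Sum>\<beta>\<in>PiE ?E (\<lambda>e. {..<D e}). \<Prod>s\<in>?S. ?g s \<beta>)"
    unfolding contraction_def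
    by (rule order.trans[OF norm_sum]) (simp add: prod_norm prod.cartesian_product case_prod_unfold)
  also have "\<dots> \<le> (\<Prod>s\<in>?S. sqrt (\<Sum>\<beta>\<in>PiE (site_edges s \<inter> ?E) (\<lambda>e. {..<D e}). (?g s \<beta>)\<^sup>2))"
  proof (rule sum_prod_le_prod_l2)
    show "?g s \<beta> = ?g s \<beta>'" if "s \<in> ?S" "\<And>e. e \<in> site_edges s \<Longrightarrow> \<beta> e = \<beta>' e" for s \<beta> \<beta>'
      using that(2) by (auto simp: site_edges_def split: prod.splits)
    show "D e = Suc 0 \<or> card {s \<in> ?S. e \<in> site_edges s} = 2" if "e \<in> ?E" for e
      using that D card_sites_of_inner_edge[of e q p] unfolding lattice_bond_dims_def by auto
  qed (auto simp: finite_lattice_edges)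
  also have "\<dots> = (\<Prod>(a, b)\<in>?S.
    sqrt (\<Sum>x<D (left_edge a b). \<Sum>y<D (up_edge a b). \<Sum>z<D (right_edge a b). \<Sum>w<D (down_edge a b).
      (cmod (X a b (i a b) x y z w))\<^sup>2))"
  proof (rule prod.cong[OF refl])
    fix s assume s: "s \<in> ?S"
    obtain a b where ab: "s = (a, b)" by (cases s)
    have "site_edges s \<inter> ?E = site_edges s" using site_edges_subset[OF s] by blast
    then show "sqrt (\<Sum>\<beta>\<in>PiE (site_edges s \<inter> ?E) (\<lambda>e. {..<D e}). (?g s \<beta>)\<^sup>2) = (case s of (a, b) \<Rightarrow>
      sqrt (\<Sum>x<D (left_edge a b). \<Sum>y<D (up_edge a b). \<Sum>z<D (right_edge a b). \<Sum>w<D (down_edge a b).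
        (cmod (X a b (i a b) x y z w))\<^sup>2))"
      using s ab sum_site_edges[where a = a and b = b and D = D and f = "\<lambda>x y z w. (cmod (X a b (i a b) x y z w))\<^sup>2"] by simp
  qed
  finally show ?thesis .
qed

text \<open>Squared, the bound for fixed physical indices is a product with one factor per site. By
  injectivity the sum over \<open>J\<close> is at most the sum over all assignments of indices to
  sites, and that sum factorises into squared local norms.\<close>

lemma l2n_contraction_le:
  assumes D: "lattice_bond_dims q p D" and I: "finite I"
    and \<phi>: "\<And>j a b. j \<in> J \<Longrightarrow> a \<in> {1..q} \<Longrightarrow> b \<in> {1..p} \<Longrightarrow> \<phi> j a b \<in> I"
    and inj: "\<And>j j'. j \<in> J \<Longrightarrow> j' \<in> J \<Longrightarrow> \<forall>a\<in>{1..q}. \<forall>b\<in>{1..p}. \<phi> j a b = \<phi> j' a b \<Longrightarrow> j = j'"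
  shows "l2n J (\<lambda>j. contraction q p D X (\<phi> j)) \<le> (\<Prod>(a, b)\<in>{1..q} \<times> {1..p}. local_norm I D a b (X a b))"
proof -
  let ?S = "{1..q} \<times> {1..p}"
  define h where "h s i = (case s of (a, b) \<Rightarrow> \<Sum>x<D (left_edge a b). \<Sum>y<D (up_edge a b).
     \<Sum>z<D (right_edge a b). \<Sum>w<D (down_edge a b). (cmod (X a b i x y z w))\<^sup>2)" for s i
  have h0: "0 \<le> h s i" for s i by (auto simp: h_def intro!: sum_nonneg split: prod.split)
  have ln: "local_norm I D a b (X a b) = sqrt (\<Sum>i\<in>I. h (a, b) i)" for a b
    by (simp add: local_norm_def h_def)
  define \<psi> where "\<psi> j = (\<lambda>s\<in>?S. \<phi> j (fst s) (snd s))" for j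
  have inj\<psi>: "inj_on \<psi> J"
  proof (rule inj_onI)
    fix j j' assume j: "j \<in> J" "j' \<in> J" "\<psi> j = \<psi> j'"
    have "\<phi> j a b = \<phi> j' a b" if "a \<in> {1..q}" "b \<in> {1..p}" for a b
      using fun_cong[OF j(3), of "(a, b)"] that by (simp add: \<psi>_def)
    then show "j = j'" using inj j by blast
  qed
  have "(cmod (contraction q p D X (\<phi> j)))\<^sup>2 \<le> (\<Prod>s\<in>?S. h s (\<psi> j s))" for j
  proof -
    have "cmod (contraction q p D X (\<phi> j)) \<le> (\<Prod>s\<in>?S. sqrt (h s (\<psi> j s)))"
      by (rule order.trans[OF cmod_contraction_le[OF D]])
        (rule eq_refl, intro prod.cong refl, auto simp: h_def \<psi>_def)
    then have "(cmod (contraction q p D X (\<phi> j)))\<^sup>2 \<le> (\<Prod>s\<in>?S. sqrt (h s (\<psi> j s)))\<^sup>2"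
      by (intro power_mono) auto
    also have "\<dots> = (\<Prod>s\<in>?S. h s (\<psi> j s))" using h0 by (simp add: prod_power_distrib)
    finally show ?thesis .
  qed
  then have "(\<Sum>j\<in>J. (cmod (contraction q p D X (\<phi> j)))\<^sup>2) \<le> (\<Sum>j\<in>J. \<Prod>s\<in>?S. h s (\<psi> j s))"
    by (intro sum_mono) auto
  also have "\<dots> = (\<Sum>\<sigma>\<in>\<psi> ` J. \<Prod>s\<in>?S. h s (\<sigma> s))" by (simp add: sum.reindex[OF inj\<psi>])
  also have "\<dots> \<le> (\<Sum>\<sigma>\<in>PiE ?S (\<lambda>_. I). \<Prod>s\<in>?S. h s (\<sigma> s))"
  proof (rule sum_mono2)
    show "finite (PiE ?S (\<lambda>_. I))" using I by (intro finite_PiE) auto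
    show "\<psi> ` J \<subseteq> PiE ?S (\<lambda>_. I)" using \<phi> unfolding \<psi>_def by (intro image_subsetI) (auto simp: restrict_PiE_iff)
  qed (use h0 in \<open>auto intro: prod_nonneg\<close>)
  also have "\<dots> = (\<Prod>s\<in>?S. \<Sum>i\<in>I. h s i)" using I by (intro prod_sum_PiE[symmetric]) auto
  also have "\<dots> = (\<Prod>(a, b)\<in>?S. local_norm I D a b (X a b))\<^sup>2"
    unfolding prod_power_distrib using h0
    by (intro prod.cong refl) (auto simp: ln sum_nonneg)
  finally show ?thesis
    by (subst l2n_le_iff) (auto intro!: prod_nonneg simp: local_norm_def sum_nonneg)
qed

text \<open>Multilinearity of the contraction, used in the tensor at the site
  \<open>s\<close>.\<close>

lemma contraction_diff_single:
  assumes s: "s \<in> {1..q} \<times> {1..p}"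
    and eq: "\<And>a b. (a, b) \<in> {1..q} \<times> {1..p} \<Longrightarrow> (a, b) \<noteq> s \<Longrightarrow> X a b = Z a b \<and> Y a b = Z a b"
    and at: "\<And>i x y z w. Z (fst s) (snd s) i x y z w = X (fst s) (snd s) i x y z w - Y (fst s) (snd s) i x y z w"
  shows "contraction q p D X i - contraction q p D Y i = contraction q p D Z i"
proof -
  let ?S = "{1..q} \<times> {1..p}"
  define f where "f X \<beta> s = X (fst s) (snd s) (i (fst s) (snd s)) (\<beta> (left_edge (fst s) (snd s))) (\<beta> (up_edge (fst s) (snd s)))
    (\<beta> (right_edge (fst s) (snd s))) (\<beta> (down_edge (fst s) (snd s)))"
    for X :: "nat \<Rightarrow> nat \<Rightarrow> 'a local_tensor" and \<beta> s
  have c: "contraction q p D X i = (\<Sum>\<beta>\<in>PiE (lattice_edges q p) (\<lambda>e. {..<D e}). f X \<beta> s * (\<Prod>t\<in>?S - {s}. f X \<beta> t))" for X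
  proof -
    have "contraction q p D X i = (\<Sum>\<beta>\<in>PiE (lattice_edges q p) (\<lambda>e. {..<D e}). \<Prod>t\<in>?S. f X \<beta> t)"
      by (simp add: contraction_def f_def prod.cartesian_product case_prod_unfold)
    moreover have "(\<Prod>t\<in>?S. f X \<beta> t) = f X \<beta> s * (\<Prod>t\<in>?S - {s}. f X \<beta> t)" for \<beta>
      using s by (intro prod.remove) auto
    ultimately show ?thesis by (simp only:)
  qed
  have "(\<Prod>t\<in>?S - {s}. f X \<beta> t) = (\<Prod>t\<in>?S - {s}. f Z \<beta> t)" for \<beta>
    using eq by (intro prod.cong refl) (auto simp: f_def)
  moreover have "(\<Prod>t\<in>?S - {s}. f Y \<beta> t) = (\<Prod>t\<in>?S - {s}. f Z \<beta> t)" for \<beta>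
    using eq by (intro prod.cong refl) (auto simp: f_def)
  moreover have "f Z \<beta> s = f X \<beta> s - f Y \<beta> s" for \<beta> by (simp add: f_def at)
  ultimately show ?thesis by (simp add: c left_diff_distrib sum_subtractf)
qed

text \<open>Each replacement contracts the error at one site with tensors bounded by \<Lambda> at
  the others, and so costs \<epsilon> times the product of all bounds.\<close>

lemma l2n_contraction_diff_le:
  assumes D: "lattice_bond_dims q p D" and I: "finite I"
    and \<phi>: "\<And>j a b. j \<in> J \<Longrightarrow> a \<in> {1..q} \<Longrightarrow> b \<in> {1..p} \<Longrightarrow> \<phi> j a b \<in> I"
    and inj: "\<And>j j'. j \<in> J \<Longrightarrow> j' \<in> J \<Longrightarrow> \<forall>a\<in>{1..q}. \<forall>b\<in>{1..p}. \<phi> j a b = \<phi> j' a b \<Longrightarrow> j = j'"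
    and X: "X \<in> bounded_tensors I q p D \<Lambda>" and Y: "Y \<in> bounded_tensors I q p D \<Lambda>"
    and XY: "X \<in> sitewise_ball I q p D \<Lambda> \<epsilon> Y" and e: "0 \<le> \<epsilon>"
  shows "l2n J (\<lambda>j. contraction q p D X (\<phi> j) - contraction q p D Y (\<phi> j)) \<le> lattice_resolution q p \<Lambda> \<epsilon>"
proof -
  let ?S = "{1..q} \<times> {1..p}"
  let ?c = "\<lambda>X j. contraction q p D X (\<phi> j)"
  define L where "L = (\<Prod>(a, b)\<in>?S. \<Lambda> a b)"
  have ln0: "0 \<le> local_norm I D a b T" for a b T by (simp add: local_norm_def sum_nonneg)
  \<comment> \<open>A hybrid of the two families: the sites in \<open>T\<close> already carry
    \<open>Y\<close>.\<close>
  define mix where "mix T = (\<lambda>a b. if (a, b) \<in> T then Y a b else X a b)" for T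
  have "finite T \<Longrightarrow> T \<subseteq> ?S \<Longrightarrow> l2n J (\<lambda>j. ?c X j - ?c (mix T) j) \<le> real (card T) * (\<epsilon> * L)" for T
  proof (induction T rule: finite_induct)
    case empty
    then show ?case by (simp add: mix_def)
  next
    case (insert s T)
    define Z where "Z a b = (if (a, b) = s then (\<lambda>i x y z w. X a b i x y z w - Y a b i x y z w) else mix T a b)" for a b
    have step: "?c (mix T) j - ?c (mix (insert s T)) j = ?c Z j" for j
      using insert by (intro contraction_diff_single[of s]) (auto simp: Z_def mix_def)
    have "l2n J (?c Z) \<le> (\<Prod>(a, b)\<in>?S. local_norm I D a b (Z a b))"
      by (rule l2n_contraction_le[OF D I \<phi> inj])
    also have "\<dots> \<le> (\<Prod>(a, b)\<in>?S. \<Lambda> a b * (if (a, b) = s then \<epsilon> else 1))"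
    proof (rule prod_mono, clarify)
      fix a b assume "a \<in> {1..q}" "b \<in> {1..p}"
      then have "local_norm I D a b (X a b) \<le> \<Lambda> a b" "local_norm I D a b (Y a b) \<le> \<Lambda> a b"
        "local_norm I D a b (\<lambda>i x y z w. X a b i x y z w - Y a b i x y z w) \<le> \<Lambda> a b * \<epsilon>"
        using X Y XY by (auto simp: bounded_tensors_def sitewise_ball_def)
      then show "0 \<le> local_norm I D a b (Z a b) \<and> local_norm I D a b (Z a b) \<le> \<Lambda> a b * (if (a, b) = s then \<epsilon> else 1)"
        using ln0 by (auto simp: Z_def mix_def)
    qed
    also have "\<dots> = L * (\<Prod>t\<in>?S. if t = s then \<epsilon> else 1)"
      by (simp add: L_def case_prod_unfold prod.distrib)
    also have "\<dots> = \<epsilon> * L" using insert.prems by (simp add: mult.commute)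
    finally have Z: "l2n J (?c Z) \<le> \<epsilon> * L" .
    have "l2n J (\<lambda>j. ?c X j - ?c (mix (insert s T)) j) = l2n J (\<lambda>j. (?c X j - ?c (mix T) j) + ?c Z j)"
      by (simp add: step[symmetric])
    also have "\<dots> \<le> l2n J (\<lambda>j. ?c X j - ?c (mix T) j) + l2n J (?c Z)" by (rule l2n_triangle)
    also have "\<dots> \<le> real (card T) * (\<epsilon> * L) + \<epsilon> * L" using insert Z by (intro add_mono) auto
    also have "\<dots> = real (card (insert s T)) * (\<epsilon> * L)" using insert.hyps by (simp add: distrib_right)
    finally show ?case .
  qed
  note mix_le = this
  have mixS: "?c (mix ?S) j = ?c Y j" for j
    unfolding contraction_def by (intro sum.cong prod.cong refl) (auto simp: mix_def)
  from mix_le[of ?S] have "l2n J (\<lambda>j. ?c X j - ?c (mix ?S) j) \<le> real (card ?S) * (\<epsilon> * L)" by simp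
  also have "\<dots> = lattice_resolution q p \<Lambda> \<epsilon>"
    by (simp add: lattice_resolution_def L_def prod.cartesian_product card_cartesian_product mult.assoc)
  finally show ?thesis by (simp only: mixS)
qed

section \<open>Nets for lattice tensors\<close>

lemma local_norm_l2n:
  "local_norm I D a b T = l2n (I \<times> {..<D (left_edge a b)} \<times> {..<D (up_edge a b)} \<times> {..<D (right_edge a b)} \<times> {..<D (down_edge a b)})
     (\<lambda>(i, x, y, z, w). T i x y z w)"
  unfolding local_norm_def l2n_def L2_set_def
  by (simp add: sum.cartesian_product case_prod_unfold)

text \<open>Unit-ball nets scaled by \<Lambda>. The centers stay in \<open>bounded_tensors\<close>
  because the hybrids in \<open>l2n_contraction_diff_le\<close> mix both families and need bounds on
  each.\<close>

lemma tensor_net: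
  assumes I: "finite I" and \<Lambda>: "\<forall>a\<in>{1..q}. \<forall>b\<in>{1..p}. 0 \<le> \<Lambda> a b" and e: "0 < \<epsilon>" "\<epsilon> \<le> 1"
  shows "\<exists>C. finite C \<and>
    real (card C) \<le> (\<Prod>(a, b)\<in>{1..q} \<times> {1..p}. (4 / \<epsilon>) ^ (2 * (card I * bond_product D a b))) \<and>
    C \<subseteq> bounded_tensors I q p D \<Lambda> \<and>
    (\<forall>X\<in>bounded_tensors I q p D \<Lambda>. \<exists>Y\<in>C. X \<in> sitewise_ball I q p D \<Lambda> \<epsilon> Y)"
proof -
  let ?S = "{1..q} \<times> {1..p}"
  define K where "K s = (case s of (a, b) \<Rightarrow>
    I \<times> {..<D (left_edge a b)} \<times> {..<D (up_edge a b)} \<times> {..<D (right_edge a b)} \<times> {..<D (down_edge a b)})" for s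
  have K: "finite (K s)" "card (K s) = card I * bond_product D (fst s) (snd s)" for s
    using I by (auto simp: K_def bond_product_def card_cartesian_product case_prod_unfold mult.assoc)
  have ln: "local_norm I D a b T = l2n (K (a, b)) (\<lambda>(i, x, y, z, w). T i x y z w)" for a b T
    unfolding local_norm_l2n K_def by simp
  have "\<forall>s. \<exists>C. finite C \<and> C \<subseteq> {x. l2n (K s) x \<le> 1} \<and> real (card C) \<le> (4 / \<epsilon>) ^ (2 * card (K s)) \<and>
    (\<forall>x. l2n (K s) x \<le> 1 \<longrightarrow> (\<exists>c\<in>C. l2n (K s) (\<lambda>i. x i - c i) \<le> \<epsilon>))"
    using l2n_net[OF K(1) e] by blast
  from choice[OF this] obtain N where N0: "\<forall>s. finite (N s) \<and> N s \<subseteq> {x. l2n (K s) x \<le> 1} \<and>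
    real (card (N s)) \<le> (4 / \<epsilon>) ^ (2 * card (K s)) \<and>
    (\<forall>x. l2n (K s) x \<le> 1 \<longrightarrow> (\<exists>c\<in>N s. l2n (K s) (\<lambda>i. x i - c i) \<le> \<epsilon>))" ..
  have N: "finite (N s)" "N s \<subseteq> {x. l2n (K s) x \<le> 1}" "real (card (N s)) \<le> (4 / \<epsilon>) ^ (2 * card (K s))"
    "l2n (K s) x \<le> 1 \<Longrightarrow> \<exists>c\<in>N s. l2n (K s) (\<lambda>i. x i - c i) \<le> \<epsilon>" for s x
    using N0[rule_format, of s] by simp_all
  define F where "F \<zeta> a b i x y z w = complex_of_real (\<Lambda> a b) * \<zeta> (a, b) (i, x, y, z, w)"
    for \<zeta> :: "nat \<times> nat \<Rightarrow> _ \<Rightarrow> complex" and a b and i :: 'a and x y z w :: nat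
  have lnF: "local_norm I D a b (F \<zeta> a b) = \<bar>\<Lambda> a b\<bar> * l2n (K (a, b)) (\<zeta> (a, b))" for \<zeta> a b
    by (simp add: ln F_def case_prod_unfold l2n_scale)
  let ?Z = "PiE ?S N"
  have fZ: "finite ?Z" using N(1) by (intro finite_PiE) auto
  show ?thesis
  proof (intro exI[of _ "F ` ?Z"] conjI ballI)
    show "finite (F ` ?Z)" using fZ by simp
    have "real (card (F ` ?Z)) \<le> real (card ?Z)" using card_image_le[OF fZ] by (rule of_nat_mono)
    also have "\<dots> = (\<Prod>s\<in>?S. real (card (N s)))" by (simp add: card_PiE)
    also have "\<dots> \<le> (\<Prod>s\<in>?S. (4 / \<epsilon>) ^ (2 * card (K s)))" using N(3) by (intro prod_mono) auto
    also have "\<dots> = (\<Prod>(a, b)\<in>?S. (4 / \<epsilon>) ^ (2 * (card I * bond_product D a b)))"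
      by (simp add: K(2) case_prod_unfold)
    finally show "real (card (F ` ?Z)) \<le> (\<Prod>(a, b)\<in>?S. (4 / \<epsilon>) ^ (2 * (card I * bond_product D a b)))" .
    show "F ` ?Z \<subseteq> bounded_tensors I q p D \<Lambda>"
    proof (intro subsetI, elim imageE)
      fix Y \<zeta> assume Y: "Y = F \<zeta>" "\<zeta> \<in> ?Z"
      have "local_norm I D a b (F \<zeta> a b) \<le> \<Lambda> a b" if "a \<in> {1..q}" "b \<in> {1..p}" for a b
      proof -
        have "\<zeta> (a, b) \<in> N (a, b)" using Y(2) that by auto
        then have "l2n (K (a, b)) (\<zeta> (a, b)) \<le> 1" using N(2) by blast
        moreover have "0 \<le> \<Lambda> a b" using \<Lambda> that by blast
        ultimately show ?thesis unfolding lnF by (simp add: mult_left_le)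
      qed
      then show "Y \<in> bounded_tensors I q p D \<Lambda>" unfolding Y(1) bounded_tensors_def by blast
    qed
    fix X assume X: "X \<in> bounded_tensors I q p D \<Lambda>"
    \<comment> \<open>Where \<Lambda> is 0, \<open>inverse 0 = 0\<close> makes \<open>u\<close>
      vanish, which still puts it in the unit ball.\<close>
    define u where "u s = (case s of (a, b) \<Rightarrow> \<lambda>(i, x, y, z, w). complex_of_real (inverse (\<Lambda> a b)) * X a b i x y z w)" for s
    have lnX: "local_norm I D a b (X a b) \<le> \<Lambda> a b" if "(a, b) \<in> ?S" for a b
      using X that by (auto simp: bounded_tensors_def)
    have u: "l2n (K s) (u s) \<le> 1" if "s \<in> ?S" for s
    proof -
      obtain a b where s: "s = (a, b)" by (cases s)
      have "l2n (K s) (u s) = \<bar>inverse (\<Lambda> a b)\<bar> * local_norm I D a b (X a b)"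
        unfolding ln u_def s norm_of_real[symmetric, where 'a = complex] l2n_scale[symmetric]
        by (simp add: case_prod_unfold)
      moreover have "0 \<le> \<Lambda> a b" using \<Lambda> that s by auto
      moreover have "local_norm I D a b (X a b) / \<Lambda> a b \<le> 1" if "0 < \<Lambda> a b"
        using lnX[of a b] \<open>s \<in> ?S\<close> s that by (simp add: divide_le_eq_1_pos)
      ultimately show ?thesis
        by (cases "\<Lambda> a b = 0") (simp_all add: divide_inverse mult.commute)
    qed
    have "\<forall>s\<in>?S. \<exists>c. c \<in> N s \<and> l2n (K s) (\<lambda>i. u s i - c i) \<le> \<epsilon>" using N(4) u by blast
    from bchoice[OF this] obtain \<zeta> where \<zeta>: "\<forall>s\<in>?S. \<zeta> s \<in> N s \<and> l2n (K s) (\<lambda>i. u s i - \<zeta> s i) \<le> \<epsilon>" ..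
    let ?\<zeta> = "restrict \<zeta> ?S"
    have "?\<zeta> \<in> ?Z" using \<zeta> by auto
    moreover have "X \<in> sitewise_ball I q p D \<Lambda> \<epsilon> (F ?\<zeta>)"
      unfolding sitewise_ball_def mem_Collect_eq
    proof (intro ballI)
      fix a b assume ab: "a \<in> {1..q}" "b \<in> {1..p}"
      then have s: "(a, b) \<in> ?S" by simp
      have L0: "0 \<le> \<Lambda> a b" using \<Lambda> ab by blast
      show "local_norm I D a b (\<lambda>i x y z w. X a b i x y z w - F ?\<zeta> a b i x y z w) \<le> \<Lambda> a b * \<epsilon>"
      proof (cases "\<Lambda> a b = 0")
        \<comment> \<open>Radius 0: the scaled net element is 0, and \<open>X\<close> itself has
          local norm 0.\<close>
        case True
        then show ?thesis using lnX[OF s] by (simp add: F_def)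
      next
        case False
        have "local_norm I D a b (\<lambda>i x y z w. X a b i x y z w - F ?\<zeta> a b i x y z w) =
            l2n (K (a, b)) (\<lambda>k. complex_of_real (\<Lambda> a b) * (u (a, b) k - \<zeta> (a, b) k))"
          unfolding ln using False s by (intro l2n_cong) (auto simp: F_def u_def right_diff_distrib)
        also have "\<dots> = \<Lambda> a b * l2n (K (a, b)) (\<lambda>k. u (a, b) k - \<zeta> (a, b) k)"
          using L0 by (simp add: l2n_scale)
        also have "\<dots> \<le> \<Lambda> a b * \<epsilon>" using \<zeta> s L0 by (intro mult_left_mono) auto
        finally show ?thesis .
      qed
    qed
    ultimately show "\<exists>Y\<in>F ` ?Z. X \<in> sitewise_ball I q p D \<Lambda> \<epsilon> Y" by blast
  qed
qed

text \<open>The range of \<epsilon> contains both resolutions, 1/(4n) and 1/(2n). The bound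
  4/\<epsilon> \<le> 16 n is relaxed to 16 n^2 so that the size estimate for trains applies
  again.\<close>

lemma lattice_tensor_net:
  assumes I: "finite I" and \<Lambda>: "\<forall>a\<in>{1..q}. \<forall>b\<in>{1..p}. 0 \<le> \<Lambda> a b"
    and n: "2 \<le> n" and e: "1 / (4 * real n) \<le> \<epsilon>" "\<epsilon> \<le> 1"
  obtains C where "finite C"
    "real (card C) \<le> exp (12 * (\<Sum>a = 1..q. \<Sum>b = 1..p. real (card I * bond_product D a b) * ln (real n)))"
    "C \<subseteq> bounded_tensors I q p D \<Lambda>"
    "\<forall>X\<in>bounded_tensors I q p D \<Lambda>. \<exists>Y\<in>C. X \<in> sitewise_ball I q p D \<Lambda> \<epsilon> Y"
proof -
  have "0 < 1 / (4 * real n)" using n by simp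
  with e(1) have e0: "0 < \<epsilon>" by linarith
  have "4 \<le> \<epsilon> * (16 * real n)" using e(1) n by (simp add: field_simps)
  then have "4 / \<epsilon> \<le> 16 * real n" using e0 by (simp add: divide_le_eq mult.commute)
  also have "\<dots> \<le> 16 * (real n)\<^sup>2" using n by (simp add: power2_eq_square)
  finally have e4: "4 / \<epsilon> \<le> 16 * (real n)\<^sup>2" .
  obtain C where C: "finite C"
    "real (card C) \<le> (\<Prod>(a, b)\<in>{1..q} \<times> {1..p}. (4 / \<epsilon>) ^ (2 * (card I * bond_product D a b)))"
    "C \<subseteq> bounded_tensors I q p D \<Lambda>"
    "\<forall>X\<in>bounded_tensors I q p D \<Lambda>. \<exists>Y\<in>C. X \<in> sitewise_ball I q p D \<Lambda> \<epsilon> Y"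
    using tensor_net[OF I \<Lambda> e0 e(2), of D] by (elim exE conjE) (rule that; assumption)
  have "(\<Prod>(a, b)\<in>{1..q} \<times> {1..p}. (4 / \<epsilon>) ^ (2 * (card I * bond_product D a b))) \<le>
      (\<Prod>(a, b)\<in>{1..q} \<times> {1..p}. exp (12 * (real (card I * bond_product D a b) * ln (real n))))"
    using e0 by (intro prod_mono, clarify) (intro conjI net_size_le_exp n e4, simp_all)
  also have "\<dots> = exp (\<Sum>(a, b)\<in>{1..q} \<times> {1..p}. 12 * (real (card I * bond_product D a b) * ln (real n)))"
    by (simp add: exp_sum case_prod_unfold)
  also have "(\<Sum>(a, b)\<in>{1..q} \<times> {1..p}. 12 * (real (card I * bond_product D a b) * ln (real n))) =
      12 * (\<Sum>a = 1..q. \<Sum>b = 1..p. real (card I * bond_product D a b) * ln (real n))"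
    unfolding sum_distrib_left by (rule sum.cartesian_product[symmetric])
  finally show ?thesis using that C by (meson order_trans)
qed

lemma lattice_index_eqD:
  assumes "i < d ^ (q * p)" "j < d ^ (q * p)"
    and eq: "\<forall>a\<in>{1..q}. \<forall>b\<in>{1..p}. lattice_index d q p i a b = lattice_index d q p j a b"
  shows "i = j"
proof (rule site_index_eqD[OF assms(1,2)], rule ballI)
  fix l assume l: "l \<in> {1..q * p}"
  \<comment> \<open>Division with remainder inverts the row-by-row numbering; sites and coordinates
    both start at 1, hence the shifts.\<close>
  define a b where "a = Suc ((l - 1) div p)" and "b = Suc ((l - 1) mod p)"
  have p: "0 < p" using l by (cases p) auto
  have "l - 1 < q * p" using l by auto
  then have "a \<in> {1..q}" by (simp add: a_def less_mult_imp_div_less Suc_le_eq)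
  moreover have "b \<in> {1..p}" using p by (simp add: b_def Suc_le_eq)
  moreover have "(a - 1) * p + b = l" using l by (simp add: a_def b_def)
  ultimately show "site_index d (q * p) i l = site_index d (q * p) j l"
    using eq unfolding lattice_index_def by metis
qed

text \<open>One net of local tensors gives both bounds: sitewise it covers by construction, and
  contracting its elements gives centers of Euclidean balls with the radius from
  \<open>l2n_contraction_diff_le\<close>.\<close>

lemma log_peps_covering_le:
  assumes d: "1 \<le> d" and n: "n = q * p" "2 \<le> n" and D: "lattice_bond_dims q p D"
    and \<Lambda>: "\<forall>a\<in>{1..q}. \<forall>b\<in>{1..p}. 0 \<le> \<Lambda> a b"
    and e: "1 / (4 * real n) \<le> \<epsilon>" "\<epsilon> \<le> 1"
  defines "B \<equiv> 12 * (\<Sum>a = 1..q. \<Sum>b = 1..p. real (d * bond_product D a b) * ln (real n))"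
  shows "log_enat (peps_sitewise_covering_number d q p D \<Lambda> L \<epsilon>) \<le> ereal B"
    "log_enat (vec_covering_number (d ^ n) (lattice_resolution q p \<Lambda> \<epsilon>) (peps_set d q p D \<Lambda> L)) \<le> ereal B"
proof -
  let ?I = "{..<d}"
  have "0 \<le> 1 / (4 * real n)" by simp
  with e(1) have e0: "0 \<le> \<epsilon>" by linarith
  obtain C where C: "finite C" "real (card C) \<le> exp B" "C \<subseteq> bounded_tensors ?I q p D \<Lambda>"
    "\<forall>X\<in>bounded_tensors ?I q p D \<Lambda>. \<exists>Y\<in>C. X \<in> sitewise_ball ?I q p D \<Lambda> \<epsilon> Y"
    using lattice_tensor_net[OF finite_lessThan \<Lambda> n(2) e, of d D] by (auto simp: B_def)
  show "log_enat (peps_sitewise_covering_number d q p D \<Lambda> L \<epsilon>) \<le> ereal B"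
    unfolding peps_sitewise_covering_number_def
  proof (rule log_covering_number_le[OF C(1) subset_UNIV _ C(2)])
    show "peps_set d q p D \<Lambda> L \<subseteq> (\<Union>Y\<in>C. peps_vec d q p D ` (bounded_tensors ?I q p D \<Lambda> \<inter> sitewise_ball ?I q p D \<Lambda> \<epsilon> Y))"
      using C(4) unfolding peps_set_def by blast
  qed
  let ?\<phi> = "\<lambda>i a b. lattice_index d q p i a b"
  let ?c = "\<lambda>X i. contraction q p D X (?\<phi> i)"
  show "log_enat (vec_covering_number (d ^ n) (lattice_resolution q p \<Lambda> \<epsilon>) (peps_set d q p D \<Lambda> L)) \<le> ereal B"
  proof (rule log_vec_covering_number_le)
    show "finite (?c ` C)" using C(1) by simp
    show "real (card (?c ` C)) \<le> exp B" using card_image_le[OF C(1), of ?c] C(2) by linarith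
    show "peps_set d q p D \<Lambda> L \<subseteq> carrier_vec (d ^ n)" by (auto simp: peps_set_def peps_vec_def n)
    fix v assume "v \<in> peps_set d q p D \<Lambda> L"
    then obtain X where X: "X \<in> bounded_tensors ?I q p D \<Lambda>" "v = peps_vec d q p D X" by (auto simp: peps_set_def)
    obtain Y where Y: "Y \<in> C" "X \<in> sitewise_ball ?I q p D \<Lambda> \<epsilon> Y" using C(4) X(1) by blast
    have "l2n {..<d ^ n} (\<lambda>i. v $ i - ?c Y i) = l2n {..<d ^ n} (\<lambda>i. ?c X i - ?c Y i)"
      by (intro l2n_cong) (simp add: X(2) peps_vec_def n)
    also have "\<dots> \<le> lattice_resolution q p \<Lambda> \<epsilon>"
    proof (rule l2n_contraction_diff_le[OF D finite_lessThan _ _ X(1) _ Y(2) e0])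
      show "?\<phi> i a b \<in> {..<d}" for i a b using site_index_less[OF d] by (simp add: lattice_index_def)
      show "i = j" if "i \<in> {..<d ^ n}" "j \<in> {..<d ^ n}" "\<forall>a\<in>{1..q}. \<forall>b\<in>{1..p}. ?\<phi> i a b = ?\<phi> j a b" for i j
        using that n(1) by (intro lattice_index_eqD[of i d q p j]) auto
      show "Y \<in> bounded_tensors ?I q p D \<Lambda>" using C(3) Y(1) by blast
    qed
    finally show "\<exists>c\<in>?c ` C. l2n {..<d ^ n} (\<lambda>i. v $ i - c i) \<le> lattice_resolution q p \<Lambda> \<epsilon>"
      by (intro bexI[of _ "?c Y"] rev_image_eqI[OF Y(1)] refl)
  qed
qed

lemma log_pepo_covering_le:
  assumes d: "1 \<le> d" and n: "n = q * p" "2 \<le> n" and D: "lattice_bond_dims q p D"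
    and \<Lambda>: "\<forall>a\<in>{1..q}. \<forall>b\<in>{1..p}. 0 \<le> \<Lambda> a b"
    and e: "1 / (4 * real n) \<le> \<epsilon>" "\<epsilon> \<le> 1"
  defines "B \<equiv> 12 * (\<Sum>a = 1..q. \<Sum>b = 1..p. real (d\<^sup>2 * bond_product D a b) * ln (real n))"
  shows "log_enat (pepo_sitewise_covering_number d q p D \<Lambda> L \<epsilon>) \<le> ereal B"
    "log_enat (mat_covering_number (d ^ n) (lattice_resolution q p \<Lambda> \<epsilon>) (pepo_set d q p D \<Lambda> L)) \<le> ereal B"
proof -
  let ?I = "{..<d} \<times> {..<d}"
  have fI: "finite ?I" by simp
  have "0 \<le> 1 / (4 * real n)" by simp
  with e(1) have e0: "0 \<le> \<epsilon>" by linarith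
  obtain C where C: "finite C" "real (card C) \<le> exp B" "C \<subseteq> bounded_tensors ?I q p D \<Lambda>"
    "\<forall>X\<in>bounded_tensors ?I q p D \<Lambda>. \<exists>Y\<in>C. X \<in> sitewise_ball ?I q p D \<Lambda> \<epsilon> Y"
    using lattice_tensor_net[OF fI \<Lambda> n(2) e, of D] by (auto simp: B_def card_cartesian_product power2_eq_square)
  show "log_enat (pepo_sitewise_covering_number d q p D \<Lambda> L \<epsilon>) \<le> ereal B"
    unfolding pepo_sitewise_covering_number_def
  proof (rule log_covering_number_le[OF C(1) subset_UNIV _ C(2)])
    show "pepo_set d q p D \<Lambda> L \<subseteq> (\<Union>Y\<in>C. pepo_mat d q p D ` (bounded_tensors ?I q p D \<Lambda> \<inter> sitewise_ball ?I q p D \<Lambda> \<epsilon> Y))"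
      using C(4) unfolding pepo_set_def by blast
  qed
  let ?\<phi> = "\<lambda>j a b. (lattice_index d q p (fst j) a b, lattice_index d q p (snd j) a b)"
  let ?c = "\<lambda>X j. contraction q p D X (?\<phi> j)"
  let ?J = "{..<d ^ n} \<times> {..<d ^ n}"
  show "log_enat (mat_covering_number (d ^ n) (lattice_resolution q p \<Lambda> \<epsilon>) (pepo_set d q p D \<Lambda> L)) \<le> ereal B"
  proof (rule log_mat_covering_number_le)
    show "finite (?c ` C)" using C(1) by simp
    show "real (card (?c ` C)) \<le> exp B" using card_image_le[OF C(1), of ?c] C(2) by linarith
    show "pepo_set d q p D \<Lambda> L \<subseteq> carrier_mat (d ^ n) (d ^ n)" by (auto simp: pepo_set_def pepo_mat_def n)
    fix A assume "A \<in> pepo_set d q p D \<Lambda> L"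
    then obtain X where X: "X \<in> bounded_tensors ?I q p D \<Lambda>" "A = pepo_mat d q p D X" by (auto simp: pepo_set_def)
    obtain Y where Y: "Y \<in> C" "X \<in> sitewise_ball ?I q p D \<Lambda> \<epsilon> Y" using C(4) X(1) by blast
    have "l2n ?J (\<lambda>j. A $$ j - ?c Y j) = l2n ?J (\<lambda>j. ?c X j - ?c Y j)"
      by (intro l2n_cong) (auto simp: X(2) pepo_mat_def n)
    also have "\<dots> \<le> lattice_resolution q p \<Lambda> \<epsilon>"
    proof (rule l2n_contraction_diff_le[OF D fI _ _ X(1) _ Y(2) e0])
      show "?\<phi> j a b \<in> ?I" for j a b using site_index_less[OF d] by (simp add: lattice_index_def)
      show "i = j" if "i \<in> ?J" "j \<in> ?J" "\<forall>a\<in>{1..q}. \<forall>b\<in>{1..p}. ?\<phi> i a b = ?\<phi> j a b" for i j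
      proof (rule prod_eqI)
        show "fst i = fst j" using that n(1) by (intro lattice_index_eqD[of _ d q p]) auto
        show "snd i = snd j" using that n(1) by (intro lattice_index_eqD[of _ d q p]) auto
      qed
      show "Y \<in> bounded_tensors ?I q p D \<Lambda>" using C(3) Y(1) by blast
    qed
    finally show "\<exists>c\<in>?c ` C. l2n ?J (\<lambda>j. A $$ j - c j) \<le> lattice_resolution q p \<Lambda> \<epsilon>"
      by (intro bexI[of _ "?c Y"] rev_image_eqI[OF Y(1)] refl)
  qed
qed

section \<open>Bond dimensions in the low-rank classes\<close>

lemma lattice_bond_dims_lr_pepo: "lattice_bond_dims q p D \<Longrightarrow> lattice_bond_dims q p (lr_pepo_bonds q p D)"
  unfolding lattice_bond_dims_def lr_pepo_bonds_def by (auto simp: Suc_le_eq)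

text \<open>Each of the four edges contributes at most a factor 2, hence 16. An edge leaving the
  lattice keeps dimension 1, which is below twice the square of a positive number.\<close>

lemma bond_product_lr_pepo_le:
  assumes D: "lattice_bond_dims q p D" and ab: "a \<in> {1..q}" "b \<in> {1..p}"
  shows "bond_product (lr_pepo_bonds q p D) a b \<le> 16 * (bond_product D a b)\<^sup>2"
proof -
  have le: "lr_pepo_bonds q p D e \<le> 2 * (D e)\<^sup>2" if "e \<in> site_edges (a, b)" for e
  proof -
    have "e \<in> lattice_edges q p" using that site_edges_subset[of "(a, b)" q p] ab by blast
    then have "1 \<le> D e" using D by (auto simp: lattice_bond_dims_def)
    then have "1 \<le> (D e)\<^sup>2" by (rule one_le_power)
    then show ?thesis by (simp add: lr_pepo_bonds_def)
  qed
  have "bond_product (lr_pepo_bonds q p D) a b \<le>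
      (2 * (D (left_edge a b))\<^sup>2) * (2 * (D (up_edge a b))\<^sup>2) * (2 * (D (right_edge a b))\<^sup>2) * (2 * (D (down_edge a b))\<^sup>2)"
    unfolding bond_product_def by (intro mult_mono le) (auto simp: site_edges_def)
  also have "\<dots> = 16 * (bond_product D a b)\<^sup>2" by (simp add: bond_product_def power_mult_distrib mult_ac)
  finally show ?thesis .
qed

lemma real_mult_le_of_nat_le:
  assumes "x \<le> c * y" "0 \<le> w"
  shows "real x * w \<le> real c * (real y * w)"
proof -
  have "real x \<le> real c * real y" using assms(1) by (metis of_nat_le_iff of_nat_mult)
  then have "real x * w \<le> real c * real y * w" using assms(2) by (rule mult_right_mono)
  then show ?thesis by (simp only: mult.assoc)
qed

lemma lr_pepo_sum_le:
  assumes "lattice_bond_dims q p D" "2 \<le> n"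
  shows "12 * (\<Sum>a = 1..q. \<Sum>b = 1..p. real (d\<^sup>2 * bond_product (lr_pepo_bonds q p D) a b) * ln (real n))
    \<le> 192 * (\<Sum>a = 1..q. \<Sum>b = 1..p. real (d\<^sup>2 * (bond_product D a b)\<^sup>2) * ln (real n))"
proof -
  have ln: "0 \<le> ln (real n)" using assms(2) by simp
  have "(\<Sum>a = 1..q. \<Sum>b = 1..p. real (d\<^sup>2 * bond_product (lr_pepo_bonds q p D) a b) * ln (real n)) \<le>
      (\<Sum>a = 1..q. \<Sum>b = 1..p. 16 * (real (d\<^sup>2 * (bond_product D a b)\<^sup>2) * ln (real n)))"
  proof (intro sum_mono)
    fix a b assume "a \<in> {1..q}" "b \<in> {1..p}"
    then have "d\<^sup>2 * bond_product (lr_pepo_bonds q p D) a b \<le> 16 * (d\<^sup>2 * (bond_product D a b)\<^sup>2)"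
      using mult_left_mono[OF bond_product_lr_pepo_le[OF assms(1)], of a b "d\<^sup>2"] by (simp add: mult_ac)
    from real_mult_le_of_nat_le[OF this ln]
    show "real (d\<^sup>2 * bond_product (lr_pepo_bonds q p D) a b) * ln (real n) \<le> 16 * (real (d\<^sup>2 * (bond_product D a b)\<^sup>2) * ln (real n))"
      by (simp only: of_nat_numeral)
  qed
  then show ?thesis by (simp add: sum_distrib_left[symmetric])
qed

text \<open>Only two bonds meet at a site of a chain, so 48 = 12 * 2 * 2.\<close>

lemma lr_mpo_sum_le:
  assumes "bond_dims n r" "2 \<le> n"
  shows "12 * (\<Sum>l = 1..n. real (d\<^sup>2 * lr_mpo_bonds n r (l - 1) * lr_mpo_bonds n r l) * ln (real n))
    \<le> 48 * (\<Sum>l = 1..n. real (d\<^sup>2 * (r (l - 1))\<^sup>2 * (r l)\<^sup>2) * ln (real n))"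
proof -
  have ln: "0 \<le> ln (real n)" using assms(2) by simp
  have le: "lr_mpo_bonds n r l \<le> 2 * (r l)\<^sup>2" if "l \<le> n" for l
  proof -
    have "1 \<le> (r l)\<^sup>2" using assms(1) that by (intro one_le_power) (simp add: bond_dims_def)
    then show ?thesis by (simp add: lr_mpo_bonds_def)
  qed
  have "(\<Sum>l = 1..n. real (d\<^sup>2 * lr_mpo_bonds n r (l - 1) * lr_mpo_bonds n r l) * ln (real n)) \<le>
      (\<Sum>l = 1..n. 4 * (real (d\<^sup>2 * (r (l - 1))\<^sup>2 * (r l)\<^sup>2) * ln (real n)))"
  proof (intro sum_mono)
    fix l assume "l \<in> {1..n}"
    then have "d\<^sup>2 * lr_mpo_bonds n r (l - 1) * lr_mpo_bonds n r l \<le> d\<^sup>2 * (2 * (r (l - 1))\<^sup>2) * (2 * (r l)\<^sup>2)"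
      by (intro mult_mono le) auto
    also have "\<dots> = 4 * (d\<^sup>2 * (r (l - 1))\<^sup>2 * (r l)\<^sup>2)" by (simp add: mult_ac)
    finally have "d\<^sup>2 * lr_mpo_bonds n r (l - 1) * lr_mpo_bonds n r l \<le> 4 * (d\<^sup>2 * (r (l - 1))\<^sup>2 * (r l)\<^sup>2)" .
    from real_mult_le_of_nat_le[OF this ln]
    show "real (d\<^sup>2 * lr_mpo_bonds n r (l - 1) * lr_mpo_bonds n r l) * ln (real n) \<le> 4 * (real (d\<^sup>2 * (r (l - 1))\<^sup>2 * (r l)\<^sup>2) * ln (real n))"
      by (simp only: of_nat_numeral)
  qed
  then show ?thesis by (simp add: sum_distrib_left[symmetric])
qed

lemma log_mat_covering_number_empty: "log_enat (mat_covering_number N \<epsilon> {}) \<le> ereal b"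
  unfolding mat_covering_number_def by (rule log_covering_number_le[of "{}"]) auto

text \<open>For \<open>s\<close> beyond d^(2n) the claimed bound can be negative. The empty set has
  covering number 0 with logarithm -\<infinity>, so the estimate survives.\<close>

lemma sparse_set_empty:
  assumes "d ^ (2 * n) < s"
  shows "sparse_set d n s = {}"
proof -
  have "num_nonzero A \<le> d ^ (2 * n)" if "A \<in> phy_set d n" for A
  proof -
    have "A \<in> carrier_mat (d ^ n) (d ^ n)" by (rule phy_setD(1)[OF that])
    then have "{(i, j). i < dim_row A \<and> j < dim_col A \<and> A $$ (i, j) \<noteq> 0} \<subseteq> {..<d ^ n} \<times> {..<d ^ n}" by auto
    then have "num_nonzero A \<le> card ({..<d ^ n} \<times> {..<d ^ n})"
      unfolding num_nonzero_def by (intro card_mono) auto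
    then show ?thesis by (simp add: card_cartesian_product power_add[symmetric] mult_2)
  qed
  then show ?thesis using assms unfolding sparse_set_def by fastforce
qed

text \<open>Monotone because centers range over the ambient space; with centers confined to the
  covered set this could fail.\<close>

lemma log_mat_covering_number_mono:
  assumes "S \<subseteq> T" "log_enat (mat_covering_number N \<epsilon> T) \<le> ereal b"
  shows "log_enat (mat_covering_number N \<epsilon> S) \<le> ereal b"
proof -
  have "mat_covering_number N \<epsilon> S \<le> mat_covering_number N \<epsilon> T"
    unfolding mat_covering_number_def covering_number_def by (rule INF_superset_mono) (use assms(1) in auto)
  then have "log_enat (mat_covering_number N \<epsilon> S) \<le> log_enat (mat_covering_number N \<epsilon> T)"
    by (cases "mat_covering_number N \<epsilon> S"; cases "mat_covering_number N \<epsilon> T") (auto simp: log_enat_def)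
  with assms(2) show ?thesis by (rule order_trans[rotated])
qed

text \<open>Lets a multiple of the logarithm absorb an additive constant such as 9. The value comes
  from ln (1/2) \<le> -1/2.\<close>

lemma ln_ge_half: "2 * s \<le> m \<Longrightarrow> 1 \<le> s \<Longrightarrow> 1 / 2 \<le> ln (real m / real s)"
proof -
  assume s: "2 * s \<le> m" "1 \<le> s"
  then have "2 \<le> real m / real s" by (simp add: field_simps)
  then have "ln 2 \<le> ln (real m / real s)" by (intro ln_mono) auto
  moreover have "1 / 2 \<le> ln (2::real)"
    using ln_le_minus_one[of "1 / 2 :: real"] by (simp add: ln_div)
  ultimately show ?thesis by linarith
qed

text \<open>These matrices are sparse with s = 2t^2. If this exceeds d^(2n) there are none;
  otherwise d^(2n)/t^2 is at least 2, so the logarithm is at least 1/2 with no further assumption.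
  Then 9 is at most 18 times the logarithm, and 38 = 2 * (18 + 1).\<close>

lemma log_lr_sparse_covering_le:
  assumes t: "1 \<le> t"
  shows "log_enat (mat_covering_number (d ^ n) (1 / 4) (lr_sparse_set d n r t))
    \<le> ereal (38 * (real (t\<^sup>2) * ln (real (d ^ (2 * n)) / real (t\<^sup>2))))"
proof (cases "2 * t\<^sup>2 \<le> d ^ (2 * n)")
  case True
  let ?m = "d ^ (2 * n)" and ?u = "t\<^sup>2"
  have u: "1 \<le> ?u" using t by (rule one_le_power)
  have h: "1 / 2 \<le> ln (real ?m / real ?u)" by (rule ln_ge_half[OF True u])
  have m: "0 < ?m" using True u by linarith
  have "ln (real ?m / real (2 * ?u)) \<le> ln (real ?m / real ?u)"
    using u m t by (intro ln_mono divide_left_mono divide_pos_pos mult_pos_pos) auto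
  then have "real (2 * ?u) * (9 + ln (real ?m / real (2 * ?u))) \<le> real (2 * ?u) * (19 * ln (real ?m / real ?u))"
    using h by (intro mult_left_mono) linarith+
  also have "\<dots> = 38 * (real ?u * ln (real ?m / real ?u))" by simp
  finally have b: "real (2 * ?u) * (9 + ln (real ?m / real (2 * ?u))) \<le> 38 * (real ?u * ln (real ?m / real ?u))" .
  have "log_enat (mat_covering_number (d ^ n) (1 / 4) (sparse_set d n (2 * ?u)))
    \<le> ereal (real (2 * ?u) * (9 + ln (real ?m / real (2 * ?u))))"
    using u True by (intro log_sparse_covering_le) auto
  also have "\<dots> \<le> ereal (38 * (real ?u * ln (real ?m / real ?u)))" using b by (simp only: ereal_less_eq)
  finally show ?thesis
    by (rule log_mat_covering_number_mono[rotated]) (auto simp: lr_sparse_set_def sparse_set_def)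
next
  case False
  then have "sparse_set d n (2 * t\<^sup>2) = {}" by (intro sparse_set_empty) auto
  then have "lr_sparse_set d n r t = {}" by (auto simp: lr_sparse_set_def sparse_set_def)
  then show ?thesis by (simp add: log_mat_covering_number_empty)
qed

text \<open>At s = d^(2n) the logarithm in the sparse bound is 0, although a nonempty set contains
  opposite matrices at distance 2; hence the restricted range of \<open>s\<close> and the second
  form with 1 added. Likewise \<open>ln n\<close> is 0 for n = 1, which is why the tensor-network
  clauses start at n = 2. In the factor version of LR a difference of two states has the doubled
  rank parameter.\<close>

theorem lemma1:
  shows "\<exists>C::real. 0 < C \<and>
    \<comment> \<open>PHY\<close>
    (\<forall>d n :: nat. 1 \<le> d \<and> 1 \<le> n \<longrightarrow>
       log_enat (mat_covering_number (d ^ n) (1 / 2) (phy_set d n))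
         \<le> ereal (C * real (d ^ (2 * n)))) \<and>
    \<comment> \<open>S: as stated when the logarithm is bounded away from 0, and for every s\<close>
    (\<forall>d n s :: nat. 1 \<le> d \<and> 1 \<le> n \<and> 1 \<le> s \<and> 2 * s \<le> d ^ (2 * n) \<longrightarrow>
       log_enat (mat_covering_number (d ^ n) (1 / 4) (sparse_set d n s))
         \<le> ereal (C * (real s * ln (real (d ^ (2 * n)) / real s)))) \<and>
    (\<forall>d n s :: nat. 1 \<le> d \<and> 1 \<le> n \<and> 1 \<le> s \<longrightarrow>
       log_enat (mat_covering_number (d ^ n) (1 / 4) (sparse_set d n s))
         \<le> ereal (C * (real s * (1 + ln (real (d ^ (2 * n)) / real s))))) \<and>
    \<comment> \<open>LR: density matrices, and factors\<close>
    (\<forall>d n r :: nat. 1 \<le> d \<and> 1 \<le> n \<and> 1 \<le> r \<longrightarrow>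
       log_enat (mat_covering_number (d ^ n) (1 / 4) (lr_set d n r))
         \<le> ereal (C * real (d ^ n * r))) \<and>
    (\<forall>d n r :: nat. 1 \<le> d \<and> 1 \<le> n \<and> 1 \<le> r \<longrightarrow>
       log_enat (mat_covering_number (d ^ n) (1 / 4) (lr_set d n (2 * r)))
         \<le> ereal (C * real (d ^ n * r))) \<and>
    \<comment> \<open>LR-S\<close>
    (\<forall>d n r t :: nat. 1 \<le> d \<and> 1 \<le> n \<and> 1 \<le> r \<and> 1 \<le> t \<longrightarrow>
       log_enat (mat_covering_number (d ^ n) (1 / 4) (lr_sparse_set d n r t))
         \<le> ereal (C * (real (t\<^sup>2) * ln (real (d ^ (2 * n)) / real (t\<^sup>2))))) \<and>
    \<comment> \<open>MPS\<close>
    (\<forall>(d::nat) (n::nat) (r :: nat \<Rightarrow> nat). 1 \<le> d \<and> 2 \<le> n \<and> bond_dims n r \<longrightarrow>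
       log_enat (vec_covering_number (d ^ n) (1 / (4 * real n)) (mps_set d n r))
         \<le> ereal (C * (\<Sum>l = 1..n. real (d * r (l - 1) * r l) * ln (real n)))) \<and>
    \<comment> \<open>MPO\<close>
    (\<forall>(d::nat) (n::nat) (r :: nat \<Rightarrow> nat). 1 \<le> d \<and> 2 \<le> n \<and> bond_dims n r \<longrightarrow>
       log_enat (mat_covering_number (d ^ n) (1 / (2 * real n)) (mpo_set d n r))
         \<le> ereal (C * (\<Sum>l = 1..n. real (d\<^sup>2 * r (l - 1) * r l) * ln (real n)))) \<and>
    \<comment> \<open>LR-MPO\<close>
    (\<forall>(d::nat) (n::nat) (k::nat) (r :: nat \<Rightarrow> nat).
       1 \<le> d \<and> 2 \<le> n \<and> 1 \<le> k \<and> bond_dims n r \<longrightarrow>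
       log_enat (mat_covering_number (d ^ n) (1 / (2 * real n)) (lr_mpo_set d n k r))
         \<le> ereal (C * (\<Sum>l = 1..n. real (d\<^sup>2 * (r (l - 1))\<^sup>2 * (r l)\<^sup>2) * ln (real n)))) \<and>
    \<comment> \<open>PEPS\<close>
    (\<forall>(d::nat) (q::nat) (p::nat) (n::nat) (D :: lattice_edge \<Rightarrow> nat)
        (\<Lambda> :: nat \<Rightarrow> nat \<Rightarrow> real) (L::real).
       1 \<le> d \<and> n = q * p \<and> 2 \<le> n \<and> lattice_bond_dims q p D \<and>
       (\<forall>a \<in> {1..q}. \<forall>b \<in> {1..p}. 0 \<le> \<Lambda> a b) \<and> 0 \<le> L \<longrightarrow>
       log_enat (peps_sitewise_covering_number d q p D \<Lambda> L (1 / (4 * real n)))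
         \<le> ereal (C * (\<Sum>a = 1..q. \<Sum>b = 1..p. real (d * bond_product D a b) * ln (real n))) \<and>
       log_enat (vec_covering_number (d ^ n) (lattice_resolution q p \<Lambda> (1 / (4 * real n)))
                   (peps_set d q p D \<Lambda> L))
         \<le> ereal (C * (\<Sum>a = 1..q. \<Sum>b = 1..p. real (d * bond_product D a b) * ln (real n)))) \<and>
    \<comment> \<open>PEPO\<close>
    (\<forall>(d::nat) (q::nat) (p::nat) (n::nat) (D :: lattice_edge \<Rightarrow> nat)
        (\<Lambda> :: nat \<Rightarrow> nat \<Rightarrow> real) (L::real).
       1 \<le> d \<and> n = q * p \<and> 2 \<le> n \<and> lattice_bond_dims q p D \<and>
       (\<forall>a \<in> {1..q}. \<forall>b \<in> {1..p}. 0 \<le> \<Lambda> a b) \<and> 0 \<le> L \<longrightarrow>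
       log_enat (pepo_sitewise_covering_number d q p D \<Lambda> L (1 / (2 * real n)))
         \<le> ereal (C * (\<Sum>a = 1..q. \<Sum>b = 1..p. real (d\<^sup>2 * bond_product D a b) * ln (real n))) \<and>
       log_enat (mat_covering_number (d ^ n) (lattice_resolution q p \<Lambda> (1 / (2 * real n)))
                   (pepo_set d q p D \<Lambda> L))
         \<le> ereal (C * (\<Sum>a = 1..q. \<Sum>b = 1..p. real (d\<^sup>2 * bond_product D a b) * ln (real n)))) \<and>
    \<comment> \<open>LR-PEPO\<close>
    (\<forall>(d::nat) (q::nat) (p::nat) (n::nat) (D :: lattice_edge \<Rightarrow> nat)
        (\<Lambda> :: nat \<Rightarrow> nat \<Rightarrow> real) (L::real).
       1 \<le> d \<and> n = q * p \<and> 2 \<le> n \<and> lattice_bond_dims q p D \<and>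
       (\<forall>a \<in> {1..q}. \<forall>b \<in> {1..p}. 0 \<le> \<Lambda> a b) \<and> 0 \<le> L \<longrightarrow>
       log_enat (pepo_sitewise_covering_number d q p (lr_pepo_bonds q p D) \<Lambda> L (1 / (2 * real n)))
         \<le> ereal (C * (\<Sum>a = 1..q. \<Sum>b = 1..p.
                     real (d\<^sup>2 * (bond_product D a b)\<^sup>2) * ln (real n))) \<and>
       log_enat (mat_covering_number (d ^ n) (lattice_resolution q p \<Lambda> (1 / (2 * real n)))
                   (pepo_set d q p (lr_pepo_bonds q p D) \<Lambda> L))
         \<le> ereal (C * (\<Sum>a = 1..q. \<Sum>b = 1..p.
                     real (d\<^sup>2 * (bond_product D a b)\<^sup>2) * ln (real n))))"
proof (intro exI[of _ 192] conjI allI impI; (elim conjE)?)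
  show "(0::real) < 192" by simp
next
  fix d n :: nat
  show "log_enat (mat_covering_number (d ^ n) (1 / 2) (phy_set d n)) \<le> ereal (192 * real (d ^ (2 * n)))"
    by (rule order_trans[OF log_phy_covering_le]) simp
next
  fix d n s :: nat
  assume s: "1 \<le> s" "2 * s \<le> d ^ (2 * n)"
  let ?l = "ln (real (d ^ (2 * n)) / real s)"
  have h: "1 / 2 \<le> ?l" by (rule ln_ge_half[OF s(2,1)])
  then have "real s * (9 + ?l) \<le> real s * (192 * ?l)" by (intro mult_left_mono) linarith+
  then have "ereal (real s * (9 + ?l)) \<le> ereal (192 * (real s * ?l))"
    unfolding ereal_less_eq by (simp only: mult.left_commute)
  moreover have "s \<le> d ^ (2 * n)" using s by linarith
  ultimately show "log_enat (mat_covering_number (d ^ n) (1 / 4) (sparse_set d n s)) \<le> ereal (192 * (real s * ?l))"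
    by (metis order_trans[OF log_sparse_covering_le[OF s(1)]])
next
  fix d n s :: nat
  assume s: "1 \<le> s"
  let ?l = "ln (real (d ^ (2 * n)) / real s)"
  show "log_enat (mat_covering_number (d ^ n) (1 / 4) (sparse_set d n s)) \<le> ereal (192 * (real s * (1 + ?l)))"
  proof (cases "s \<le> d ^ (2 * n)")
    case True
    then have "1 \<le> real (d ^ (2 * n)) / real s" using s by (simp add: le_divide_eq)
    then have "0 \<le> ?l" by (rule ln_ge_zero)
    moreover have "9 + x \<le> 192 * (1 + x)" if "0 \<le> x" for x :: real using that by simp
    ultimately have "real s * (9 + ?l) \<le> real s * (192 * (1 + ?l))" by (intro mult_left_mono) simp_all
    then have "ereal (real s * (9 + ?l)) \<le> ereal (192 * (real s * (1 + ?l)))"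
      unfolding ereal_less_eq by (simp only: mult.left_commute)
    with log_sparse_covering_le[OF s True] show ?thesis by (rule order_trans)
  next
    case False
    then have "sparse_set d n s = {}" by (intro sparse_set_empty) auto
    then show ?thesis by (simp add: log_mat_covering_number_empty)
  qed
next
  fix d n r :: nat
  show "log_enat (mat_covering_number (d ^ n) (1 / 4) (lr_set d n r)) \<le> ereal (192 * real (d ^ n * r))"
    by (rule order_trans[OF log_lr_covering_le]) (unfold ereal_less_eq, intro mult_right_mono, simp_all)
next
  fix d n r :: nat
  have "ereal (24 * real (d ^ n * (2 * r))) \<le> ereal (192 * real (d ^ n * r))" by simp
  with log_lr_covering_le[of d n "2 * r"]
  show "log_enat (mat_covering_number (d ^ n) (1 / 4) (lr_set d n (2 * r))) \<le> ereal (192 * real (d ^ n * r))"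
    by (rule order_trans)
next
  fix d n r t :: nat
  assume t: "1 \<le> t"
  let ?l = "ln (real (d ^ (2 * n)) / real (t\<^sup>2))"
  show "log_enat (mat_covering_number (d ^ n) (1 / 4) (lr_sparse_set d n r t)) \<le> ereal (192 * (real (t\<^sup>2) * ?l))"
  \<comment> \<open>Raising 38 to 192 needs a nonnegative logarithm, hence this case distinction
    again.\<close>
  proof (cases "2 * t\<^sup>2 \<le> d ^ (2 * n)")
    case True
    have "1 / 2 \<le> ?l" using t by (intro ln_ge_half[OF True]) (rule one_le_power)
    then have "0 \<le> real (t\<^sup>2) * ?l" by (intro mult_nonneg_nonneg) linarith+
    then have "ereal (38 * (real (t\<^sup>2) * ?l)) \<le> ereal (192 * (real (t\<^sup>2) * ?l))"
      unfolding ereal_less_eq by linarith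
    with log_lr_sparse_covering_le[OF t] show ?thesis by (rule order_trans)
  next
    case False
    then have "lr_sparse_set d n r t = {}"
      using sparse_set_empty[of d n "2 * t\<^sup>2"] by (auto simp: lr_sparse_set_def sparse_set_def)
    then show ?thesis by (simp add: log_mat_covering_number_empty)
  qed
next
  fix d n :: nat and r :: "nat \<Rightarrow> nat"
  assume *: "1 \<le> d" "2 \<le> n" "bond_dims n r"
  let ?s = "\<Sum>l = 1..n. real (d * r (l - 1) * r l) * ln (real n)"
  have "0 \<le> ?s" using *(2) by (intro sum_nonneg mult_nonneg_nonneg) auto
  then have "ereal (12 * ?s) \<le> ereal (192 * ?s)" unfolding ereal_less_eq by linarith
  with log_mps_covering_le[OF *] show "log_enat (vec_covering_number (d ^ n) (1 / (4 * real n)) (mps_set d n r)) \<le> ereal (192 * ?s)"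
    by (rule order_trans)
next
  fix d n :: nat and r :: "nat \<Rightarrow> nat"
  assume *: "1 \<le> d" "2 \<le> n" "bond_dims n r"
  let ?s = "\<Sum>l = 1..n. real (d\<^sup>2 * r (l - 1) * r l) * ln (real n)"
  have "0 \<le> ?s" using *(2) by (intro sum_nonneg mult_nonneg_nonneg) auto
  then have "ereal (12 * ?s) \<le> ereal (192 * ?s)" unfolding ereal_less_eq by linarith
  moreover have "r 0 = 1" "r n = 1" using *(3) by (auto simp: bond_dims_def)
  ultimately show "log_enat (mat_covering_number (d ^ n) (1 / (2 * real n)) (mpo_set d n r)) \<le> ereal (192 * ?s)"
    using log_mpo_covering_le[OF *(1,2) _ _ order_refl] by (meson order_trans)
next
  fix d n k :: nat and r :: "nat \<Rightarrow> nat"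
  assume *: "1 \<le> d" "2 \<le> n" "bond_dims n r"
  let ?b = "lr_mpo_bonds n r"
  have b: "?b 0 = 1" "?b n = 1" by (simp_all add: lr_mpo_bonds_def)
  let ?s = "\<Sum>l = 1..n. real (d\<^sup>2 * (r (l - 1))\<^sup>2 * (r l)\<^sup>2) * ln (real n)"
  have "0 \<le> ?s" using *(2) by (intro sum_nonneg mult_nonneg_nonneg) auto
  then have "ereal (12 * (\<Sum>l = 1..n. real (d\<^sup>2 * ?b (l - 1) * ?b l) * ln (real n))) \<le> ereal (192 * ?s)"
    unfolding ereal_less_eq using lr_mpo_sum_le[OF *(3,2), of d] by linarith
  moreover have "log_enat (mat_covering_number (d ^ n) (1 / (2 * real n)) (lr_mpo_set d n k r)) \<le>
      ereal (12 * (\<Sum>l = 1..n. real (d\<^sup>2 * ?b (l - 1) * ?b l) * ln (real n)))"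
    by (rule log_mpo_covering_le[OF *(1,2) b]) (auto simp: lr_mpo_set_def)
  ultimately show "log_enat (mat_covering_number (d ^ n) (1 / (2 * real n)) (lr_mpo_set d n k r)) \<le> ereal (192 * ?s)"
    by (rule order_trans[rotated])
next
  fix d q p n :: nat and D :: "lattice_edge \<Rightarrow> nat" and \<Lambda> :: "nat \<Rightarrow> nat \<Rightarrow> real" and L :: real
  assume *: "1 \<le> d" "n = q * p" "2 \<le> n" "lattice_bond_dims q p D" "\<forall>a\<in>{1..q}. \<forall>b\<in>{1..p}. 0 \<le> \<Lambda> a b"
  let ?s = "\<Sum>a = 1..q. \<Sum>b = 1..p. real (d * bond_product D a b) * ln (real n)"
  have "0 \<le> ?s" using *(3) by (intro sum_nonneg mult_nonneg_nonneg) auto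
  then have s: "ereal (12 * ?s) \<le> ereal (192 * ?s)" unfolding ereal_less_eq by linarith
  have e: "1 / (4 * real n) \<le> 1" using *(3) by simp
  show "log_enat (peps_sitewise_covering_number d q p D \<Lambda> L (1 / (4 * real n))) \<le> ereal (192 * ?s)"
    by (rule order_trans[OF log_peps_covering_le(1)[OF * order_refl e] s])
  show "log_enat (vec_covering_number (d ^ n) (lattice_resolution q p \<Lambda> (1 / (4 * real n))) (peps_set d q p D \<Lambda> L)) \<le> ereal (192 * ?s)"
    by (rule order_trans[OF log_peps_covering_le(2)[OF * order_refl e] s])
next
  fix d q p n :: nat and D :: "lattice_edge \<Rightarrow> nat" and \<Lambda> :: "nat \<Rightarrow> nat \<Rightarrow> real" and L :: real
  assume *: "1 \<le> d" "n = q * p" "2 \<le> n" "lattice_bond_dims q p D" "\<forall>a\<in>{1..q}. \<forall>b\<in>{1..p}. 0 \<le> \<Lambda> a b"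
  let ?s = "\<Sum>a = 1..q. \<Sum>b = 1..p. real (d\<^sup>2 * bond_product D a b) * ln (real n)"
  have "0 \<le> ?s" using *(3) by (intro sum_nonneg mult_nonneg_nonneg) auto
  then have s: "ereal (12 * ?s) \<le> ereal (192 * ?s)" unfolding ereal_less_eq by linarith
  have e: "1 / (4 * real n) \<le> 1 / (2 * real n)" "1 / (2 * real n) \<le> 1" using *(3) by (simp_all add: field_simps)
  show "log_enat (pepo_sitewise_covering_number d q p D \<Lambda> L (1 / (2 * real n))) \<le> ereal (192 * ?s)"
    by (rule order_trans[OF log_pepo_covering_le(1)[OF * e] s])
  show "log_enat (mat_covering_number (d ^ n) (lattice_resolution q p \<Lambda> (1 / (2 * real n))) (pepo_set d q p D \<Lambda> L)) \<le> ereal (192 * ?s)"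
    by (rule order_trans[OF log_pepo_covering_le(2)[OF * e] s])
next
  fix d q p n :: nat and D :: "lattice_edge \<Rightarrow> nat" and \<Lambda> :: "nat \<Rightarrow> nat \<Rightarrow> real" and L :: real
  assume *: "1 \<le> d" "n = q * p" "2 \<le> n" and D: "lattice_bond_dims q p D" and \<Lambda>: "\<forall>a\<in>{1..q}. \<forall>b\<in>{1..p}. 0 \<le> \<Lambda> a b"
  let ?D = "lr_pepo_bonds q p D"
  let ?s = "\<Sum>a = 1..q. \<Sum>b = 1..p. real (d\<^sup>2 * (bond_product D a b)\<^sup>2) * ln (real n)"
  have s: "ereal (12 * (\<Sum>a = 1..q. \<Sum>b = 1..p. real (d\<^sup>2 * bond_product ?D a b) * ln (real n))) \<le> ereal (192 * ?s)"
    unfolding ereal_less_eq by (rule lr_pepo_sum_le[OF D *(3)])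
  have e: "1 / (4 * real n) \<le> 1 / (2 * real n)" "1 / (2 * real n) \<le> 1" using *(3) by (simp_all add: field_simps)
  note D' = lattice_bond_dims_lr_pepo[OF D]
  show "log_enat (pepo_sitewise_covering_number d q p ?D \<Lambda> L (1 / (2 * real n))) \<le> ereal (192 * ?s)"
    by (rule order_trans[OF log_pepo_covering_le(1)[OF * D' \<Lambda> e] s])
  show "log_enat (mat_covering_number (d ^ n) (lattice_resolution q p \<Lambda> (1 / (2 * real n))) (pepo_set d q p ?D \<Lambda> L)) \<le> ereal (192 * ?s)"
    by (rule order_trans[OF log_pepo_covering_le(2)[OF * D' \<Lambda> e] s])
qed

end
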